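(* Let $N_1<N_2<\cdots$ be an increasing sequence of positive integers with $L/N_L\to 1$ as $L\to\infty$, and let $(\lambda(N_L))_{L\ge1}\in\prod_{L\ge 1}\mathrm{Sign}_{N_L}$ be a Vershik--Kerov sequence converging to $\omega\in\Omega$. For each $L$ let $(\pi_{N_L},V_{N_L})$ be the irreducible representation of $U(N_L)$ associated with $\lambda(N_L)$ and $\psi_{N_L}\in V_{N_L}$ a unit vector. Let $\mu_1,\dots,\mu_m$ be integer partitions, and for $s\geq 0$ and $L$ large enough (so that $N_L$ is at least the length of each $\mu_i$) let $$X^{(i)}_{N_L,s}:=\Lambda_s(\mathbb{S}_{\mu_i|N_L}),\qquad \widetilde X^{(i)}_{N_L,s}:=\frac{X^{(i)}_{N_L,s}-\langle X^{(i)}_{N_L,s}\rangle_{N_L,s}}{N_L^{|\mu_i|+1/2}}\qquad(i=1,\dots,m).$$ Then for every $t>0$ $$\lim_{L\to\infty}\langle\widetilde X^{(1)}_{N_L,Lt}\cdots\widetilde X^{(m)}_{N_L,Lt}\rangle_{N_L,Lt}=\begin{cases}\displaystyle\sum_{\pi\in\mathcal{P}_2(m)}\ \prod_{\{i,j\}\in\pi}t\,s_{\mu_i}(\omega)s_{\mu_j}(\omega) & m\text{ even},\\ 0& m\text{ odd},\end{cases}$$ where $\mathcal{P}_2(m)$ is the set of pair partitions of $\{1,\dots,m\}$. (That is, the processes with scaled time $Lt$ converge in the moment sense to a Gaussian family with covariance $t\,s_{\mu_i}(\omega)s_{\mu_j}(\omega)$.)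
   Context: Fock space. Inner products are linear in the first variable. $\mathcal{F}(\mathfrak{h})=\bigoplus_{n\ge 0}\mathfrak{h}^{\odot n}$ is the symmetric Fock space of a complex Hilbert space $\mathfrak h$, with exponential vectors $e(\psi)=\sum_{n\ge0}\frac{1}{\sqrt{n!}}\psi^{\odot n}$. For bounded self-adjoint $H$, $\Lambda(H)$ is the self-adjoint generator of the unitary group determined by $e^{\mathrm{i}r\Lambda(H)}e(\psi)=e(e^{\mathrm{i}rH}\psi)$; for $H\in B(\mathfrak{h})$, $\Lambda(H):=\Lambda\left(\frac{H+H^*}{2}\right)+\mathrm{i}\Lambda\left(\frac{H-H^*}{2\mathrm{i}}\right)$. Products of such operators are defined on exponential vectors. For $\mathfrak{h}=L^2(\mathbb{R}_{\ge0};V)\cong L^2(\mathbb{R}_{\ge 0})\otimes V$ and $\mathsf{h}\in B(V)$ put $\Lambda_s(1\otimes\mathsf{h}):=\Lambda((1\otimes\mathsf{h})_s)$, where $(1\otimes\mathsf{h})_s$ is $1\otimes\mathsf{h}$ composed with multiplication by $\mathbb{1}_{[0,s]}$. For $\varphi\in\mathfrak{h}$, $\langle X\rangle_\varphi:=\langle Xe(\varphi),e(\varphi)\rangle/\langle e(\varphi),e(\varphi)\rangle$. For $\psi\in V$, $\psi_s:=\mathbb{1}_{[0,s)}\otimes\psi$. Here $V=V_{N_L}$, $\mathfrak{h}_{N_L}=L^2(\mathbb{R}_{\ge0};V_{N_L})$, and $\langle\,\cdot\,\rangle_{N_L,s}:=\langle\,\cdot\,\rangle_{(\psi_{N_L})_s}$.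 Representations. $\mathrm{Sign}_N=\{\lambda=(\lambda_1\ge\dots\ge\lambda_N)\in\mathbb{Z}^N\}$ parametrizes the irreducible representations $(\pi_\lambda,V_\lambda)$ of $U(N)$ by highest weight; $\widetilde\pi_\lambda$ is the induced representation of the universal enveloping algebra $U(\mathfrak{gl}_N)$ on $V_\lambda$, and $Z(\mathfrak{gl}_N)$ is the center of $U(\mathfrak{gl}_N)$. For $X\in U(\mathfrak{gl}_{N_L})$ put $\Lambda_s(X):=\Lambda_s(1\otimes\widetilde\pi_{N_L}(X))$, with $\widetilde\pi_{N_L}:=\widetilde\pi_{\lambda(N_L)}$. For a partition $\mu$ of length at most $N$ (padded by zeros to $N$ entries), the shifted Schur polynomial is $$s^*_\mu(x_1,\dots,x_N)=\frac{\det[(x_i+N-i)^{\downarrow\mu_j+N-j}]_{i,j=1}^N}{\det[(x_i+N-i)^{\downarrow N-j}]_{i,j=1}^N},\quad x^{\downarrow k}=x(x-1)\cdots(x-k+1),\ x^{\downarrow 0}=1,$$ and the quantum immanant $\mathbb{S}_{\mu|N}\in Z(\mathfrak{gl}_N)$ is the element with $\widetilde\pi_\lambda(\mathbb{S}_{\mu|N})=s^*_\mu(\lambda)1_{V_\lambda}$ for all $\lambda\in\mathrm{Sign}_N$. $|\mu|$ is the sum of the parts of $\mu$. Parameters. $\Omega$ is the set of $\omega=(\alpha^+,\alpha^-,\beta^+,\beta^-,\gamma^+,\gamma^-)\in(\mathbb{R}_{\ge0}^\infty)^4\times\mathbb{R}_{\ge0}^2$ with $\alpha^\pm=(\alpha^\pm_1\ge\alpha^\pm_2\ge\cdots)$,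 $\beta^\pm=(\beta^\pm_1\ge\beta^\pm_2\ge\cdots)$, $\sum_i(\alpha^\pm_i+\beta^\pm_i)<\infty$, $\beta^+_1+\beta^-_1\le1$. Put $$\Phi_\omega(z)=e^{\gamma^+(z-1)+\gamma^-(z^{-1}-1)}\prod_{j\ge1}\frac{1+\beta^+_j(z-1)}{1-\alpha^+_j(z-1)}\,\frac{1+\beta^-_j(z^{-1}-1)}{1-\alpha^-_j(z^{-1}-1)}.$$ Define $h_k(\omega)$ by $\sum_{k\ge0}h_k(\omega)x^k=\Phi_\omega(1+x)$ (power series at $x=0$), $h_k(\omega)=0$ for $k<0$, and $s_\mu(\omega)=\det[h_{\mu_i-i+j}(\omega)]_{i,j=1}^n$ for a partition $\mu$ of length at most $n$. Vershik--Kerov sequences. For $\lambda\in\mathrm{Sign}_N$ write $\lambda=(\lambda^+_1,\lambda^+_2,\dots,-\lambda^-_2,-\lambda^-_1)$ with $\lambda^+,\lambda^-$ the partitions formed by the positive and negative parts; $\lambda^{\pm\prime}$ is the transposed diagram of $\lambda^\pm$, $a^\pm_i=\lambda^\pm_i-i+\frac12$, $b^\pm_i=\lambda^{\pm\prime}_i-i+\frac12$. The sequence $(\lambda(N_L))_L$ is a Vershik--Kerov sequence converging to $\omega$ if, with $a_i^\pm(N_L),b_i^\pm(N_L)$ computed from $\lambda(N_L)$, as $L\to\infty$: $a^\pm_i(N_L)/N_L\to\alpha^\pm_i$ and $b^\pm_i(N_L)/N_L\to\beta^\pm_i$ for all $i$, $|\lambda^\pm(N_L)|/N_L\to\delta^\pm$,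 and $\gamma^\pm=\delta^\pm-\sum_i(\alpha^\pm_i+\beta^\pm_i)$. *)

theory Defs
  imports
    "HOL-Complex_Analysis.Complex_Analysis"
    "HOL-Algebra.QuotRing"
    "HOL-Library.Poly_Mapping"
    "HOL-Library.Disjoint_Sets"
    "Jordan_Normal_Form.Schur_Decomposition"
    "Jordan_Normal_Form.VS_Connect"
begin

no_notation vec_nth (infixl \<open>$\<close> 90)
no_notation fps_nth (infixl \<open>$\<close> 75)


section \<open>Hilbert spaces of functions and their operators\<close>

text \<open>
  A Hilbert space is presented by a vector space of complex-valued functions (with the pointwise
  operations) and a positive semidefinite inner product, linear in the first variable.  Its elements
  are the functions modulo \<open>heq\<close>, the vectors of norm zero being identified with \<open>0\<close>; for
  \<open>L\<^sup>2\<close> spaces this is almost everywhere equality.  Operators act on representatives.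
\<close>

record 'x hspace =
  vecs :: "('x \<Rightarrow> complex) set"
  ip :: "('x \<Rightarrow> complex) \<Rightarrow> ('x \<Rightarrow> complex) \<Rightarrow> complex"

definition hnorm :: "'x hspace \<Rightarrow> ('x \<Rightarrow> complex) \<Rightarrow> real" where
  "hnorm H f = sqrt (Re (ip H f f))"

definition heq :: "'x hspace \<Rightarrow> ('x \<Rightarrow> complex) \<Rightarrow> ('x \<Rightarrow> complex) \<Rightarrow> bool" where
  "heq H f g \<longleftrightarrow> hnorm H (\<lambda>x. f x - g x) = 0"

definition linear_op :: "'x hspace \<Rightarrow> (('x \<Rightarrow> complex) \<Rightarrow> ('x \<Rightarrow> complex)) \<Rightarrow> bool" where
  "linear_op H A \<longleftrightarrow>
     (\<forall>f\<in>vecs H. A f \<in> vecs H) \<and>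
     (\<forall>f\<in>vecs H. \<forall>g\<in>vecs H. heq H (A (\<lambda>x. f x + g x)) (\<lambda>x. A f x + A g x)) \<and>
     (\<forall>f\<in>vecs H. \<forall>c. heq H (A (\<lambda>x. c * f x)) (\<lambda>x. c * A f x))"

definition bounded_op :: "'x hspace \<Rightarrow> (('x \<Rightarrow> complex) \<Rightarrow> ('x \<Rightarrow> complex)) \<Rightarrow> bool" where
  "bounded_op H A \<longleftrightarrow>
     linear_op H A \<and> (\<exists>K. \<forall>f\<in>vecs H. hnorm H (A f) \<le> K * hnorm H f)"

definition unitary_op :: "'x hspace \<Rightarrow> (('x \<Rightarrow> complex) \<Rightarrow> ('x \<Rightarrow> complex)) \<Rightarrow> bool" where
  "unitary_op H U \<longleftrightarrow>
     linear_op H U \<and>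
     (\<forall>f\<in>vecs H. \<forall>g\<in>vecs H. ip H (U f) (U g) = ip H f g) \<and>
     (\<forall>g\<in>vecs H. \<exists>f\<in>vecs H. heq H (U f) g)"

definition op_adjoint ::
    "'x hspace \<Rightarrow> (('x \<Rightarrow> complex) \<Rightarrow> ('x \<Rightarrow> complex)) \<Rightarrow> ('x \<Rightarrow> complex) \<Rightarrow> ('x \<Rightarrow> complex)" where
  "op_adjoint H A =
     (SOME B. bounded_op H B \<and> (\<forall>f\<in>vecs H. \<forall>g\<in>vecs H. ip H (A f) g = ip H f (B g)))"

definition op_exp ::
    "'x hspace \<Rightarrow> (('x \<Rightarrow> complex) \<Rightarrow> ('x \<Rightarrow> complex)) \<Rightarrow> ('x \<Rightarrow> complex) \<Rightarrow> ('x \<Rightarrow> complex)" where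
  "op_exp H A f =
     (SOME g. g \<in> vecs H \<and>
        (\<lambda>n. hnorm H (\<lambda>x. g x - (\<Sum>k<n. (A ^^ k) f x / fact k))) \<longlonglongrightarrow> 0)"

text \<open>
  Stone's theorem: the self-adjoint \<open>T\<close> with \<open>U r = exp (\<i> r T)\<close> has as domain the vectors \<open>F\<close> for
  which the limit below exists, and \<open>T F\<close> is that limit.  Outside of the domain the value is
  arbitrary, as for \<^const>\<open>deriv\<close>.
\<close>

definition op_generator ::
    "'x hspace \<Rightarrow> (real \<Rightarrow> ('x \<Rightarrow> complex) \<Rightarrow> ('x \<Rightarrow> complex)) \<Rightarrow> ('x \<Rightarrow> complex) \<Rightarrow> ('x \<Rightarrow> complex)" where
  "op_generator H U F =
     (SOME G. G \<in> vecs H \<and>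
        ((\<lambda>r::real. hnorm H (\<lambda>x. (U r F x - F x) / (\<i> * complex_of_real r) - G x)) \<longlongrightarrow> 0) (at 0))"


section \<open>Fock space\<close>

definition L2 :: "'a measure \<Rightarrow> 'a hspace" where
  "L2 M = \<lparr>vecs = {f. f \<in> borel_measurable M \<and> integrable M (\<lambda>x. (cmod (f x))\<^sup>2)},
           ip = (\<lambda>f g. LINT x|M. f x * cnj (g x))\<rparr>"

text \<open>
  The symmetric Fock space over \<open>L\<^sup>2(M)\<close>: the \<open>n\<close>-th tensor power of \<open>L\<^sup>2(M)\<close> is \<open>L\<^sup>2(M\<^sup>n)\<close>, with
  \<open>(f\<^sub>0 \<otimes> \<dots> \<otimes> f\<^sub>n\<^sub>-\<^sub>1)(x) = f\<^sub>0(x\<^sub>0) \<dots> f\<^sub>n\<^sub>-\<^sub>1(x\<^sub>n\<^sub>-\<^sub>1)\<close>, and the \<open>n\<close>-th symmetric power consists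
  of the symmetric elements.  The \<open>n\<close>-particle component of \<open>F\<close> is \<open>\<lambda>x. F (n, x)\<close>.
\<close>

definition nfold :: "'a measure \<Rightarrow> nat \<Rightarrow> (nat \<Rightarrow> 'a) measure" where
  "nfold M n = (\<Pi>\<^sub>M i\<in>{..<n}. M)"

definition fock :: "'a measure \<Rightarrow> (nat \<times> (nat \<Rightarrow> 'a)) hspace" where
  "fock M =
     \<lparr>vecs = {F. (\<forall>n. (\<lambda>x. F (n, x)) \<in> vecs (L2 (nfold M n))) \<and>
                 (\<forall>n \<sigma>. \<sigma> permutes {..<n} \<longrightarrow> (AE x in nfold M n. F (n, x \<circ> \<sigma>) = F (n, x))) \<and>
                 summable (\<lambda>n. (hnorm (L2 (nfold M n)) (\<lambda>x. F (n, x)))\<^sup>2)},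
      ip = (\<lambda>F G. suminf (\<lambda>n. ip (L2 (nfold M n)) (\<lambda>x. F (n, x)) (\<lambda>x. G (n, x))))\<rparr>"

definition exp_vec :: "('a \<Rightarrow> complex) \<Rightarrow> nat \<times> (nat \<Rightarrow> 'a) \<Rightarrow> complex" where
  "exp_vec \<psi> = (\<lambda>(n, x). (\<Prod>i<n. \<psi> (x i)) / complex_of_real (sqrt (fact n)))"

text \<open>
  For bounded self-adjoint \<open>H\<close> the group is determined up to \<open>heq\<close> by its values on the
  exponential vectors, which span a dense subspace.
\<close>

definition second_quant_group ::
    "'a measure \<Rightarrow> (('a \<Rightarrow> complex) \<Rightarrow> ('a \<Rightarrow> complex)) \<Rightarrow>
     real \<Rightarrow> (nat \<times> (nat \<Rightarrow> 'a) \<Rightarrow> complex) \<Rightarrow> (nat \<times> (nat \<Rightarrow> 'a) \<Rightarrow> complex)" where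
  "second_quant_group M H =
     (SOME U. \<forall>r. unitary_op (fock M) (U r) \<and>
        (\<forall>\<psi>\<in>vecs (L2 M).
           heq (fock M) (U r (exp_vec \<psi>))
             (exp_vec (op_exp (L2 M) (\<lambda>f x. \<i> * complex_of_real r * H f x) \<psi>))))"

definition Lambda_sa ::
    "'a measure \<Rightarrow> (('a \<Rightarrow> complex) \<Rightarrow> ('a \<Rightarrow> complex)) \<Rightarrow>
     (nat \<times> (nat \<Rightarrow> 'a) \<Rightarrow> complex) \<Rightarrow> (nat \<times> (nat \<Rightarrow> 'a) \<Rightarrow> complex)" where
  "Lambda_sa M H = op_generator (fock M) (second_quant_group M H)"

definition Lambda ::
    "'a measure \<Rightarrow> (('a \<Rightarrow> complex) \<Rightarrow> ('a \<Rightarrow> complex)) \<Rightarrow>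
     (nat \<times> (nat \<Rightarrow> 'a) \<Rightarrow> complex) \<Rightarrow> (nat \<times> (nat \<Rightarrow> 'a) \<Rightarrow> complex)" where
  "Lambda M H F =
     (\<lambda>y. Lambda_sa M (\<lambda>f x. (H f x + op_adjoint (L2 M) H f x) / 2) F y
          + \<i> * Lambda_sa M (\<lambda>f x. (H f x - op_adjoint (L2 M) H f x) / (2 * \<i>)) F y)"

definition fock_expect ::
    "'a measure \<Rightarrow> ('a \<Rightarrow> complex) \<Rightarrow>
     ((nat \<times> (nat \<Rightarrow> 'a) \<Rightarrow> complex) \<Rightarrow> (nat \<times> (nat \<Rightarrow> 'a) \<Rightarrow> complex)) \<Rightarrow> complex" where
  "fock_expect M \<phi> X =
     ip (fock M) (X (exp_vec \<phi>)) (exp_vec \<phi>) / ip (fock M) (exp_vec \<phi>) (exp_vec \<phi>)"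

text \<open>
  The finite-dimensional Hilbert space \<open>V\<close> is \<open>\<complex>\<^sup>d\<close> with its standard inner product, so that
  \<open>L\<^sup>2(\<real>\<^sub>\<ge>\<^sub>0; V) = L\<^sup>2(\<real>\<^sub>\<ge>\<^sub>0 \<times> {0, \<dots>, d - 1})\<close>: a function \<open>f\<close> has value \<open>(f (t, i))\<^sub>i\<close> at \<open>t\<close>.
\<close>

definition time_space :: "nat \<Rightarrow> (real \<times> nat) measure" where
  "time_space d = restrict_space lborel {0..} \<Otimes>\<^sub>M count_space {..<d}"

definition one_tensor :: "nat \<Rightarrow> complex Matrix.mat \<Rightarrow> real \<Rightarrow>
    (real \<times> nat \<Rightarrow> complex) \<Rightarrow> (real \<times> nat \<Rightarrow> complex)" where
  "one_tensor d h s f = (\<lambda>(u, i). indicator {0..s} u * (\<Sum>j<d. h $$ (i, j) * f (u, j)))"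

definition Lambda_s :: "nat \<Rightarrow> real \<Rightarrow> complex Matrix.mat \<Rightarrow>
    (nat \<times> (nat \<Rightarrow> real \<times> nat) \<Rightarrow> complex) \<Rightarrow> (nat \<times> (nat \<Rightarrow> real \<times> nat) \<Rightarrow> complex)" where
  "Lambda_s d s h = Lambda (time_space d) (one_tensor d h s)"

definition state_vec :: "complex Matrix.vec \<Rightarrow> real \<Rightarrow> real \<times> nat \<Rightarrow> complex" where
  "state_vec \<psi> s = (\<lambda>(u, i). indicator {0..<s} u * \<psi> $ i)"


section \<open>The universal enveloping algebra of \<open>gl\<^sub>N\<close>\<close>

text \<open>
  Noncommutative polynomials in letters \<open>E\<^sub>i\<^sub>j\<close> are finitely supported functions on words; the
  convolution product of \<^typ>\<open>'a \<Rightarrow>\<^sub>0 'b\<close> is the product of the free algebra once words form a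
  monoid under concatenation.  Indices of the letters start at 0.
\<close>

datatype word = Word (letters: "(nat \<times> nat) list")

instantiation word :: monoid_add
begin
definition "0 = Word []"
definition "v + w = Word (letters v @ letters w)"
instance by standard (auto simp: zero_word_def plus_word_def)
end

definition free_alg :: "nat \<Rightarrow> (word \<Rightarrow>\<^sub>0 complex) ring" where
  "free_alg N =
     \<lparr>carrier = {p. \<forall>w\<in>Poly_Mapping.keys p. set (letters w) \<subseteq> {..<N} \<times> {..<N}},
      mult = (*), one = 1, zero = 0, add = (+)\<rparr>"

lemma ring_free_alg: "ring (free_alg N)"
proof (rule ringI)
  show "abelian_group (free_alg N)"
  proof (rule abelian_groupI)
    fix x assume "x \<in> carrier (free_alg N)"
    then show "\<exists>y\<in>carrier (free_alg N). y \<oplus>\<^bsub>free_alg N\<^esub> x = \<zero>\<^bsub>free_alg N\<^esub>"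
      by (intro bexI[of _ "- x"]) (auto simp: free_alg_def)
  qed (use Poly_Mapping.keys_add in \<open>fastforce simp: free_alg_def add_ac\<close>)+
  show "Group.monoid (free_alg N)"
  proof (rule monoidI)
    fix x y assume "x \<in> carrier (free_alg N)" "y \<in> carrier (free_alg N)"
    then show "x \<otimes>\<^bsub>free_alg N\<^esub> y \<in> carrier (free_alg N)"
      using keys_mult[of x y] by (fastforce simp: free_alg_def plus_word_def)
  qed (auto simp: free_alg_def mult.assoc zero_word_def)
qed (auto simp: free_alg_def algebra_simps)

definition gl_gen :: "nat \<Rightarrow> nat \<Rightarrow> word \<Rightarrow>\<^sub>0 complex" where
  "gl_gen i j = Poly_Mapping.single (Word [(i, j)]) 1"

definition gl_relations :: "nat \<Rightarrow> (word \<Rightarrow>\<^sub>0 complex) set" where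
  "gl_relations N =
     {gl_gen i j * gl_gen k l - gl_gen k l * gl_gen i j
        - ((if j = k then gl_gen i l else 0) - (if l = i then gl_gen k j else 0)) | i j k l.
        i < N \<and> j < N \<and> k < N \<and> l < N}"

definition U_gl :: "nat \<Rightarrow> (word \<Rightarrow>\<^sub>0 complex) set ring" where
  "U_gl N = free_alg N Quot (Idl\<^bsub>free_alg N\<^esub> (gl_relations N))"

definition Z_gl :: "nat \<Rightarrow> (word \<Rightarrow>\<^sub>0 complex) set set" where
  "Z_gl N = {X \<in> carrier (U_gl N). \<forall>Y \<in> carrier (U_gl N). X \<otimes>\<^bsub>U_gl N\<^esub> Y = Y \<otimes>\<^bsub>U_gl N\<^esub> X}"


section \<open>Representations of the unitary group\<close>

definition unitary_group :: "nat \<Rightarrow> complex Matrix.mat monoid" where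
  "unitary_group N =
     \<lparr>carrier = {g \<in> carrier_mat N N. g * mat_adjoint g = 1\<^sub>m N}, mult = (*), one = 1\<^sub>m N\<rparr>"

definition unitary_rep :: "nat \<Rightarrow> nat \<Rightarrow> (complex Matrix.mat \<Rightarrow> complex Matrix.mat) \<Rightarrow> bool" where
  "unitary_rep N d \<pi> \<longleftrightarrow>
     \<pi> \<in> hom (unitary_group N) (unitary_group d) \<and>
     (\<forall>g g0. range g \<subseteq> carrier (unitary_group N) \<longrightarrow> g0 \<in> carrier (unitary_group N) \<longrightarrow>
        (\<forall>i<N. \<forall>j<N. (\<lambda>k::nat. g k $$ (i, j)) \<longlonglongrightarrow> g0 $$ (i, j)) \<longrightarrow>
        (\<forall>i<d. \<forall>j<d. (\<lambda>k. \<pi> (g k) $$ (i, j)) \<longlonglongrightarrow> \<pi> g0 $$ (i, j)))"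

definition irreducible_rep :: "nat \<Rightarrow> nat \<Rightarrow> (complex Matrix.mat \<Rightarrow> complex Matrix.mat) \<Rightarrow> bool" where
  "irreducible_rep N d \<pi> \<longleftrightarrow>
     unitary_rep N d \<pi> \<and> 0 < d \<and>
     (\<forall>W. subspace class_ring W (module_vec TYPE(complex) d) \<longrightarrow>
        (\<forall>g\<in>carrier (unitary_group N). \<forall>w\<in>W. \<pi> g *\<^sub>v w \<in> W) \<longrightarrow>
        W = {0\<^sub>v d} \<or> W = carrier_vec d)"

definition mat_exp :: "nat \<Rightarrow> complex Matrix.mat \<Rightarrow> complex Matrix.mat" where
  "mat_exp N A = Matrix.mat N N (\<lambda>(i, j). suminf (\<lambda>k. (A ^\<^sub>m k) $$ (i, j) / fact k))"

text \<open>The differential at the identity, for skew-Hermitian \<open>A\<close>.\<close>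

definition rep_deriv :: "nat \<Rightarrow> nat \<Rightarrow> (complex Matrix.mat \<Rightarrow> complex Matrix.mat) \<Rightarrow>
    complex Matrix.mat \<Rightarrow> complex Matrix.mat" where
  "rep_deriv N d \<pi> A = Matrix.mat d d (\<lambda>(i, j).
     vector_derivative (\<lambda>r::real. \<pi> (mat_exp N (complex_of_real r \<cdot>\<^sub>m A)) $$ (i, j)) (at 0))"

text \<open>
  Its complex-linear extension to \<open>gl\<^sub>N\<close>, where \<open>A = (A - A\<^sup>*)/2 + \<i> (A + A\<^sup>*)/(2\<i>)\<close> is the
  decomposition of \<open>A\<close> along \<open>u(N) \<oplus> \<i> u(N)\<close>.
\<close>

definition gl_rep :: "nat \<Rightarrow> nat \<Rightarrow> (complex Matrix.mat \<Rightarrow> complex Matrix.mat) \<Rightarrow>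
    complex Matrix.mat \<Rightarrow> complex Matrix.mat" where
  "gl_rep N d \<pi> A =
     rep_deriv N d \<pi> ((1 / 2) \<cdot>\<^sub>m (A - mat_adjoint A))
     + \<i> \<cdot>\<^sub>m rep_deriv N d \<pi> ((1 / (2 * \<i>)) \<cdot>\<^sub>m (A + mat_adjoint A))"

definition mat_unit :: "nat \<Rightarrow> nat \<Rightarrow> nat \<Rightarrow> complex Matrix.mat" where
  "mat_unit N i j = Matrix.mat N N (\<lambda>(k, l). if k = i \<and> l = j then 1 else 0)"

definition free_rep :: "nat \<Rightarrow> nat \<Rightarrow> (complex Matrix.mat \<Rightarrow> complex Matrix.mat) \<Rightarrow>
    (word \<Rightarrow>\<^sub>0 complex) \<Rightarrow> complex Matrix.mat" where
  "free_rep N d \<pi> p = Matrix.mat d d (\<lambda>(r, c).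
     \<Sum>w\<in>Poly_Mapping.keys p. Poly_Mapping.lookup p w *
       foldr (\<lambda>(i, j) B. gl_rep N d \<pi> (mat_unit N i j) * B) (letters w) (1\<^sub>m d) $$ (r, c))"

text \<open>
  An element of \<open>U(gl\<^sub>N)\<close> is a coset; the map \<^const>\<open>free_rep\<close> is constant on it when \<open>\<pi>\<close> is a
  representation.
\<close>

definition U_rep :: "nat \<Rightarrow> nat \<Rightarrow> (complex Matrix.mat \<Rightarrow> complex Matrix.mat) \<Rightarrow>
    (word \<Rightarrow>\<^sub>0 complex) set \<Rightarrow> complex Matrix.mat" where
  "U_rep N d \<pi> X = the_elem (free_rep N d \<pi> ` X)"

definition Sign :: "nat \<Rightarrow> int list set" where
  "Sign N = {l. length l = N \<and> sorted_wrt (\<ge>) l}"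

text \<open>\<open>\<pi>\<close> is an irreducible representation of \<open>U(N)\<close> on \<open>\<complex>\<^sup>d\<close> with highest weight \<open>l\<close>.\<close>

definition irrep :: "nat \<Rightarrow> int list \<Rightarrow> nat \<Rightarrow> (complex Matrix.mat \<Rightarrow> complex Matrix.mat) \<Rightarrow> bool" where
  "irrep N l d \<pi> \<longleftrightarrow>
     irreducible_rep N d \<pi> \<and>
     (\<exists>v\<in>carrier_vec d. v \<noteq> 0\<^sub>v d \<and>
        (\<forall>i<N. \<forall>j<N. i < j \<longrightarrow> gl_rep N d \<pi> (mat_unit N i j) *\<^sub>v v = 0\<^sub>v d) \<and>
        (\<forall>i<N. gl_rep N d \<pi> (mat_unit N i i) *\<^sub>v v = of_int (l ! i) \<cdot>\<^sub>v v))"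


section \<open>Quantum immanants\<close>

definition int_partition :: "nat list \<Rightarrow> bool" where
  "int_partition \<mu> \<longleftrightarrow> sorted_wrt (\<ge>) \<mu> \<and> 0 \<notin> set \<mu>"

definition part :: "nat list \<Rightarrow> nat \<Rightarrow> nat" where
  "part \<mu> i = (if i < length \<mu> then \<mu> ! i else 0)"

definition falling :: "complex \<Rightarrow> nat \<Rightarrow> complex" where
  "falling x k = (\<Prod>i<k. x - of_nat i)"

text \<open>Rows and columns are indexed from 0, so \<open>N - i\<close> becomes \<open>N - 1 - i\<close>.\<close>

definition shifted_schur :: "nat \<Rightarrow> nat list \<Rightarrow> (nat \<Rightarrow> complex) \<Rightarrow> complex" where
  "shifted_schur N \<mu> x =
     Determinant.det (Matrix.mat N N (\<lambda>(i, j).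
       falling (x i + of_nat (N - 1 - i)) (part \<mu> j + (N - 1 - j))))
     / Determinant.det (Matrix.mat N N (\<lambda>(i, j).
       falling (x i + of_nat (N - 1 - i)) (N - 1 - j)))"

definition quantum_immanant :: "nat \<Rightarrow> nat list \<Rightarrow> (word \<Rightarrow>\<^sub>0 complex) set \<Rightarrow> bool" where
  "quantum_immanant N \<mu> S \<longleftrightarrow>
     S \<in> Z_gl N \<and>
     (\<forall>l\<in>Sign N. \<forall>d \<pi>. irrep N l d \<pi> \<longrightarrow>
        U_rep N d \<pi> S = shifted_schur N \<mu> (\<lambda>i. of_int (l ! i)) \<cdot>\<^sub>m 1\<^sub>m d)"


section \<open>Vershik--Kerov sequences\<close>

text \<open>All sequences are indexed from 0: \<open>alpha_p \<omega> i\<close> is \<open>\<alpha>\<^sup>+\<^sub>i\<^sub>+\<^sub>1\<close>.\<close>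

record vk_param =
  alpha_p :: "nat \<Rightarrow> real"
  alpha_m :: "nat \<Rightarrow> real"
  beta_p :: "nat \<Rightarrow> real"
  beta_m :: "nat \<Rightarrow> real"
  gamma_p :: real
  gamma_m :: real

definition Omega :: "vk_param set" where
  "Omega = {\<omega>.
     (\<forall>a\<in>{alpha_p \<omega>, alpha_m \<omega>, beta_p \<omega>, beta_m \<omega>}. antimono a \<and> (\<forall>i. 0 \<le> a i)) \<and>
     0 \<le> gamma_p \<omega> \<and> 0 \<le> gamma_m \<omega> \<and>
     summable (\<lambda>i. alpha_p \<omega> i + beta_p \<omega> i) \<and>
     summable (\<lambda>i. alpha_m \<omega> i + beta_m \<omega> i) \<and>
     beta_p \<omega> 0 + beta_m \<omega> 0 \<le> 1}"

definition Phi :: "vk_param \<Rightarrow> complex \<Rightarrow> complex" where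
  "Phi \<omega> z =
     exp (complex_of_real (gamma_p \<omega>) * (z - 1) + complex_of_real (gamma_m \<omega>) * (inverse z - 1)) *
     prodinf (\<lambda>j. (1 + complex_of_real (beta_p \<omega> j) * (z - 1))
            / (1 - complex_of_real (alpha_p \<omega> j) * (z - 1)) *
          ((1 + complex_of_real (beta_m \<omega> j) * (inverse z - 1))
            / (1 - complex_of_real (alpha_m \<omega> j) * (inverse z - 1))))"

definition h_coeff :: "vk_param \<Rightarrow> int \<Rightarrow> complex" where
  "h_coeff \<omega> k =
     (if k < 0 then 0 else fps_nth (fps_expansion (\<lambda>x. Phi \<omega> (1 + x)) 0) (nat k))"

definition schur_omega :: "nat list \<Rightarrow> vk_param \<Rightarrow> complex" where
  "schur_omega \<mu> \<omega> = Determinant.det (Matrix.mat (length \<mu>) (length \<mu>)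
     (\<lambda>(i, j). h_coeff \<omega> (int (\<mu> ! i) - int i + int j)))"

definition pos_part :: "int list \<Rightarrow> nat \<Rightarrow> nat" where
  "pos_part l i = (if i < length l then nat (l ! i) else 0)"

definition neg_part :: "int list \<Rightarrow> nat \<Rightarrow> nat" where
  "neg_part l i = (if i < length l then nat (- (l ! (length l - 1 - i))) else 0)"

definition transposed :: "(nat \<Rightarrow> nat) \<Rightarrow> nat \<Rightarrow> nat" where
  "transposed p i = card {j. i < p j}"

definition frob_coord :: "(nat \<Rightarrow> nat) \<Rightarrow> nat \<Rightarrow> real" where
  "frob_coord p i = real (p i) - real (Suc i) + 1 / 2"

definition diagram_size :: "(nat \<Rightarrow> nat) \<Rightarrow> nat" where
  "diagram_size p = (\<Sum>i | p i \<noteq> 0. p i)"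

definition vk_half :: "(nat \<Rightarrow> nat) \<Rightarrow> (nat \<Rightarrow> nat \<Rightarrow> nat) \<Rightarrow>
    (nat \<Rightarrow> real) \<Rightarrow> (nat \<Rightarrow> real) \<Rightarrow> real \<Rightarrow> bool" where
  "vk_half N p \<alpha> \<beta> \<gamma> \<longleftrightarrow>
     (\<forall>i. (\<lambda>L. frob_coord (p L) i / real (N L)) \<longlonglongrightarrow> \<alpha> i) \<and>
     (\<forall>i. (\<lambda>L. frob_coord (transposed (p L)) i / real (N L)) \<longlonglongrightarrow> \<beta> i) \<and>
     (\<exists>\<delta>. (\<lambda>L. real (diagram_size (p L)) / real (N L)) \<longlonglongrightarrow> \<delta> \<and>
          \<gamma> = \<delta> - suminf (\<lambda>i. \<alpha> i + \<beta> i))"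

definition vershik_kerov :: "(nat \<Rightarrow> nat) \<Rightarrow> (nat \<Rightarrow> int list) \<Rightarrow> vk_param \<Rightarrow> bool" where
  "vershik_kerov N lam \<omega> \<longleftrightarrow>
     vk_half N (\<lambda>L. pos_part (lam L)) (alpha_p \<omega>) (beta_p \<omega>) (gamma_p \<omega>) \<and>
     vk_half N (\<lambda>L. neg_part (lam L)) (alpha_m \<omega>) (beta_m \<omega>) (gamma_m \<omega>)"


section \<open>The rescaled operators\<close>

definition X_op :: "nat \<Rightarrow> nat \<Rightarrow> (complex Matrix.mat \<Rightarrow> complex Matrix.mat) \<Rightarrow>
    (word \<Rightarrow>\<^sub>0 complex) set \<Rightarrow> real \<Rightarrow>
    (nat \<times> (nat \<Rightarrow> real \<times> nat) \<Rightarrow> complex) \<Rightarrow> (nat \<times> (nat \<Rightarrow> real \<times> nat) \<Rightarrow> complex)" where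
  "X_op N d \<pi> S s = Lambda_s d s (U_rep N d \<pi> S)"

definition X_tilde :: "nat \<Rightarrow> nat \<Rightarrow> (complex Matrix.mat \<Rightarrow> complex Matrix.mat) \<Rightarrow>
    complex Matrix.vec \<Rightarrow> nat list \<Rightarrow> (word \<Rightarrow>\<^sub>0 complex) set \<Rightarrow> real \<Rightarrow>
    (nat \<times> (nat \<Rightarrow> real \<times> nat) \<Rightarrow> complex) \<Rightarrow> (nat \<times> (nat \<Rightarrow> real \<times> nat) \<Rightarrow> complex)" where
  "X_tilde N d \<pi> \<psi> \<mu> S s F = (\<lambda>y.
     (X_op N d \<pi> S s F y
        - fock_expect (time_space d) (state_vec \<psi> s) (X_op N d \<pi> S s) * F y)
     / complex_of_real (real N powr (real (sum_list \<mu>) + 1 / 2)))"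

definition pair_partitions :: "nat \<Rightarrow> nat set set set" where
  "pair_partitions m = {P. partition_on {1..m} P \<and> (\<forall>B\<in>P. card B = 2)}"

end

(*
  A quantum immanant acts on an irreducible representation as a scalar c, so its second quantization
  is c times the number operator of the time interval [0,s].  In the exponential state of a unit
  vector this number operator has the Poisson distribution of mean s, hence the mixed moment is the
  product of the scalars c_i / N^(|mu_i| + 1/2) and of a central Poisson moment.  With s = L t, the
  latter is asymptotic to s^(m/2) times the number of pairings.

  It remains to see that the shifted Schur polynomial satisfies s*_mu(lambda) / N^|mu| -> s_mu(omega).
  The quotient of determinants is the determinant of the coefficients of falling factorials, reduced
  modulo the polynomial with roots lambda_i + N - i, in the basis of falling factorials of degree
  less than N.  A three-term recursion reduces these coefficients, in the limit, to the leading ones;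
  their generating function is a product over i, hence they obey Newton's identities with the power
  sums of (lambda_i - i) minus those of (-i).  The power sums converge because they are power sums
  of the Frobenius coordinates, and the coefficients of Phi_omega(1 + x) obey the same identities.
*)

theory Submission
  imports Defs
begin

section \<open>Semi-inner product spaces\<close>

text \<open>Everything between a matrix and \<open>Lambda\<close> is defined by \<open>SOME\<close>,
  so an operator is known only through its specification and only up to \<open>heq\<close>; moreover
  the unitary group is prescribed on exponential vectors alone. This forces a class of vectors on
  which all of it can be computed: \<open>exp_comb a \<phi>\<close>, whose n-particle part is
  \<open>a n\<close> times that of the exponential vector, with \<open>a\<close> of polynomial
  growth. Isometry fixes the group on this class, growth makes its members differentiable along the
  group, and the generator multiplies \<open>a n\<close> by a multiple of \<open>n\<close>. Since
  operators act on representatives and need not respect \<open>heq\<close>, each such fact is stated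
  for all \<open>F\<close> that equal \<open>exp_comb a \<phi>\<close> up to \<open>heq\<close>.

  On the algebraic side the obstacle is that the size of the determinants grows with N; reduction
  modulo the node polynomial cuts it down to the length of mu. Power sums are compared with those of
  the empty diagram because each of them alone can be of order N^(k+1), one order too large for the
  scaling by N^k.\<close>

locale semi_inner_space =
  fixes H :: "'x hspace"
  assumes add_closed: "f \<in> vecs H \<Longrightarrow> g \<in> vecs H \<Longrightarrow> (\<lambda>x. f x + g x) \<in> vecs H"
    and scale_closed: "f \<in> vecs H \<Longrightarrow> (\<lambda>x. c * f x) \<in> vecs H"
    and ip_add_left: "f \<in> vecs H \<Longrightarrow> g \<in> vecs H \<Longrightarrow> h \<in> vecs H \<Longrightarrow>
          ip H (\<lambda>x. f x + g x) h = ip H f h + ip H g h"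
    and ip_scale_left: "f \<in> vecs H \<Longrightarrow> h \<in> vecs H \<Longrightarrow> ip H (\<lambda>x. c * f x) h = c * ip H f h"
    and ip_commute: "f \<in> vecs H \<Longrightarrow> g \<in> vecs H \<Longrightarrow> ip H f g = cnj (ip H g f)"
    and ip_self_nonneg: "f \<in> vecs H \<Longrightarrow> 0 \<le> Re (ip H f f)"
begin

lemma diff_closed: 
  assumes "f \<in> vecs H" "g \<in> vecs H" shows "(\<lambda>x. f x - g x) \<in> vecs H"
  using add_closed[OF assms(1) scale_closed[OF assms(2), of "-1"]] by simp

lemma ip_diff_left:
  assumes "f \<in> vecs H" "g \<in> vecs H" "h \<in> vecs H"
  shows "ip H (\<lambda>x. f x - g x) h = ip H f h - ip H g h"
  using ip_add_left[OF assms(1) scale_closed[OF assms(2), of "-1"] assms(3)]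
    ip_scale_left[OF assms(2,3), of "-1"] by simp

lemma ip_diff_right:
  assumes "f \<in> vecs H" "g \<in> vecs H" "h \<in> vecs H"
  shows "ip H h (\<lambda>x. f x - g x) = ip H h f - ip H h g"
  using ip_diff_left[OF assms] ip_commute[OF assms(3) diff_closed[OF assms(1,2)]]
    ip_commute[OF assms(3,1)] ip_commute[OF assms(3,2)] by simp

lemma ip_scale_right:
  assumes "f \<in> vecs H" "h \<in> vecs H"
  shows "ip H h (\<lambda>x. c * f x) = cnj c * ip H h f"
  using ip_scale_left[OF assms] ip_commute[OF assms(2) scale_closed[OF assms(1)]]
    ip_commute[OF assms(2,1)] by simp

lemma ip_self_real: "f \<in> vecs H \<Longrightarrow> ip H f f = complex_of_real (Re (ip H f f))"
  using ip_commute[of f f] by (metis Reals_cnj_iff complex_is_Real_iff complex_eq_iff Im_complex_of_real Re_complex_of_real)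

lemma hnorm_nonneg: "f \<in> vecs H \<Longrightarrow> 0 \<le> hnorm H f"
  by (simp add: hnorm_def ip_self_nonneg)

lemma hnorm_sq: "f \<in> vecs H \<Longrightarrow> (hnorm H f)\<^sup>2 = Re (ip H f f)"
  by (simp add: hnorm_def ip_self_nonneg)

lemma ip_self: "f \<in> vecs H \<Longrightarrow> ip H f f = complex_of_real ((hnorm H f)\<^sup>2)"
  using ip_self_real hnorm_sq by metis

lemma hnorm_diff_sq:
  assumes "f \<in> vecs H" "g \<in> vecs H"
  shows "(hnorm H (\<lambda>x. f x - g x))\<^sup>2 = (hnorm H f)\<^sup>2 + (hnorm H g)\<^sup>2 - 2 * Re (ip H f g)"
  using ip_commute[OF assms]
  by (simp add: hnorm_sq assms diff_closed ip_diff_left ip_diff_right)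

lemma hnorm_scale: 
  assumes "f \<in> vecs H" shows "hnorm H (\<lambda>x. c * f x) = cmod c * hnorm H f"
proof -
  have "ip H (\<lambda>x. c * f x) (\<lambda>x. c * f x) = (c * cnj c) * ip H f f"
    using assms by (simp add: ip_scale_left ip_scale_right scale_closed)
  also have "\<dots> = complex_of_real ((cmod c)\<^sup>2) * ip H f f"
    using complex_norm_square[of c] by simp
  finally have "Re (ip H (\<lambda>x. c * f x) (\<lambda>x. c * f x)) = (cmod c)\<^sup>2 * Re (ip H f f)" by simp
  then show ?thesis by (simp add: hnorm_def real_sqrt_mult)
qed

text \<open>The norm of \<open>f - r <f,g> g\<close> is nonnegative for every real \<open>r\<close>.
  The form may be degenerate, so \<open>hnorm H g = 0\<close> is a separate case, in which the
  quadratic polynomial in \<open>r\<close> becomes affine.\<close>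

lemma Cauchy_Schwarz:
  assumes f: "f \<in> vecs H" and g: "g \<in> vecs H"
  shows "cmod (ip H f g) \<le> hnorm H f * hnorm H g"
proof -
  define a b z where "a = (hnorm H f)\<^sup>2" and "b = (hnorm H g)\<^sup>2" and "z = ip H f g"
  have key: "0 \<le> a + (r * cmod z)\<^sup>2 * b - 2 * (r * (cmod z)\<^sup>2)" for r :: real
  proof -
    have "0 \<le> (hnorm H (\<lambda>x. f x - (r * z) * g x))\<^sup>2" by simp
    also have "\<dots> = a + (cmod (r * z) * hnorm H g)\<^sup>2 - 2 * Re (cnj (r * z) * z)"
      by (simp add: hnorm_diff_sq[OF f scale_closed[OF g]] hnorm_scale[OF g] ip_scale_right[OF g f] a_def z_def)
    also have "cnj (r * z) * z = complex_of_real (r * (cmod z)\<^sup>2)"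
      using complex_norm_square[of z] by (simp add: mult.commute)
    finally show ?thesis by (simp add: b_def norm_mult power_mult_distrib)
  qed
  have "(cmod z)\<^sup>2 \<le> a * b"
  proof (cases "b = 0")
    case True
    show ?thesis
    proof (rule ccontr)
      assume "\<not> ?thesis"
      then have "(cmod z)\<^sup>2 > 0" using True by simp
      \<comment> \<open>At \<open>b = 0\<close> this \<open>r\<close> makes the right-hand side of
        \<open>key\<close> equal to -1.\<close>
      then show False using key[of "(a + 1) / (2 * (cmod z)\<^sup>2)"] True
        by (simp add: field_simps a_def)
    qed
  next
    case False
    then have b: "b > 0" by (simp add: b_def)
    then show ?thesis using key[of "1 / b"] by (simp add: field_simps power2_eq_square)
  qed
  then have "(cmod z)\<^sup>2 \<le> (hnorm H f * hnorm H g)\<^sup>2" by (simp add: a_def b_def power_mult_distrib)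
  then show ?thesis unfolding z_def
    by (rule power2_le_imp_le) (simp add: hnorm_nonneg f g)
qed

lemma hnorm_diff_triangle:
  assumes f: "f \<in> vecs H" and g: "g \<in> vecs H" and h: "h \<in> vecs H"
  shows "hnorm H (\<lambda>x. f x - h x) \<le> hnorm H (\<lambda>x. f x - g x) + hnorm H (\<lambda>x. g x - h x)"
proof -
  let ?u = "\<lambda>x. f x - g x" and ?v = "\<lambda>x. h x - g x"
  have uv: "?u \<in> vecs H" "?v \<in> vecs H" using assms by (simp_all add: diff_closed)
  have v: "hnorm H (\<lambda>x. g x - h x) = hnorm H ?v"
    using hnorm_scale[OF uv(2), of "-1"] by simp
  have "(hnorm H (\<lambda>x. f x - h x))\<^sup>2 = (hnorm H (\<lambda>x. ?u x - ?v x))\<^sup>2" by simp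
  also have "\<dots> = (hnorm H ?u)\<^sup>2 + (hnorm H ?v)\<^sup>2 - 2 * Re (ip H ?u ?v)"
    by (rule hnorm_diff_sq[OF uv])
  also have "\<dots> \<le> (hnorm H ?u)\<^sup>2 + (hnorm H ?v)\<^sup>2 + 2 * (hnorm H ?u * hnorm H ?v)"
    using Cauchy_Schwarz[OF uv] abs_Re_le_cmod[of "ip H ?u ?v"] by linarith
  also have "\<dots> = (hnorm H ?u + hnorm H ?v)\<^sup>2" by (simp add: power2_sum)
  finally show ?thesis unfolding v
    by (rule power2_le_imp_le) (simp add: hnorm_nonneg uv)
qed

lemma hnorm_minus_commute:
  assumes "f \<in> vecs H" "g \<in> vecs H"
  shows "hnorm H (\<lambda>x. f x - g x) = hnorm H (\<lambda>x. g x - f x)"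
  using hnorm_scale[OF diff_closed[OF assms], of "-1"] by simp

lemma heq_refl: "f \<in> vecs H \<Longrightarrow> heq H f f"
  using hnorm_scale[of f 0] by (simp add: heq_def)

lemma heq_sym: "f \<in> vecs H \<Longrightarrow> g \<in> vecs H \<Longrightarrow> heq H f g \<Longrightarrow> heq H g f"
  using hnorm_minus_commute[of f g] by (simp add: heq_def)

lemma heq_trans:
  assumes "f \<in> vecs H" "g \<in> vecs H" "h \<in> vecs H" "heq H f g" "heq H g h"
  shows "heq H f h"
  using hnorm_diff_triangle[OF assms(1-3)] hnorm_nonneg[OF diff_closed[OF assms(1,3)]] assms(4,5)
  by (simp add: heq_def)

lemma ip_heq_right:
  assumes "f \<in> vecs H" "g \<in> vecs H" "h \<in> vecs H" "heq H f g"
  shows "ip H h f = ip H h g"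
  using Cauchy_Schwarz[OF assms(3) diff_closed[OF assms(1,2)]] assms(4)
  by (simp add: heq_def ip_diff_right[OF assms(1-3)])

lemma ip_heq_left:
  assumes "f \<in> vecs H" "g \<in> vecs H" "h \<in> vecs H" "heq H f g"
  shows "ip H f h = ip H g h"
  using Cauchy_Schwarz[OF diff_closed[OF assms(1,2)] assms(3)] assms(4)
  by (simp add: heq_def ip_diff_left[OF assms(1-3)])

lemma hnorm_heq:
  assumes "f \<in> vecs H" "g \<in> vecs H" "heq H f g" shows "hnorm H f = hnorm H g"
  using ip_heq_left[OF assms(1,2,1,3)] ip_heq_right[OF assms(1,2,2,3)] by (simp add: hnorm_def)

text \<open>Turns an explicitly computed limit into knowledge about a limit chosen by
  \<open>SOME\<close>. The filter is arbitrary because \<open>op_exp\<close> uses a sequence and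
  \<open>op_generator\<close> lets \<open>r\<close> tend to 0.\<close>

lemma limit_unique:
  assumes g: "g \<in> vecs H" and h: "h \<in> vecs H" and k: "\<And>r. k r \<in> vecs H"
    and "F \<noteq> bot"
    and lim: "((\<lambda>r. hnorm H (\<lambda>x. k r x - g x)) \<longlongrightarrow> 0) F" "((\<lambda>r. hnorm H (\<lambda>x. k r x - h x)) \<longlongrightarrow> 0) F"
  shows "heq H g h"
proof -
  have s: "hnorm H (\<lambda>x. g x - k r x) = hnorm H (\<lambda>x. k r x - g x)" for r
    by (rule hnorm_minus_commute[OF g k])
  have "((\<lambda>r. hnorm H (\<lambda>x. k r x - g x) + hnorm H (\<lambda>x. k r x - h x)) \<longlongrightarrow> 0 + 0) F"
    by (intro tendsto_add lim)
  then have "hnorm H (\<lambda>x. g x - h x) \<le> 0 + 0"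
    by (rule tendsto_lowerbound)
      (use hnorm_diff_triangle[OF g k h] s \<open>F \<noteq> bot\<close> in \<open>auto intro!: always_eventually\<close>)
  then show ?thesis using hnorm_nonneg[OF diff_closed[OF g h]] by (simp add: heq_def)
qed

text \<open>Testing with \<open>h = f - g\<close> gives norm zero. This pins down the choice made in
  \<open>op_adjoint\<close>.\<close>

lemma adjoint_unique:
  assumes "f \<in> vecs H" "g \<in> vecs H" "\<And>h. h \<in> vecs H \<Longrightarrow> ip H h f = ip H h g"
  shows "heq H f g"
  using assms(3)[OF diff_closed[OF assms(1,2)]] ip_diff_right[OF assms(1,2) diff_closed[OF assms(1,2)]]
  by (simp add: heq_def hnorm_def)

end

section \<open>The spaces \<open>L\<^sup>2\<close> and Fock space\<close>

lemma L2_vecs_iff: "f \<in> vecs (L2 M) \<longleftrightarrow> f \<in> borel_measurable M \<and> integrable M (\<lambda>x. (cmod (f x))\<^sup>2)"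
  by (simp add: L2_def)

text \<open>Vectors built from vector or matrix entries carry unspecified values outside of the
  measure space; membership ignores them.\<close>

lemma L2_vecs_cong:
  assumes "\<And>x. x \<in> space M \<Longrightarrow> f x = g x" shows "f \<in> vecs (L2 M) \<longleftrightarrow> g \<in> vecs (L2 M)"
  using measurable_cong[of M f g borel, OF assms]
    Bochner_Integration.integrable_cong[of M M "\<lambda>x. (cmod (f x))\<^sup>2" "\<lambda>x. (cmod (g x))\<^sup>2"] assms
  by (simp add: L2_vecs_iff)

lemma ip_L2: "ip (L2 M) f g = (LINT x|M. f x * cnj (g x))"
  by (simp add: L2_def)

lemma integrable_mult_cnj:
  assumes "f \<in> vecs (L2 M)" "g \<in> vecs (L2 M)"
  shows "integrable M (\<lambda>x. f x * cnj (g x))"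
proof (rule Bochner_Integration.integrable_bound)
  show "integrable M (\<lambda>x. (cmod (f x))\<^sup>2 + (cmod (g x))\<^sup>2)"
    using assms by (simp add: L2_vecs_iff)
  have [measurable]: "f \<in> borel_measurable M" "g \<in> borel_measurable M"
    using assms by (simp_all add: L2_vecs_iff)
  show "(\<lambda>x. f x * cnj (g x)) \<in> borel_measurable M"
    by (intro borel_measurable_times) (auto intro: measurable_compose[OF _ borel_measurable_continuous_onI])
  have "a * b \<le> a\<^sup>2 + b\<^sup>2" for a b :: real
    using sum_squares_bound[of a b] zero_le_power2[of a] zero_le_power2[of b] by linarith
  then show "AE x in M. norm (f x * cnj (g x)) \<le> norm ((cmod (f x))\<^sup>2 + (cmod (g x))\<^sup>2)"
    by (auto simp: norm_mult)
qed

lemma L2_vecs_bound: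
  assumes f: "f \<in> vecs (L2 M)" and g: "g \<in> borel_measurable M"
    and le: "AE x in M. cmod (g x) \<le> K * cmod (f x)"
  shows "g \<in> vecs (L2 M)"
proof -
  have "integrable M (\<lambda>x. (cmod (g x))\<^sup>2)"
  proof (rule Bochner_Integration.integrable_bound)
    show "integrable M (\<lambda>x. K\<^sup>2 * (cmod (f x))\<^sup>2)" using f by (simp add: L2_vecs_iff)
    show "(\<lambda>x. (cmod (g x))\<^sup>2) \<in> borel_measurable M" using g by measurable
    show "AE x in M. norm ((cmod (g x))\<^sup>2) \<le> norm (K\<^sup>2 * (cmod (f x))\<^sup>2)"
      using le by eventually_elim (simp add: power_mono flip: power_mult_distrib)
  qed
  with g show ?thesis by (simp add: L2_vecs_iff)
qed

lemma semi_inner_space_L2: "semi_inner_space (L2 M)"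
proof
  fix f g h :: "'a \<Rightarrow> complex" and c
  assume f: "f \<in> vecs (L2 M)"
  show "(\<lambda>x. c * f x) \<in> vecs (L2 M)"
    using f by (auto simp: L2_vecs_iff norm_mult power_mult_distrib)
  show "0 \<le> Re (ip (L2 M) f f)"
  proof -
    have "ip (L2 M) f f = complex_of_real (LINT x|M. (cmod (f x))\<^sup>2)"
      unfolding ip_L2 integral_complex_of_real[symmetric] complex_norm_square ..
    then show ?thesis by simp
  qed
  assume g: "g \<in> vecs (L2 M)"
  show "ip (L2 M) f g = cnj (ip (L2 M) g f)"
    unfolding ip_L2 using Bochner_Integration.integral_cnj[of M "\<lambda>x. g x * cnj (f x)"] by (simp add: mult.commute)
  show "(\<lambda>x. f x + g x) \<in> vecs (L2 M)"
  proof -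
    have "integrable M (\<lambda>x. (cmod (f x + g x))\<^sup>2)"
    proof (rule Bochner_Integration.integrable_bound)
      show "integrable M (\<lambda>x. 2 * (cmod (f x))\<^sup>2 + 2 * (cmod (g x))\<^sup>2)"
        using f g by (simp add: L2_vecs_iff)
      show "(\<lambda>x. (cmod (f x + g x))\<^sup>2) \<in> borel_measurable M"
        using f g by (auto simp: L2_vecs_iff)
      have "(cmod (f x + g x))\<^sup>2 \<le> 2 * (cmod (f x))\<^sup>2 + 2 * (cmod (g x))\<^sup>2" for x
      proof -
        have "(cmod (f x + g x))\<^sup>2 \<le> (cmod (f x) + cmod (g x))\<^sup>2"
          by (simp add: power_mono norm_triangle_ineq)
        also have "\<dots> \<le> 2 * (cmod (f x))\<^sup>2 + 2 * (cmod (g x))\<^sup>2"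
          using sum_squares_bound[of "cmod (f x)" "cmod (g x)"] by (simp add: power2_sum)
        finally show ?thesis .
      qed
      then show "AE x in M. norm ((cmod (f x + g x))\<^sup>2) \<le> norm (2 * (cmod (f x))\<^sup>2 + 2 * (cmod (g x))\<^sup>2)"
        by auto
    qed
    with f g show ?thesis by (auto simp: L2_vecs_iff)
  qed
  show "ip (L2 M) (\<lambda>x. c * f x) g = c * ip (L2 M) f g"
    by (simp add: ip_L2 mult.assoc)
  assume h: "h \<in> vecs (L2 M)"
  show "ip (L2 M) (\<lambda>x. f x + g x) h = ip (L2 M) f h + ip (L2 M) g h"
    using integrable_mult_cnj[OF f h] integrable_mult_cnj[OF g h]
    by (simp add: ip_L2 distrib_right)
qed

interpretation L2: semi_inner_space "L2 M" for M by (rule semi_inner_space_L2)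

lemma hnorm_L2_sq:
  assumes "f \<in> vecs (L2 M)" shows "(hnorm (L2 M) f)\<^sup>2 = (LINT x|M. (cmod (f x))\<^sup>2)"
proof -
  have "ip (L2 M) f f = complex_of_real (LINT x|M. (cmod (f x))\<^sup>2)"
    unfolding ip_L2 integral_complex_of_real[symmetric] complex_norm_square ..
  then show ?thesis using L2.hnorm_sq[OF assms] by simp
qed

lemma hnorm_L2_eq_0_iff:
  assumes "f \<in> vecs (L2 M)" shows "hnorm (L2 M) f = 0 \<longleftrightarrow> (AE x in M. f x = 0)"
proof -
  have "hnorm (L2 M) f = 0 \<longleftrightarrow> (LINT x|M. (cmod (f x))\<^sup>2) = 0"
    using hnorm_L2_sq[OF assms] by (metis zero_eq_power2)
  also have "\<dots> \<longleftrightarrow> (AE x in M. (cmod (f x))\<^sup>2 = 0)"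
    using assms by (intro integral_nonneg_eq_0_iff_AE) (auto simp: L2_vecs_iff)
  finally show ?thesis by simp
qed

lemma heq_L2_iff:
  assumes "f \<in> vecs (L2 M)" "g \<in> vecs (L2 M)"
  shows "heq (L2 M) f g \<longleftrightarrow> (AE x in M. f x = g x)"
  using hnorm_L2_eq_0_iff[OF L2.diff_closed[OF assms]] by (simp add: heq_def)

lemma hnorm_L2_le:
  assumes f: "f \<in> vecs (L2 M)" and g: "g \<in> borel_measurable M" and "0 \<le> K"
    and le: "AE x in M. cmod (g x) \<le> K * cmod (f x)"
  shows "hnorm (L2 M) g \<le> K * hnorm (L2 M) f"
proof -
  have g': "g \<in> vecs (L2 M)" by (rule L2_vecs_bound[OF f g le])
  have "(hnorm (L2 M) g)\<^sup>2 \<le> (LINT x|M. K\<^sup>2 * (cmod (f x))\<^sup>2)"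
    unfolding hnorm_L2_sq[OF g']
  proof (rule integral_mono_AE)
    show "AE x in M. (cmod (g x))\<^sup>2 \<le> K\<^sup>2 * (cmod (f x))\<^sup>2"
      using le by eventually_elim (simp add: power_mono flip: power_mult_distrib)
  qed (use f g' in \<open>auto simp: L2_vecs_iff\<close>)
  also have "\<dots> = (K * hnorm (L2 M) f)\<^sup>2"
    by (simp add: hnorm_L2_sq[OF f] power_mult_distrib)
  finally show ?thesis
    by (rule power2_le_imp_le) (simp add: L2.hnorm_nonneg f \<open>0 \<le> K\<close>)
qed

lemma fock_vecs_iff:
  "F \<in> vecs (fock M) \<longleftrightarrow>
     (\<forall>n. (\<lambda>x. F (n, x)) \<in> vecs (L2 (nfold M n))) \<and>
     (\<forall>n \<sigma>. \<sigma> permutes {..<n} \<longrightarrow> (AE x in nfold M n. F (n, x \<circ> \<sigma>) = F (n, x))) \<and>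
     summable (\<lambda>n. (hnorm (L2 (nfold M n)) (\<lambda>x. F (n, x)))\<^sup>2)"
  by (simp add: fock_def)

lemma fock_vecs_component: "F \<in> vecs (fock M) \<Longrightarrow> (\<lambda>x. F (n, x)) \<in> vecs (L2 (nfold M n))"
  by (simp add: fock_vecs_iff)

lemma ip_fock:
  "ip (fock M) F G = suminf (\<lambda>n. ip (L2 (nfold M n)) (\<lambda>x. F (n, x)) (\<lambda>x. G (n, x)))"
  by (simp add: fock_def)

lemma summable_ip_fock:
  assumes "F \<in> vecs (fock M)" "G \<in> vecs (fock M)"
  shows "summable (\<lambda>n. ip (L2 (nfold M n)) (\<lambda>x. F (n, x)) (\<lambda>x. G (n, x)))"
proof (rule summable_comparison_test')
  let ?f = "\<lambda>n. hnorm (L2 (nfold M n)) (\<lambda>x. F (n, x))"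
  let ?g = "\<lambda>n. hnorm (L2 (nfold M n)) (\<lambda>x. G (n, x))"
  show "summable (\<lambda>n. (?f n)\<^sup>2 + (?g n)\<^sup>2)"
    using assms by (intro summable_add) (auto simp: fock_vecs_iff)
  fix n
  have "norm (ip (L2 (nfold M n)) (\<lambda>x. F (n, x)) (\<lambda>x. G (n, x))) \<le> ?f n * ?g n"
    by (intro L2.Cauchy_Schwarz fock_vecs_component assms)
  also have "\<dots> \<le> 2 * (?f n * ?g n)"
    using assms by (simp add: L2.hnorm_nonneg fock_vecs_component)
  also have "\<dots> \<le> (?f n)\<^sup>2 + (?g n)\<^sup>2"
    using sum_squares_bound[of "?f n" "?g n"] by (simp add: mult.assoc)
  finally show "norm (ip (L2 (nfold M n)) (\<lambda>x. F (n, x)) (\<lambda>x. G (n, x))) \<le> (?f n)\<^sup>2 + (?g n)\<^sup>2" .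
qed

lemma fock_ip_self:
  assumes "F \<in> vecs (fock M)"
  shows "ip (fock M) F F = complex_of_real (suminf (\<lambda>n. (hnorm (L2 (nfold M n)) (\<lambda>x. F (n, x)))\<^sup>2))"
proof -
  have eq: "ip (L2 (nfold M n)) (\<lambda>x. F (n, x)) (\<lambda>x. F (n, x))
     = complex_of_real ((hnorm (L2 (nfold M n)) (\<lambda>x. F (n, x)))\<^sup>2)" for n
    by (rule L2.ip_self[OF fock_vecs_component[OF assms]])
  have "summable (\<lambda>n. (hnorm (L2 (nfold M n)) (\<lambda>x. F (n, x)))\<^sup>2)"
    using assms by (simp add: fock_vecs_iff)
  then show ?thesis unfolding ip_fock eq by (simp only: suminf_of_real)
qed

lemma semi_inner_space_fock: "semi_inner_space (fock M)"
proof
  fix F G K :: "nat \<times> (nat \<Rightarrow> 'a) \<Rightarrow> complex" and c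
  assume F: "F \<in> vecs (fock M)"
  note Fn = fock_vecs_component[OF F]
  show "(\<lambda>x. c * F x) \<in> vecs (fock M)"
    using F by (auto simp: fock_vecs_iff L2.scale_closed L2.hnorm_scale power_mult_distrib
        elim!: allE eventually_mono)
  show "0 \<le> Re (ip (fock M) F F)"
    using F by (auto simp: fock_ip_self fock_vecs_iff intro!: suminf_nonneg)
  show "ip (fock M) (\<lambda>x. c * F x) G = c * ip (fock M) F G" if "G \<in> vecs (fock M)" for G
    using that F by (simp add: ip_fock L2.ip_scale_left fock_vecs_component suminf_mult summable_ip_fock)
  assume G: "G \<in> vecs (fock M)"
  note Gn = fock_vecs_component[OF G]
  show "ip (fock M) F G = cnj (ip (fock M) G F)"
    using bounded_linear.suminf[OF bounded_linear_cnj summable_ip_fock[OF G F]]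
    by (simp add: ip_fock L2.ip_commute[OF Fn Gn])
  show "(\<lambda>x. F x + G x) \<in> vecs (fock M)"
    unfolding fock_vecs_iff
  proof (intro conjI allI impI)
    fix n
    show "(\<lambda>x. F (n, x) + G (n, x)) \<in> vecs (L2 (nfold M n))" by (intro L2.add_closed Fn Gn)
    fix \<sigma> :: "nat \<Rightarrow> nat" assume "\<sigma> permutes {..<n}"
    then have "AE x in nfold M n. F (n, x \<circ> \<sigma>) = F (n, x)" "AE x in nfold M n. G (n, x \<circ> \<sigma>) = G (n, x)"
      using F G by (auto simp: fock_vecs_iff)
    then show "AE x in nfold M n. F (n, x \<circ> \<sigma>) + G (n, x \<circ> \<sigma>) = F (n, x) + G (n, x)"
      by eventually_elim simp
  next
    show "summable (\<lambda>n. (hnorm (L2 (nfold M n)) (\<lambda>x. F (n, x) + G (n, x)))\<^sup>2)"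
    proof (rule summable_comparison_test')
      let ?f = "\<lambda>n. hnorm (L2 (nfold M n)) (\<lambda>x. F (n, x))"
      let ?g = "\<lambda>n. hnorm (L2 (nfold M n)) (\<lambda>x. G (n, x))"
      show "summable (\<lambda>n. 2 * (?f n)\<^sup>2 + 2 * (?g n)\<^sup>2)"
        using F G by (intro summable_add summable_mult) (auto simp: fock_vecs_iff)
      fix n
      have "hnorm (L2 (nfold M n)) (\<lambda>x. F (n, x) + G (n, x)) \<le> ?f n + ?g n"
        \<comment> \<open>The triangle inequality for differences, with \<open>0 * G\<close> as
          middle point and \<open>-1 * G\<close> as last point.\<close>
        using L2.hnorm_diff_triangle[OF Fn L2.scale_closed[OF Gn, where c = 0] L2.scale_closed[OF Gn, where c = "-1"]]
        by simp
      then have "(hnorm (L2 (nfold M n)) (\<lambda>x. F (n, x) + G (n, x)))\<^sup>2 \<le> (?f n + ?g n)\<^sup>2"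
        by (intro power_mono) (auto intro!: L2.hnorm_nonneg L2.add_closed Fn Gn)
      also have "\<dots> \<le> 2 * (?f n)\<^sup>2 + 2 * (?g n)\<^sup>2"
        using sum_squares_bound[of "?f n" "?g n"] by (simp add: power2_sum)
      finally show "norm ((hnorm (L2 (nfold M n)) (\<lambda>x. F (n, x) + G (n, x)))\<^sup>2) \<le> 2 * (?f n)\<^sup>2 + 2 * (?g n)\<^sup>2"
        by simp
    qed
  qed
  assume K: "K \<in> vecs (fock M)"
  show "ip (fock M) (\<lambda>x. F x + G x) K = ip (fock M) F K + ip (fock M) G K"
    using suminf_add[OF summable_ip_fock[OF F K] summable_ip_fock[OF G K]]
    by (simp add: ip_fock L2.ip_add_left[OF Fn Gn fock_vecs_component[OF K]])
qed

interpretation fock: semi_inner_space "fock M" for M by (rule semi_inner_space_fock)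

lemma hnorm_fock_sq:
  assumes "F \<in> vecs (fock M)"
  shows "(hnorm (fock M) F)\<^sup>2 = (suminf (\<lambda>n. (hnorm (L2 (nfold M n)) (\<lambda>x. F (n, x)))\<^sup>2))"
  using fock.hnorm_sq[OF assms] fock_ip_self[OF assms] by simp

lemma heq_fock_iff:
  assumes F: "F \<in> vecs (fock M)" and G: "G \<in> vecs (fock M)"
  shows "heq (fock M) F G \<longleftrightarrow> (\<forall>n. AE x in nfold M n. F (n, x) = G (n, x))"
proof -
  have D: "(\<lambda>x. F x - G x) \<in> vecs (fock M)" by (rule fock.diff_closed[OF F G])
  have s: "summable (\<lambda>n. (hnorm (L2 (nfold M n)) (\<lambda>x. F (n, x) - G (n, x)))\<^sup>2)"
    using D by (simp add: fock_vecs_iff)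
  have "heq (fock M) F G \<longleftrightarrow> (hnorm (fock M) (\<lambda>x. F x - G x))\<^sup>2 = 0" by (simp add: heq_def)
  also have "\<dots> \<longleftrightarrow> (\<forall>n. heq (L2 (nfold M n)) (\<lambda>x. F (n, x)) (\<lambda>x. G (n, x)))"
    using suminf_eq_zero_iff[OF s] by (simp add: hnorm_fock_sq[OF D] heq_def)
  finally show ?thesis by (simp add: heq_L2_iff fock_vecs_component F G)
qed

section \<open>Exponential vectors\<close>

text \<open>The coefficient sequences of \<open>exp_comb\<close>. The class is closed under sums and
  products and contains \<open>n\<close> and the unimodular phases of the unitary group, so every
  operator considered preserves it; the weights \<open>s^n / n!\<close> make it summable.\<close>

definition poly_growth :: "(nat \<Rightarrow> complex) \<Rightarrow> bool" where
  "poly_growth a \<longleftrightarrow> (\<exists>K k. \<forall>n. cmod (a n) \<le> K * (1 + real n) ^ k)"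

lemma poly_growth_const: "poly_growth (\<lambda>n. c)"
  unfolding poly_growth_def by (rule exI[of _ "cmod c"], rule exI[of _ 0]) simp

lemma poly_growth_of_nat: "poly_growth (\<lambda>n. of_nat n)"
  unfolding poly_growth_def by (rule exI[of _ 1], rule exI[of _ 1]) simp

lemma poly_growth_mult:
  assumes "poly_growth a" "poly_growth b" shows "poly_growth (\<lambda>n. a n * b n)"
proof -
  obtain K k K' k' where 1: "\<And>n. cmod (a n) \<le> K * (1 + real n) ^ k"
    and 2: "\<And>n. cmod (b n) \<le> K' * (1 + real n) ^ k'"
    using assms by (auto simp: poly_growth_def)
  have "cmod (a n * b n) \<le> (K * K') * (1 + real n) ^ (k + k')" for n
    using mult_mono'[OF 1[of n] 2[of n]] by (simp add: norm_mult power_add mult_ac)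
  then show ?thesis unfolding poly_growth_def by blast
qed

lemma poly_growth_add:
  assumes "poly_growth a" "poly_growth b" shows "poly_growth (\<lambda>n. a n + b n)"
proof -
  obtain K k K' k' where 1: "\<And>n. cmod (a n) \<le> K * (1 + real n) ^ k"
    and 2: "\<And>n. cmod (b n) \<le> K' * (1 + real n) ^ k'"
    using assms by (auto simp: poly_growth_def)
  have "cmod (a n + b n) \<le> (\<bar>K\<bar> + \<bar>K'\<bar>) * (1 + real n) ^ (k + k')" for n
  proof -
    have "K * (1 + real n) ^ k \<le> \<bar>K\<bar> * (1 + real n) ^ (k + k')"
      by (intro mult_mono power_increasing) auto
    moreover have "K' * (1 + real n) ^ k' \<le> \<bar>K'\<bar> * (1 + real n) ^ (k + k')"
      by (intro mult_mono power_increasing) auto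
    ultimately show ?thesis
      using norm_triangle_ineq[of "a n" "b n"] 1[of n] 2[of n] by (simp add: distrib_right)
  qed
  then show ?thesis unfolding poly_growth_def by blast
qed

lemma poly_growth_power: "poly_growth a \<Longrightarrow> poly_growth (\<lambda>n. a n ^ k)"
  by (induction k) (auto intro: poly_growth_mult poly_growth_const)

lemma poly_growth_unimodular: "(\<And>n. cmod (a n) = 1) \<Longrightarrow> poly_growth a"
  unfolding poly_growth_def by (intro exI[of _ 1] exI[of _ 0]) simp

text \<open>A single term of the exponential series gives
  \<open>(1 + n)^k \<le> k! e^(1 + n)\<close>, so a constant times \<open>(e s)^n / n!\<close> is a
  majorant.\<close>

lemma summable_poly_growth_exp:
  assumes "poly_growth a" "0 \<le> s"
  shows "summable (\<lambda>n. cmod (a n) * s ^ n / fact n)"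
proof -
  obtain K k where a: "\<And>n. cmod (a n) \<le> K * (1 + real n) ^ k"
    using assms(1) by (auto simp: poly_growth_def)
  show ?thesis
  proof (rule summable_comparison_test')
    show "summable (\<lambda>n. (\<bar>K\<bar> * fact k * exp 1) * (inverse (fact n) * (exp 1 * s) ^ n))"
      by (intro summable_mult summable_exp)
    fix n
    have "(1 + real n) ^ k / fact k \<le> exp (1 + real n)"
    proof -
      have "(1 + real n) ^ k / fact k = (\<Sum>i\<in>{k}. (1 + real n) ^ i / fact i)" by simp
      also have "\<dots> \<le> suminf (\<lambda>i. (1 + real n) ^ i / fact i)"
        using summable_exp[of "1 + real n"] by (intro sum_le_suminf) (auto simp: field_simps)
      also have "\<dots> = exp (1 + real n)" by (simp add: exp_def divide_inverse mult.commute)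
      finally show ?thesis .
    qed
    then have "(1 + real n) ^ k \<le> fact k * exp (1 + real n)" by (simp add: field_simps)
    then have "\<bar>K\<bar> * (1 + real n) ^ k \<le> \<bar>K\<bar> * (fact k * exp (1 + real n))"
      by (intro mult_left_mono) auto
    moreover have "K * (1 + real n) ^ k \<le> \<bar>K\<bar> * (1 + real n) ^ k"
      by (intro mult_right_mono) auto
    ultimately have "cmod (a n) \<le> \<bar>K\<bar> * (fact k * exp (1 + real n))"
      using a[of n] by linarith
    moreover have "exp (1 + real n) = exp 1 * exp 1 ^ n"
      by (simp add: exp_add exp_of_nat_mult[symmetric])
    ultimately have "cmod (a n) \<le> \<bar>K\<bar> * fact k * (exp 1 * exp 1 ^ n)"
      by (simp only: mult.assoc)
    then have "cmod (a n) * (s ^ n / fact n) \<le> \<bar>K\<bar> * fact k * (exp 1 * exp 1 ^ n) * (s ^ n / fact n)"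
      using assms(2) by (intro mult_right_mono) auto
    then show "norm (cmod (a n) * s ^ n / fact n)
        \<le> (\<bar>K\<bar> * fact k * exp 1) * (inverse (fact n) * (exp 1 * s) ^ n)"
      using assms(2) by (simp add: power_mult_distrib divide_inverse mult_ac)
  qed
qed

lemma summable_poly_growth_exp':
  assumes "poly_growth a" "0 \<le> s"
  shows "summable (\<lambda>n. a n * complex_of_real (s ^ n / fact n))"
proof (rule summable_norm_cancel)
  show "summable (\<lambda>n. norm (a n * complex_of_real (s ^ n / fact n)))"
    using summable_poly_growth_exp[OF assms] assms(2)
    by (simp add: norm_mult norm_divide norm_power)
qed

text \<open>This is the function \<open>a\<close> of the number operator, applied to
  \<open>e(\<phi>)\<close>. Geometric \<open>a\<close> gives the vectors \<open>e(z \<phi>)\<close>,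
  polynomial \<open>a\<close> the images under polynomials in the number operator.\<close>

definition exp_comb :: "(nat \<Rightarrow> complex) \<Rightarrow> ('a \<Rightarrow> complex) \<Rightarrow> nat \<times> (nat \<Rightarrow> 'a) \<Rightarrow> complex" where
  "exp_comb a \<phi> = (\<lambda>(n, x). a n * exp_vec \<phi> (n, x))"

lemma exp_comb_1: "exp_comb (\<lambda>n. 1) \<phi> = exp_vec \<phi>"
  by (auto simp: exp_comb_def)

lemma exp_vec_scale: "exp_vec (\<lambda>x. z * \<phi> x) = exp_comb (\<lambda>n. z ^ n) \<phi>"
  by (auto simp: exp_comb_def exp_vec_def prod.distrib fun_eq_iff)

lemma exp_vec_permute:
  assumes "\<sigma> permutes {..<n}" shows "exp_vec \<phi> (n, x \<circ> \<sigma>) = exp_vec \<phi> (n, x)"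
  using prod.permute[OF assms, of "\<lambda>i. \<phi> (x i)"] by (simp add: exp_vec_def o_def)

context sigma_finite_measure
begin

lemma product_sigma_finite_nfold: "product_sigma_finite (\<lambda>_. M)"
  by standard

text \<open>The exceptional set lies in a box with one null side. This carries almost everywhere
  statements from one particle to \<open>n\<close>.\<close>

lemma AE_nfold_component:
  assumes "AE x in M. P x" "i < n"
  shows "AE x in nfold M n. P (x i)"
proof -
  interpret product_sigma_finite "\<lambda>_. M" by (rule product_sigma_finite_nfold)
  obtain A where A: "{x \<in> space M. \<not> P x} \<subseteq> A" "emeasure M A = 0" "A \<in> sets M"
    using assms(1) by (rule AE_E)
  let ?B = "PiE {..<n} (\<lambda>j. if j = i then A else space M)"
  show ?thesis
  proof (rule AE_I)
    show "{x \<in> space (nfold M n). \<not> P (x i)} \<subseteq> ?B"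
      using A(1) assms(2) by (auto simp: nfold_def space_PiM PiE_iff extensional_def)
    show "emeasure (nfold M n) ?B = 0"
      unfolding nfold_def using A assms(2) by (subst emeasure_PiM) auto
    show "?B \<in> sets (nfold M n)"
      unfolding nfold_def using A by (intro sets_PiM_I_finite) auto
  qed
qed

lemma AE_exp_vec_cong:
  assumes "AE x in M. \<phi> x = \<eta> x"
  shows "AE x in nfold M n. exp_vec \<phi> (n, x) = exp_vec \<eta> (n, x)"
proof -
  have "AE x in nfold M n. \<forall>i\<in>{..<n}. \<phi> (x i) = \<eta> (x i)"
    using AE_nfold_component[OF assms] by (intro AE_finite_allI) auto
  then show ?thesis by eventually_elim (simp add: exp_vec_def)
qed

lemma exp_vec_measurable:
  assumes "\<phi> \<in> borel_measurable M" shows "(\<lambda>x. exp_vec \<phi> (n, x)) \<in> borel_measurable (nfold M n)"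
proof -
  have "(\<lambda>x. \<phi> (x i)) \<in> borel_measurable (nfold M n)" if "i < n" for i
    unfolding nfold_def using that assms by (intro measurable_compose[OF measurable_component_singleton]) auto
  then show ?thesis unfolding exp_vec_def by (auto intro!: borel_measurable_divide borel_measurable_prod)
qed

lemma exp_vec_component:
  assumes "\<phi> \<in> vecs (L2 M)" shows "(\<lambda>x. exp_vec \<phi> (n, x)) \<in> vecs (L2 (nfold M n))"
proof -
  interpret product_sigma_finite "\<lambda>_. M" by (rule product_sigma_finite_nfold)
  have "integrable (nfold M n) (\<lambda>x. (\<Prod>i<n. (cmod (\<phi> (x i)))\<^sup>2))"
    unfolding nfold_def using assms by (intro product_integrable_prod) (auto simp: L2_vecs_iff)
  then have "integrable (nfold M n) (\<lambda>x. (\<Prod>i<n. (cmod (\<phi> (x i)))\<^sup>2) / fact n)" by simp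
  then show ?thesis using assms exp_vec_measurable[of \<phi> n]
    by (simp add: L2_vecs_iff exp_vec_def norm_divide prod_norm[symmetric] power_divide prod_power_distrib)
qed

lemma ip_exp_vec_component:
  assumes "\<phi> \<in> vecs (L2 M)" "\<eta> \<in> vecs (L2 M)"
  shows "ip (L2 (nfold M n)) (\<lambda>x. exp_vec \<phi> (n, x)) (\<lambda>x. exp_vec \<eta> (n, x))
    = ip (L2 M) \<phi> \<eta> ^ n / fact n"
proof -
  interpret product_sigma_finite "\<lambda>_. M" by (rule product_sigma_finite_nfold)
  have sq: "complex_of_real (sqrt (fact n)) * complex_of_real (sqrt (fact n)) = fact n"
    unfolding of_real_mult[symmetric] by simp
  have "ip (L2 (nfold M n)) (\<lambda>x. exp_vec \<phi> (n, x)) (\<lambda>x. exp_vec \<eta> (n, x))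
    = (LINT x|nfold M n. (\<Prod>i<n. \<phi> (x i) * cnj (\<eta> (x i))) / fact n)"
    by (simp add: ip_L2 exp_vec_def prod.distrib sq)
  also have "\<dots> = (LINT x|nfold M n. (\<Prod>i<n. \<phi> (x i) * cnj (\<eta> (x i)))) / fact n" by simp
  also have "(LINT x|nfold M n. (\<Prod>i<n. \<phi> (x i) * cnj (\<eta> (x i)))) = (\<Prod>i<n. LINT x|M. \<phi> x * cnj (\<eta> x))"
    unfolding nfold_def by (rule product_integral_prod) (auto intro: integrable_mult_cnj assms)
  finally show ?thesis by (simp add: ip_L2)
qed

lemma hnorm_exp_vec_component_sq:
  assumes "\<phi> \<in> vecs (L2 M)"
  shows "(hnorm (L2 (nfold M n)) (\<lambda>x. exp_vec \<phi> (n, x)))\<^sup>2 = ((hnorm (L2 M) \<phi>)\<^sup>2) ^ n / fact n"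
proof -
  have "complex_of_real ((hnorm (L2 (nfold M n)) (\<lambda>x. exp_vec \<phi> (n, x)))\<^sup>2)
     = complex_of_real (((hnorm (L2 M) \<phi>)\<^sup>2) ^ n / fact n)"
    using ip_exp_vec_component[OF assms assms, of n]
    by (simp add: L2.ip_self assms exp_vec_component)
  then show ?thesis using of_real_eq_iff by blast
qed

lemma exp_comb_vecs:
  assumes "\<phi> \<in> vecs (L2 M)" "poly_growth a"
  shows "exp_comb a \<phi> \<in> vecs (fock M)"
  unfolding fock_vecs_iff
proof (intro conjI allI impI)
  fix n
  show "(\<lambda>x. exp_comb a \<phi> (n, x)) \<in> vecs (L2 (nfold M n))"
    using L2.scale_closed[OF exp_vec_component[OF assms(1)]] by (simp add: exp_comb_def)
  show "AE x in nfold M n. exp_comb a \<phi> (n, x \<circ> \<sigma>) = exp_comb a \<phi> (n, x)" if "\<sigma> permutes {..<n}" for \<sigma>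
    using exp_vec_permute[OF that, of \<phi>] by (simp add: exp_comb_def)
  have "summable (\<lambda>n. cmod ((a n)\<^sup>2) * ((hnorm (L2 M) \<phi>)\<^sup>2) ^ n / fact n)"
    using assms(2) by (intro summable_poly_growth_exp poly_growth_power) auto
  then show "summable (\<lambda>n. (hnorm (L2 (nfold M n)) (\<lambda>x. exp_comb a \<phi> (n, x)))\<^sup>2)"
    using hnorm_exp_vec_component_sq[OF assms(1)] L2.hnorm_scale[OF exp_vec_component[OF assms(1)]]
    by (simp add: exp_comb_def power_mult_distrib norm_power)
qed

lemma exp_vec_vecs: "\<phi> \<in> vecs (L2 M) \<Longrightarrow> exp_vec \<phi> \<in> vecs (fock M)"
  using exp_comb_vecs[of \<phi> "\<lambda>n. 1"] by (simp add: exp_comb_1 poly_growth_const)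

lemma ip_exp_comb:
  assumes "\<phi> \<in> vecs (L2 M)"
  shows "ip (fock M) (exp_comb a \<phi>) (exp_comb b \<phi>)
    = suminf (\<lambda>n. a n * cnj (b n) * complex_of_real (((hnorm (L2 M) \<phi>)\<^sup>2) ^ n / fact n))"
proof -
  have "ip (L2 (nfold M n)) (\<lambda>x. exp_comb a \<phi> (n, x)) (\<lambda>x. exp_comb b \<phi> (n, x))
    = a n * cnj (b n) * complex_of_real (((hnorm (L2 M) \<phi>)\<^sup>2) ^ n / fact n)" for n
    by (simp add: exp_comb_def L2.ip_scale_left L2.ip_scale_right L2.scale_closed exp_vec_component assms
        ip_exp_vec_component L2.ip_self[OF assms])
  then show ?thesis by (simp add: ip_fock)
qed

lemma hnorm_exp_comb_sq:
  assumes "\<phi> \<in> vecs (L2 M)" "poly_growth a"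
  shows "(hnorm (fock M) (exp_comb a \<phi>))\<^sup>2
    = suminf (\<lambda>n. (cmod (a n))\<^sup>2 * ((hnorm (L2 M) \<phi>)\<^sup>2) ^ n / fact n)"
  using hnorm_exp_vec_component_sq[OF assms(1)] L2.hnorm_scale[OF exp_vec_component[OF assms(1)]]
  by (simp add: hnorm_fock_sq exp_comb_vecs assms) (simp add: exp_comb_def power_mult_distrib)

end

section \<open>Second quantization of a multiple of an indicator function\<close>

lemma power_series_unique:
  fixes a b :: "nat \<Rightarrow> complex"
  assumes "\<And>z. summable (\<lambda>n. a n * z ^ n)" "\<And>z. summable (\<lambda>n. b n * z ^ n)"
    and eq: "\<And>z. suminf (\<lambda>n. a n * z ^ n) = suminf (\<lambda>n. b n * z ^ n)"
  shows "a m = b m"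
proof -
  have s: "(\<lambda>n. (a n - b n) * z ^ n) sums 0" for z
    using sums_diff[OF summable_sums[OF assms(1)[of z]] summable_sums[OF assms(2)[of z]]] eq[of z]
    by (simp add: left_diff_distrib)
  have 0: "a 0 = b 0" using s[of 0] powser_sums_zero_iff[of "\<lambda>n. a n - b n" 0] by simp
  show ?thesis
  proof (rule ccontr)
    assume ne: "a m \<noteq> b m"
    then have "m > 0" using 0 by (cases m) auto
    \<comment> \<open>Isolation of zeros: a nonzero coefficient of positive index yields a punctured
      disc on which the sum has no zero, but here the sum is the zero function.\<close>
    obtain t where "0 < t" "\<And>z. z \<in> cball (0::complex) t - {0} \<Longrightarrow> (0::complex) \<noteq> 0"
      by (rule powser_0_nonzero[of 1 0 "\<lambda>n. a n - b n" "\<lambda>_. 0" m])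
        (use s ne \<open>m > 0\<close> in auto)
    from this(2)[of "of_real t"] this(1) show False by auto
  qed
qed

text \<open>Only almost everywhere, since adjoints and exponentials are determined only up to
  \<open>heq\<close>. The notion passes to the linear combinations and adjoints from which
  \<open>Lambda\<close> is formed.\<close>

definition acts_as_mult :: "'a measure \<Rightarrow> 'a set \<Rightarrow> complex \<Rightarrow> (('a \<Rightarrow> complex) \<Rightarrow> ('a \<Rightarrow> complex)) \<Rightarrow> bool" where
  "acts_as_mult M B c h \<longleftrightarrow>
     (\<forall>f\<in>vecs (L2 M). h f \<in> vecs (L2 M) \<and> (AE x in M. h f x = c * indicator B x * f x))"

lemma acts_as_mult_self:
  assumes "B \<in> sets M" shows "acts_as_mult M B c (\<lambda>f x. c * indicator B x * f x)"
  unfolding acts_as_mult_def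
proof (intro ballI conjI)
  fix f assume f: "f \<in> vecs (L2 M)"
  show "(\<lambda>x. c * indicator B x * f x) \<in> vecs (L2 M)"
    by (rule L2_vecs_bound[OF f, of _ "cmod c"])
      (use assms f in \<open>auto simp: L2_vecs_iff norm_mult indicator_def intro!: borel_measurable_times borel_measurable_indicator\<close>)
qed auto

lemma acts_as_mult_lincomb:
  assumes "acts_as_mult M B c h" "acts_as_mult M B d k"
  shows "acts_as_mult M B (u * c + v * d) (\<lambda>f x. u * h f x + v * k f x)"
  unfolding acts_as_mult_def
proof (intro ballI conjI)
  fix f assume f: "f \<in> vecs (L2 M)"
  have h: "h f \<in> vecs (L2 M)" "AE x in M. h f x = c * indicator B x * f x"
    and k: "k f \<in> vecs (L2 M)" "AE x in M. k f x = d * indicator B x * f x"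
    using assms f by (auto simp: acts_as_mult_def)
  show "(\<lambda>x. u * h f x + v * k f x) \<in> vecs (L2 M)"
    by (intro L2.add_closed L2.scale_closed h k)
  show "AE x in M. u * h f x + v * k f x = (u * c + v * d) * indicator B x * f x"
    using h(2) k(2) by eventually_elim (simp add: algebra_simps)
qed

text \<open>Multiplication by \<open>cnj c\<close> on \<open>B\<close> shows that an adjoint exists,
  so the chosen one is an adjoint; by uniqueness it agrees with this witness.\<close>

lemma acts_as_mult_adjoint:
  assumes B: "B \<in> sets M" and h: "acts_as_mult M B c h"
  shows "acts_as_mult M B (cnj c) (op_adjoint (L2 M) h)"
proof -
  let ?B = "\<lambda>f x. cnj c * indicator B x * f x"
  have self: "?B f \<in> vecs (L2 M)" if "f \<in> vecs (L2 M)" for f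
    using acts_as_mult_self[OF B, of "cnj c"] that by (simp add: acts_as_mult_def)
  have hf: "h f \<in> vecs (L2 M)" "AE x in M. h f x = c * indicator B x * f x" if "f \<in> vecs (L2 M)" for f
    using h that by (auto simp: acts_as_mult_def)
  have adj: "ip (L2 M) (h f) g = ip (L2 M) f (?B g)" if f: "f \<in> vecs (L2 M)" and g: "g \<in> vecs (L2 M)" for f g
    unfolding ip_L2
  proof (rule integral_cong_AE)
    show "(\<lambda>x. h f x * cnj (g x)) \<in> borel_measurable M"
      using integrable_mult_cnj[OF hf(1)[OF f] g] by simp
    show "(\<lambda>x. f x * cnj (?B g x)) \<in> borel_measurable M"
      using integrable_mult_cnj[OF f self[OF g]] by (rule borel_measurable_integrable)
    show "AE x in M. h f x * cnj (g x) = f x * cnj (?B g x)"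
      using hf(2)[OF f] by eventually_elim (auto simp: indicator_def)
  qed
  have "hnorm (L2 M) (?B f) \<le> cmod c * hnorm (L2 M) f" if "f \<in> vecs (L2 M)" for f
    by (rule hnorm_L2_le[OF that])
      (use self[OF that] in \<open>auto simp: L2_vecs_iff norm_mult indicator_def\<close>)
  moreover have "linear_op (L2 M) ?B"
    unfolding linear_op_def
  proof (intro conjI ballI allI)
    fix f g d assume f: "f \<in> vecs (L2 M)"
    show "?B f \<in> vecs (L2 M)" by (rule self[OF f])
    show "heq (L2 M) (?B (\<lambda>x. d * f x)) (\<lambda>x. d * ?B f x)"
      using L2.heq_refl[OF L2.scale_closed[OF self[OF f]], of d] by (simp add: mult_ac)
    assume g: "g \<in> vecs (L2 M)"
    show "heq (L2 M) (?B (\<lambda>x. f x + g x)) (\<lambda>x. ?B f x + ?B g x)"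
      using L2.heq_refl[OF L2.add_closed[OF self[OF f] self[OF g]]] by (simp add: distrib_left)
  qed
  ultimately have "bounded_op (L2 M) ?B" by (auto simp: bounded_op_def)
  with adj have "\<exists>A. bounded_op (L2 M) A \<and> (\<forall>f\<in>vecs (L2 M). \<forall>g\<in>vecs (L2 M). ip (L2 M) (h f) g = ip (L2 M) f (A g))"
    by blast
  then have *: "bounded_op (L2 M) (op_adjoint (L2 M) h) \<and>
      (\<forall>f\<in>vecs (L2 M). \<forall>g\<in>vecs (L2 M). ip (L2 M) (h f) g = ip (L2 M) f (op_adjoint (L2 M) h g))"
    unfolding op_adjoint_def by (rule someI_ex)
  show ?thesis unfolding acts_as_mult_def
  proof (intro ballI conjI)
    fix g assume g: "g \<in> vecs (L2 M)"
    show v: "op_adjoint (L2 M) h g \<in> vecs (L2 M)"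
      using * g by (auto simp: bounded_op_def linear_op_def)
    have "heq (L2 M) (op_adjoint (L2 M) h g) (?B g)"
      by (rule L2.adjoint_unique[OF v self[OF g]]) (use * g adj in auto)
    then show "AE x in M. op_adjoint (L2 M) h g x = cnj c * indicator B x * g x"
      by (simp add: heq_L2_iff v self g)
  qed
qed

text \<open>The multiplier takes only the values \<open>z\<close> and 0, so the error of the
  operator series is bounded uniformly by the errors of the scalar series at these two points, whose
  sum is \<open>e n\<close>.\<close>

lemma op_exp_mult:
  assumes B: "B \<in> sets M" and A: "acts_as_mult M B z A" and f: "f \<in> vecs (L2 M)"
  shows "op_exp (L2 M) A f \<in> vecs (L2 M)"
    and "AE x in M. op_exp (L2 M) A f x = exp (z * indicator B x) * f x"
proof -
  have Af: "A g \<in> vecs (L2 M)" "AE x in M. A g x = z * indicator B x * g x" if "g \<in> vecs (L2 M)" for g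
    using A that by (auto simp: acts_as_mult_def)
  have pow: "(A ^^ k) f \<in> vecs (L2 M) \<and> (AE x in M. (A ^^ k) f x = (z * indicator B x) ^ k * f x)" for k
  proof (induction k)
    case (Suc k)
    then have v: "(A ^^ k) f \<in> vecs (L2 M)" and e: "AE x in M. (A ^^ k) f x = (z * indicator B x) ^ k * f x"
      by auto
    have "AE x in M. A ((A ^^ k) f) x = (z * indicator B x) ^ Suc k * f x"
      using Af(2)[OF v] e by eventually_elim (simp add: mult.assoc)
    then show ?case using Af(1)[OF v] by simp
  qed (use f in simp)
  let ?p = "\<lambda>n x. \<Sum>k<n. (A ^^ k) f x / fact k"
  let ?g = "\<lambda>x. exp (z * indicator B x) * f x"
  define e where "e = (\<lambda>n. cmod (exp z - (\<Sum>k<n. z ^ k / fact k)) + cmod (exp 0 - (\<Sum>k<n. 0 ^ k / fact k)))"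
  have p: "?p n \<in> vecs (L2 M)" for n
  proof (induction n)
    case 0
    then show ?case using L2.scale_closed[OF f, of 0] by simp
  next
    case (Suc n)
    then show ?case
      using L2.add_closed[OF Suc L2.scale_closed[OF conjunct1[OF pow[of n]], of "1 / fact n"]] by simp
  qed
  have g: "?g \<in> vecs (L2 M)"
    by (rule L2_vecs_bound[OF f, of _ "cmod (exp z) + 1"])
      (use B f in \<open>auto simp: L2_vecs_iff norm_mult indicator_def mult_right_mono
        intro!: borel_measurable_times measurable_compose[OF _ borel_measurable_exp] borel_measurable_indicator\<close>)
  have "hnorm (L2 M) (\<lambda>x. ?g x - ?p n x) \<le> e n * hnorm (L2 M) f" for n
  proof (rule hnorm_L2_le[OF f])
    show "(\<lambda>x. ?g x - ?p n x) \<in> borel_measurable M"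
      using L2.diff_closed[OF g p] by (simp add: L2_vecs_iff)
    show "0 \<le> e n" by (simp add: e_def)
    have "AE x in M. \<forall>k\<in>{..<n}. (A ^^ k) f x = (z * indicator B x) ^ k * f x"
      using pow by (intro AE_finite_allI) auto
    then show "AE x in M. cmod (?g x - ?p n x) \<le> e n * cmod (f x)"
    proof eventually_elim
      case (elim x)
      have "?g x - ?p n x = (exp (z * indicator B x) - (\<Sum>k<n. (z * indicator B x) ^ k / fact k)) * f x"
        using elim by (simp add: left_diff_distrib sum_distrib_right)
      moreover have "cmod (exp (z * indicator B x) - (\<Sum>k<n. (z * indicator B x) ^ k / fact k)) \<le> e n"
        by (cases "x \<in> B") (simp_all add: e_def)
      ultimately show ?case by (simp only: norm_mult mult_right_mono norm_ge_zero)
    qed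
  qed
  moreover have lim: "(\<lambda>n. e n * hnorm (L2 M) f) \<longlonglongrightarrow> 0"
  proof -
    have "(\<lambda>n. cmod (exp w - (\<Sum>k<n. w ^ k / fact k))) \<longlonglongrightarrow> 0" for w :: complex
      using exp_converges[of w] unfolding sums_def
      by (intro tendsto_norm_zero) (auto simp: scaleR_conv_of_real divide_inverse mult.commute intro: tendsto_eq_intros)
    from tendsto_add[OF this[of z] this[of 0]] show ?thesis
      unfolding e_def by (intro tendsto_mult_left_zero) simp
  qed
  ultimately have glim: "(\<lambda>n. hnorm (L2 M) (\<lambda>x. ?g x - ?p n x)) \<longlonglongrightarrow> 0"
    by (intro tendsto_sandwich[OF _ _ tendsto_const lim])
      (auto intro!: always_eventually L2.hnorm_nonneg L2.diff_closed g p)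
  then have "\<exists>g. g \<in> vecs (L2 M) \<and> (\<lambda>n. hnorm (L2 M) (\<lambda>x. g x - ?p n x)) \<longlonglongrightarrow> 0"
    using g by blast
  then have *: "op_exp (L2 M) A f \<in> vecs (L2 M) \<and> (\<lambda>n. hnorm (L2 M) (\<lambda>x. op_exp (L2 M) A f x - ?p n x)) \<longlonglongrightarrow> 0"
    unfolding op_exp_def by (rule someI_ex)
  then show v: "op_exp (L2 M) A f \<in> vecs (L2 M)" by blast
  have "heq (L2 M) (op_exp (L2 M) A f) ?g"
  proof (rule L2.limit_unique[where k = ?p and F = sequentially])
    show "(\<lambda>n. hnorm (L2 M) (\<lambda>x. ?p n x - op_exp (L2 M) A f x)) \<longlonglongrightarrow> 0"
      using * by (subst L2.hnorm_minus_commute[OF p v]) blast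
    show "(\<lambda>n. hnorm (L2 M) (\<lambda>x. ?p n x - ?g x)) \<longlonglongrightarrow> 0"
      using glim by (subst L2.hnorm_minus_commute[OF p g])
  qed (use v g p in auto)
  then show "AE x in M. op_exp (L2 M) A f x = exp (z * indicator B x) * f x"
    by (simp add: heq_L2_iff v g)
qed

text \<open>The second quantization of multiplication by \<open>u\<close>: each particle picks up
  its own factor. For measurable \<open>u\<close> of modulus 1 it is unitary, and it is the explicit
  candidate for the group.\<close>

definition mult_quant :: "('a \<Rightarrow> complex) \<Rightarrow> (nat \<times> (nat \<Rightarrow> 'a) \<Rightarrow> complex) \<Rightarrow> nat \<times> (nat \<Rightarrow> 'a) \<Rightarrow> complex" where
  "mult_quant u F = (\<lambda>(n, x). (\<Prod>i<n. u (x i)) * F (n, x))"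

lemma mult_quant_exp_vec: "mult_quant u (exp_vec \<phi>) = exp_vec (\<lambda>x. u x * \<phi> x)"
  by (auto simp: mult_quant_def exp_vec_def prod.distrib)

context sigma_finite_measure
begin

lemma mult_quant_vecs:
  assumes u: "u \<in> borel_measurable M" "\<And>x. cmod (u x) = 1" and F: "F \<in> vecs (fock M)"
  shows "mult_quant u F \<in> vecs (fock M)"
proof -
  have "(\<lambda>x. \<Prod>i<n. u (x i)) \<in> borel_measurable (nfold M n)" for n
    unfolding nfold_def using u(1)
    by (intro borel_measurable_prod measurable_compose[OF measurable_component_singleton]) auto
  then have m: "(\<lambda>x. mult_quant u F (n, x)) \<in> borel_measurable (nfold M n)" for n
    using fock_vecs_component[OF F, of n] by (auto simp: mult_quant_def L2_vecs_iff)
  have c: "cmod (mult_quant u F (n, x)) = cmod (F (n, x))" for n x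
    by (simp add: mult_quant_def norm_mult prod_norm[symmetric] u(2))
  have v: "(\<lambda>x. mult_quant u F (n, x)) \<in> vecs (L2 (nfold M n))" for n
    using fock_vecs_component[OF F, of n] m by (simp add: L2_vecs_iff c)
  have h: "hnorm (L2 (nfold M n)) (\<lambda>x. mult_quant u F (n, x)) = hnorm (L2 (nfold M n)) (\<lambda>x. F (n, x))" for n
  proof (rule power2_eq_imp_eq)
    show "(hnorm (L2 (nfold M n)) (\<lambda>x. mult_quant u F (n, x)))\<^sup>2 = (hnorm (L2 (nfold M n)) (\<lambda>x. F (n, x)))\<^sup>2"
      unfolding hnorm_L2_sq[OF v] hnorm_L2_sq[OF fock_vecs_component[OF F]] c ..
  qed (intro L2.hnorm_nonneg v fock_vecs_component[OF F])+
  have perm: "(\<Prod>i<n. u ((x \<circ> \<sigma>) i)) = (\<Prod>i<n. u (x i))" if "\<sigma> permutes {..<n}" for n \<sigma> and x :: "nat \<Rightarrow> 'a"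
    using prod.permute[OF that, of "\<lambda>i. u (x i)"] by (simp add: o_def)
  show ?thesis unfolding fock_vecs_iff
  proof (intro conjI allI impI v)
    fix n and \<sigma> :: "nat \<Rightarrow> nat" assume \<sigma>: "\<sigma> permutes {..<n}"
    then have "AE x in nfold M n. F (n, x \<circ> \<sigma>) = F (n, x)" using F by (auto simp: fock_vecs_iff)
    then show "AE x in nfold M n. mult_quant u F (n, x \<circ> \<sigma>) = mult_quant u F (n, x)"
      using perm[OF \<sigma>] by (auto simp: mult_quant_def)
  qed (use F in \<open>simp add: h fock_vecs_iff\<close>)
qed

lemma unitary_mult_quant:
  assumes u: "u \<in> borel_measurable M" "\<And>x. cmod (u x) = 1"
  shows "unitary_op (fock M) (mult_quant u)"
  unfolding unitary_op_def linear_op_def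
proof (intro conjI ballI allI)
  fix F G :: "nat \<times> (nat \<Rightarrow> 'a) \<Rightarrow> complex" and c
  assume F: "F \<in> vecs (fock M)"
  have uc: "u x * cnj (u x) = 1" for x using u(2)[of x] complex_norm_square[of "u x"] by simp
  note v = mult_quant_vecs[OF u]
  show "mult_quant u F \<in> vecs (fock M)" by (rule v[OF F])
  show "heq (fock M) (mult_quant u (\<lambda>x. c * F x)) (\<lambda>x. c * mult_quant u F x)"
    using v[OF fock.scale_closed[OF F]] fock.scale_closed[OF v[OF F]]
    by (subst heq_fock_iff) (auto simp: mult_quant_def)
  assume G: "G \<in> vecs (fock M)"
  show "heq (fock M) (mult_quant u (\<lambda>x. F x + G x)) (\<lambda>x. mult_quant u F x + mult_quant u G x)"
    using v[OF fock.add_closed[OF F G]] fock.add_closed[OF v[OF F] v[OF G]]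
    by (subst heq_fock_iff) (auto simp: mult_quant_def distrib_left)
  have eq: "(\<Prod>i<n. u (x i)) * F (n, x) * cnj ((\<Prod>i<n. u (x i)) * G (n, x)) = F (n, x) * cnj (G (n, x))" for n x
  proof -
    have "(\<Prod>i<n. u (x i)) * F (n, x) * cnj ((\<Prod>i<n. u (x i)) * G (n, x))
      = (\<Prod>i<n. u (x i) * cnj (u (x i))) * (F (n, x) * cnj (G (n, x)))"
      by (simp add: prod.distrib)
    then show ?thesis by (simp add: uc)
  qed
  show "ip (fock M) (mult_quant u F) (mult_quant u G) = ip (fock M) F G"
    by (simp only: ip_fock ip_L2 mult_quant_def prod.case eq)
next
  fix G assume G: "G \<in> vecs (fock M)"
  have uc: "u x * cnj (u x) = 1" for x using u(2)[of x] complex_norm_square[of "u x"] by simp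
  have cu: "(\<lambda>x. cnj (u x)) \<in> borel_measurable M" "\<And>x. cmod (cnj (u x)) = 1"
    using u by (auto intro: measurable_compose[OF _ borel_measurable_continuous_onI] continuous_intros)
  have "mult_quant u (mult_quant (\<lambda>x. cnj (u x)) G) = G"
    by (auto simp: mult_quant_def uc simp flip: mult.assoc prod.distrib)
  then show "\<exists>F\<in>vecs (fock M). heq (fock M) (mult_quant u F) G"
    using mult_quant_vecs[OF cu G] fock.heq_refl[OF G] by metis
qed

text \<open>The operators \<open>mult_quant (u r)\<close> satisfy the specification, so the chosen
  group satisfies it as well. It need not be \<open>mult_quant\<close>; what is known is its
  unitarity and its values on exponential vectors.\<close>

lemma second_quant_group_spec:
  assumes B: "B \<in> sets M" and h: "acts_as_mult M B (complex_of_real c) h"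
  shows "unitary_op (fock M) (second_quant_group M h r)"
    and "\<psi> \<in> vecs (L2 M) \<Longrightarrow> heq (fock M) (second_quant_group M h r (exp_vec \<psi>))
           (exp_vec (\<lambda>x. exp (\<i> * of_real (r * c) * indicator B x) * \<psi> x))"
proof -
  define u where "u = (\<lambda>(r::real) x. exp (\<i> * of_real (r * c) * indicator B x))"
  let ?E = "\<lambda>r \<psi>. exp_vec (op_exp (L2 M) (\<lambda>f x. \<i> * complex_of_real r * h f x) \<psi>)"
  have um: "u r \<in> borel_measurable M" for r
    unfolding u_def using B
    by (intro measurable_compose[OF _ borel_measurable_exp] borel_measurable_times borel_measurable_indicator) auto
  have u1: "cmod (u r x) = 1" for r x by (simp add: u_def indicator_def)
  have "acts_as_mult M B (\<i> * of_real (r * c)) (\<lambda>f x. \<i> * complex_of_real r * h f x)" for r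
    using acts_as_mult_lincomb[OF h h, of "\<i> * of_real r" 0] by (simp add: mult.assoc)
  note oe = op_exp_mult[OF B this]
  have uv: "(\<lambda>x. u r x * \<psi> x) \<in> vecs (L2 M)" if "\<psi> \<in> vecs (L2 M)" for r \<psi>
    by (rule L2_vecs_bound[OF that, of _ 1])
      (use um[of r] that in \<open>auto simp: norm_mult u1 L2_vecs_iff intro!: borel_measurable_times\<close>)
  have heq_E: "heq (fock M) (?E r \<psi>) (exp_vec (\<lambda>x. u r x * \<psi> x))" if "\<psi> \<in> vecs (L2 M)" for r \<psi>
    using oe[OF that, of r] uv[OF that, of r] AE_exp_vec_cong
    by (subst heq_fock_iff) (auto simp: exp_vec_vecs u_def)
  let ?P = "\<lambda>U. \<forall>r. unitary_op (fock M) (U r) \<and>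
        (\<forall>\<psi>\<in>vecs (L2 M). heq (fock M) (U r (exp_vec \<psi>)) (?E r \<psi>))"
  have "?P (\<lambda>r. mult_quant (u r))"
    unfolding mult_quant_exp_vec
  proof (intro allI conjI ballI)
    fix r \<psi> assume \<psi>: "\<psi> \<in> vecs (L2 M)"
    show "heq (fock M) (exp_vec (\<lambda>x. u r x * \<psi> x)) (?E r \<psi>)"
      by (rule fock.heq_sym[OF exp_vec_vecs[OF oe(1)[OF \<psi>]] exp_vec_vecs[OF uv[OF \<psi>]] heq_E[OF \<psi>]])
  qed (rule unitary_mult_quant[OF um u1])
  then have "\<exists>U. ?P U" by (rule exI[where P = ?P])
  then have *: "?P (second_quant_group M h)"
    unfolding second_quant_group_def by (rule someI_ex)
  then show unit: "unitary_op (fock M) (second_quant_group M h r)" by blast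
  assume \<psi>: "\<psi> \<in> vecs (L2 M)"
  have "second_quant_group M h r (exp_vec \<psi>) \<in> vecs (fock M)"
    using unit exp_vec_vecs[OF \<psi>] unfolding unitary_op_def linear_op_def by blast
  then have "heq (fock M) (second_quant_group M h r (exp_vec \<psi>)) (exp_vec (\<lambda>x. u r x * \<psi> x))"
    by (rule fock.heq_trans[OF _ exp_vec_vecs[OF oe(1)[OF \<psi>]] exp_vec_vecs[OF uv[OF \<psi>]] _ heq_E[OF \<psi>]])
      (use * \<psi> in blast)
  then show "heq (fock M) (second_quant_group M h r (exp_vec \<psi>))
           (exp_vec (\<lambda>x. exp (\<i> * of_real (r * c) * indicator B x) * \<psi> x))"
    by (simp add: u_def)
qed

text \<open>
  An isometry is determined on the closed span of the vectors \<open>e(z\<phi>)\<close>, \<open>z \<in> \<complex>\<close>: the inner products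
  with all \<open>e(z\<phi>)\<close> form a power series in \<open>z\<close>, whose coefficients are the inner products with
  the \<open>n\<close>-particle vectors.
\<close>

lemma second_quant_group_exp_comb:
  assumes B: "B \<in> sets M" and h: "acts_as_mult M B (complex_of_real c) h"
    and \<phi>: "\<phi> \<in> vecs (L2 M)" "\<And>x. x \<notin> B \<Longrightarrow> \<phi> x = 0"
    and a: "poly_growth a" and F: "F \<in> vecs (fock M)" and Fa: "heq (fock M) F (exp_comb a \<phi>)"
  shows "heq (fock M) (second_quant_group M h r F) (exp_comb (\<lambda>n. exp (\<i> * of_real (r * c)) ^ n * a n) \<phi>)"
proof -
  define U where "U = second_quant_group M h r"
  define \<theta> where "\<theta> = exp (\<i> * of_real (r * c))"
  define s where "s = (hnorm (L2 M) \<phi>)\<^sup>2"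
  define G where "G = U F"
  define \<gamma> where "\<gamma> = (\<lambda>n. ip (L2 (nfold M n)) (\<lambda>x. G (n, x)) (\<lambda>x. exp_vec \<phi> (n, x)))"
  let ?e = "\<lambda>z. exp_vec (\<lambda>x. z * \<phi> x)"
  have th1: "cmod \<theta> = 1" by (simp add: \<theta>_def)
  have thc: "\<theta> * cnj \<theta> = 1" using complex_norm_square[of \<theta>] th1 by simp
  have U: "unitary_op (fock M) U" unfolding U_def by (rule second_quant_group_spec[OF B h])
  have Uv: "U K \<in> vecs (fock M)" if "K \<in> vecs (fock M)" for K
    using U that by (simp add: unitary_op_def linear_op_def)
  have Uip: "ip (fock M) (U K) (U K') = ip (fock M) K K'" if "K \<in> vecs (fock M)" "K' \<in> vecs (fock M)" for K K'
    using U that by (simp add: unitary_op_def)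
  have ev: "?e z \<in> vecs (fock M)" for z by (intro exp_vec_vecs L2.scale_closed \<phi>)
  have Gv: "G \<in> vecs (fock M)" unfolding G_def by (rule Uv[OF F])
  have Ue: "heq (fock M) (U (?e z)) (?e (\<theta> * z))" for z
  proof -
    have "(\<lambda>x. exp (\<i> * of_real (r * c) * indicator B x) * (z * \<phi> x)) = (\<lambda>x. \<theta> * z * \<phi> x)"
      using \<phi>(2) by (auto simp: fun_eq_iff indicator_def \<theta>_def)
    then show ?thesis
      using second_quant_group_spec(2)[OF B h L2.scale_closed[OF \<phi>(1)], of r z] by (simp add: U_def)
  qed
  have ip_e: "ip (fock M) K (?e w) = suminf (\<lambda>n. ip (L2 (nfold M n)) (\<lambda>x. K (n, x)) (\<lambda>x. exp_vec \<phi> (n, x)) * cnj w ^ n)"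
    and sm: "summable (\<lambda>n. ip (L2 (nfold M n)) (\<lambda>x. K (n, x)) (\<lambda>x. exp_vec \<phi> (n, x)) * cnj w ^ n)"
    if K: "K \<in> vecs (fock M)" for K w
    using summable_ip_fock[OF K ev[of w]] L2.ip_scale_right[OF exp_vec_component[OF \<phi>(1)] fock_vecs_component[OF K]]
    by (simp_all add: ip_fock exp_vec_scale exp_comb_def mult.commute)
  \<comment> \<open>Since \<open>U\<close> is isometric and maps \<open>e(cnj z \<phi>)\<close> to
    \<open>e(\<theta> cnj z \<phi>)\<close>, the products of \<open>G\<close> with the latter and of
    \<open>F\<close> with the former agree; both are power series in \<open>z\<close>.\<close>
  have coeff: "\<gamma> n * cnj \<theta> ^ n = a n * of_real (s ^ n / fact n)" for n
  proof (rule power_series_unique)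
    fix z
    show 1: "summable (\<lambda>n. \<gamma> n * cnj \<theta> ^ n * z ^ n)"
      using sm[OF Gv, of "\<theta> * cnj z"] by (simp add: \<gamma>_def power_mult_distrib mult.assoc)
    have eq: "ip (L2 (nfold M n)) (\<lambda>x. exp_comb a \<phi> (n, x)) (\<lambda>x. exp_vec \<phi> (n, x)) = a n * of_real (s ^ n / fact n)" for n
      using L2.ip_scale_left[OF exp_vec_component exp_vec_component, OF \<phi>(1) \<phi>(1), of n "a n"]
        ip_exp_vec_component[OF \<phi>(1) \<phi>(1), of n]
      by (simp add: exp_comb_def s_def L2.ip_self[OF \<phi>(1)])
    show 2: "summable (\<lambda>n. a n * of_real (s ^ n / fact n) * z ^ n)"
      using sm[OF exp_comb_vecs[OF \<phi>(1) a], of "cnj z"] by (simp only: eq complex_cnj_cnj)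
    have "suminf (\<lambda>n. \<gamma> n * cnj \<theta> ^ n * z ^ n) = ip (fock M) G (?e (\<theta> * cnj z))"
      using ip_e[OF Gv, of "\<theta> * cnj z"] by (simp add: \<gamma>_def power_mult_distrib mult.assoc)
    also have "\<dots> = ip (fock M) G (U (?e (cnj z)))"
      by (rule fock.ip_heq_right[OF Uv[OF ev] ev Gv Ue, symmetric])
    also have "\<dots> = ip (fock M) F (?e (cnj z))" unfolding G_def by (rule Uip[OF F ev])
    also have "\<dots> = ip (fock M) (exp_comb a \<phi>) (?e (cnj z))"
      by (rule fock.ip_heq_left[OF F exp_comb_vecs[OF \<phi>(1) a] ev Fa])
    also have "\<dots> = suminf (\<lambda>n. a n * of_real (s ^ n / fact n) * z ^ n)"
      using ip_e[OF exp_comb_vecs[OF \<phi>(1) a], of "cnj z"] by (simp only: eq complex_cnj_cnj)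
    finally show "suminf (\<lambda>n. \<gamma> n * cnj \<theta> ^ n * z ^ n) = suminf (\<lambda>n. a n * of_real (s ^ n / fact n) * z ^ n)" .
  qed
  let ?b = "\<lambda>n. \<theta> ^ n * a n"
  have bg: "poly_growth ?b"
    by (intro poly_growth_mult a poly_growth_unimodular) (simp add: norm_power th1)
  have bv: "exp_comb ?b \<phi> \<in> vecs (fock M)" by (rule exp_comb_vecs[OF \<phi>(1) bg])
  have gn: "\<gamma> n = \<theta> ^ n * a n * of_real (s ^ n / fact n)" for n
  proof -
    have "\<gamma> n = \<gamma> n * (\<theta> * cnj \<theta>) ^ n" by (simp add: thc)
    also have "\<dots> = \<theta> ^ n * (\<gamma> n * cnj \<theta> ^ n)" by (simp add: power_mult_distrib)
    finally show ?thesis by (simp add: coeff)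
  qed
  have "ip (fock M) G (exp_comb ?b \<phi>) = suminf (\<lambda>n. cnj (?b n) * \<gamma> n)"
    using L2.ip_scale_right[OF exp_vec_component[OF \<phi>(1)] fock_vecs_component[OF Gv]]
    by (simp add: ip_fock exp_comb_def \<gamma>_def)
  also have "\<dots> = ip (fock M) (exp_comb ?b \<phi>) (exp_comb ?b \<phi>)"
    unfolding ip_exp_comb[OF \<phi>(1)] s_def[symmetric] by (simp add: gn mult_ac)
  finally have ipG: "Re (ip (fock M) G (exp_comb ?b \<phi>)) = (hnorm (fock M) (exp_comb ?b \<phi>))\<^sup>2"
    by (simp add: fock.hnorm_sq[OF bv])
  have "(hnorm (fock M) G)\<^sup>2 = (hnorm (fock M) F)\<^sup>2"
    using Uip[OF F F] by (simp add: G_def hnorm_def)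
  also have "\<dots> = (hnorm (fock M) (exp_comb a \<phi>))\<^sup>2"
    using fock.hnorm_heq[OF F exp_comb_vecs[OF \<phi>(1) a] Fa] by simp
  also have "\<dots> = (hnorm (fock M) (exp_comb ?b \<phi>))\<^sup>2"
    unfolding hnorm_exp_comb_sq[OF \<phi>(1) a] hnorm_exp_comb_sq[OF \<phi>(1) bg]
    by (simp add: norm_mult norm_power th1)
  finally have Gb: "(hnorm (fock M) G)\<^sup>2 = (hnorm (fock M) (exp_comb ?b \<phi>))\<^sup>2" .
  \<comment> \<open>The coefficients only determine the projection of \<open>G\<close> onto the span
    of the \<open>e(z \<phi>)\<close>. Equality of the norms shows that there is no other
    component.\<close>
  have "(hnorm (fock M) (\<lambda>x. G x - exp_comb ?b \<phi> x))\<^sup>2 = 0"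
    unfolding fock.hnorm_diff_sq[OF Gv bv] ipG Gb by simp
  then have "heq (fock M) G (exp_comb ?b \<phi>)" unfolding heq_def by (simp only: power_eq_0_iff)
  then show ?thesis unfolding G_def U_def \<theta>_def .
qed

end

text \<open>First-order Taylor remainder; the factor \<open>exp |Re z|\<close> of the general bound
  is 1 on the imaginary axis.\<close>

lemma norm_exp_i_diff_le: "cmod (exp (\<i> * of_real x) - 1 - \<i> * of_real x) \<le> x\<^sup>2"
  using Taylor_exp[of "\<i> * of_real x" 1] by (simp add: norm_mult diff_diff_eq power2_eq_square)

context sigma_finite_measure
begin

text \<open>On coefficients the difference quotient is multiplication by
  \<open>(exp (\<i> r c n) - 1) / (\<i> r)\<close>, which differs from \<open>c n\<close> by at most
  \<open>|r| (c n)^2\<close>. Polynomial growth makes this error square summable against the weights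
  \<open>s^n / n!\<close>, so the quotients converge in norm, at a rate linear in
  \<open>r\<close>.\<close>

lemma Lambda_sa_exp_comb:
  assumes B: "B \<in> sets M" and h: "acts_as_mult M B (complex_of_real c) h"
    and \<phi>: "\<phi> \<in> vecs (L2 M)" "\<And>x. x \<notin> B \<Longrightarrow> \<phi> x = 0"
    and a: "poly_growth a" and F: "F \<in> vecs (fock M)" and Fa: "heq (fock M) F (exp_comb a \<phi>)"
  shows "Lambda_sa M h F \<in> vecs (fock M)"
    and "heq (fock M) (Lambda_sa M h F) (exp_comb (\<lambda>n. of_real c * of_nat n * a n) \<phi>)"
proof -
  let ?U = "second_quant_group M h"
  define b where "b = (\<lambda>n. complex_of_real c * of_nat n * a n)"
  define s where "s = (hnorm (L2 M) \<phi>)\<^sup>2"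
  have bg: "poly_growth b" unfolding b_def by (intro poly_growth_mult poly_growth_const poly_growth_of_nat a)
  let ?G = "exp_comb b \<phi>"
  let ?D = "\<lambda>r x. (?U r F x - F x) / (\<i> * complex_of_real r)"
  have G: "?G \<in> vecs (fock M)" by (rule exp_comb_vecs[OF \<phi>(1) bg])
  have Uv: "?U r F \<in> vecs (fock M)" for r
    using second_quant_group_spec(1)[OF B h] F by (auto simp: unitary_op_def linear_op_def)
  have D: "?D r \<in> vecs (fock M)" for r
    using fock.scale_closed[OF fock.diff_closed[OF Uv[of r] F], of "1 / (\<i> * complex_of_real r)"] by simp
  \<comment> \<open>The fourth power is the square of the second-order bound \<open>(c n)^2\<close>;
    \<open>C\<close> is the Fock norm of that bound.\<close>
  define C where "C = sqrt (suminf (\<lambda>n. cmod ((of_real c * of_nat n)^4 * (a n)\<^sup>2) * s ^ n / fact n))"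
  have lim: "((\<lambda>r. hnorm (fock M) (\<lambda>x. ?D r x - ?G x)) \<longlongrightarrow> 0) (at 0)"
  proof (rule tendsto_sandwich[OF _ _ tendsto_const])
    show "((\<lambda>r. \<bar>r\<bar> * C) \<longlongrightarrow> 0) (at 0)" by (auto intro!: tendsto_eq_intros)
    show "\<forall>\<^sub>F r in at 0. 0 \<le> hnorm (fock M) (\<lambda>x. ?D r x - ?G x)"
      by (intro always_eventually allI fock.hnorm_nonneg fock.diff_closed D G)
    have "hnorm (fock M) (\<lambda>x. ?D r x - ?G x) \<le> \<bar>r\<bar> * C" if "r \<noteq> 0" for r :: real
    proof -
      define \<theta> where "\<theta> = exp (\<i> * of_real (r * c))"
      let ?d = "\<lambda>n. (\<theta> ^ n * a n - a n) / (\<i> * complex_of_real r) - b n"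
      have th: "poly_growth (\<lambda>n. \<theta> ^ n)" by (rule poly_growth_unimodular) (simp add: \<theta>_def norm_power)
      have dg: "poly_growth ?d"
      proof -
        have "poly_growth (\<lambda>n. (1 / (\<i> * complex_of_real r)) * (\<theta> ^ n * a n + (-1) * a n) + (-1) * b n)"
          by (intro poly_growth_add poly_growth_mult poly_growth_const a th bg)
        then show ?thesis by simp
      qed
      have dv: "exp_comb ?d \<phi> \<in> vecs (fock M)" by (rule exp_comb_vecs[OF \<phi>(1) dg])
      have tv: "exp_comb (\<lambda>n. \<theta> ^ n * a n) \<phi> \<in> vecs (fock M)"
        by (intro exp_comb_vecs[OF \<phi>(1)] poly_growth_mult a th)
      have 1: "AE x in nfold M n. ?U r F (n, x) = exp_comb (\<lambda>n. \<theta> ^ n * a n) \<phi> (n, x)" for n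
        using second_quant_group_exp_comb[OF B h \<phi> a F Fa, of r] heq_fock_iff[OF Uv tv, of r]
        by (simp add: \<theta>_def)
      have 2: "AE x in nfold M n. F (n, x) = exp_comb a \<phi> (n, x)" for n
        using Fa heq_fock_iff[OF F exp_comb_vecs[OF \<phi>(1) a]] by simp
      have "AE x in nfold M n. ?D r (n, x) - ?G (n, x) = exp_comb ?d \<phi> (n, x)" for n
        using 1[of n] 2[of n]
        by eventually_elim (simp add: exp_comb_def algebra_simps diff_divide_distrib)
      then have "heq (fock M) (\<lambda>x. ?D r x - ?G x) (exp_comb ?d \<phi>)"
        by (subst heq_fock_iff[OF fock.diff_closed[OF D G] dv]) simp
      then have "(hnorm (fock M) (\<lambda>x. ?D r x - ?G x))\<^sup>2 = (hnorm (fock M) (exp_comb ?d \<phi>))\<^sup>2"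
        using fock.hnorm_heq[OF fock.diff_closed[OF D G] dv] by simp
      also have "\<dots> = suminf (\<lambda>n. (cmod (?d n))\<^sup>2 * s ^ n / fact n)"
        unfolding s_def by (rule hnorm_exp_comb_sq[OF \<phi>(1) dg])
      also have "\<dots> \<le> suminf (\<lambda>n. r\<^sup>2 * (cmod ((of_real c * of_nat n)^4 * (a n)\<^sup>2) * s ^ n / fact n))"
      proof (rule suminf_le)
        fix n
        define x where "x = r * c * real n"
        have "\<theta> ^ n = exp (\<i> * of_real x)"
          by (simp add: \<theta>_def x_def exp_of_nat_mult[symmetric] mult_ac)
        then have "?d n = (exp (\<i> * of_real x) - 1 - \<i> * of_real x) / (\<i> * of_real r) * a n"
          using that by (simp add: b_def x_def field_simps)
        then have "cmod (?d n) = cmod (exp (\<i> * of_real x) - 1 - \<i> * of_real x) / \<bar>r\<bar> * cmod (a n)"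
          by (simp add: norm_mult norm_divide)
        also have "\<dots> \<le> x\<^sup>2 / \<bar>r\<bar> * cmod (a n)"
          by (intro mult_right_mono divide_right_mono norm_exp_i_diff_le) auto
        finally have "(cmod (?d n))\<^sup>2 \<le> (x\<^sup>2 / \<bar>r\<bar> * cmod (a n))\<^sup>2" by (intro power_mono) auto
        also have "\<dots> = r\<^sup>2 * cmod ((of_real c * of_nat n)^4 * (a n)\<^sup>2)"
          using that by (simp add: x_def norm_mult norm_power power_mult_distrib power_divide field_simps
              flip: power_mult power_add)
        finally show "(cmod (?d n))\<^sup>2 * s ^ n / fact n
            \<le> r\<^sup>2 * (cmod ((of_real c * of_nat n)^4 * (a n)\<^sup>2) * s ^ n / fact n)"
          by (simp add: s_def divide_right_mono mult_right_mono flip: mult.assoc)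
      next
        show "summable (\<lambda>n. (cmod (?d n))\<^sup>2 * s ^ n / fact n)"
          using summable_poly_growth_exp[OF poly_growth_power[OF dg, of 2], of s] by (simp add: norm_power s_def)
        show "summable (\<lambda>n. r\<^sup>2 * (cmod ((of_real c * of_nat n)^4 * (a n)\<^sup>2) * s ^ n / fact n))"
          by (intro summable_mult summable_poly_growth_exp poly_growth_mult poly_growth_power a
              poly_growth_const poly_growth_of_nat) (simp add: s_def)
      qed
      also have "\<dots> = r\<^sup>2 * suminf (\<lambda>n. cmod ((of_real c * of_nat n)^4 * (a n)\<^sup>2) * s ^ n / fact n)"
        by (intro suminf_mult summable_poly_growth_exp poly_growth_mult poly_growth_power a
              poly_growth_const poly_growth_of_nat) (simp add: s_def)
      also have "\<dots> = (\<bar>r\<bar> * C)\<^sup>2"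
        unfolding C_def power_mult_distrib
        by (subst real_sqrt_pow2)
          (auto simp: s_def intro!: suminf_nonneg summable_poly_growth_exp poly_growth_mult poly_growth_power a
              poly_growth_const poly_growth_of_nat)
      finally show ?thesis
        by (rule power2_le_imp_le)
          (auto simp: C_def s_def intro!: mult_nonneg_nonneg suminf_nonneg summable_poly_growth_exp
            poly_growth_mult poly_growth_power a poly_growth_const poly_growth_of_nat)
    qed
    then show "\<forall>\<^sub>F r in at 0. hnorm (fock M) (\<lambda>x. ?D r x - ?G x) \<le> \<bar>r\<bar> * C"
      by (auto simp: eventually_at_filter)
  qed
  then have "\<exists>G. G \<in> vecs (fock M) \<and> ((\<lambda>r. hnorm (fock M) (\<lambda>x. ?D r x - G x)) \<longlongrightarrow> 0) (at 0)"
    using G by blast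
  then have *: "Lambda_sa M h F \<in> vecs (fock M) \<and>
      ((\<lambda>r. hnorm (fock M) (\<lambda>x. ?D r x - Lambda_sa M h F x)) \<longlongrightarrow> 0) (at 0)"
    unfolding Lambda_sa_def op_generator_def by (rule someI_ex)
  then show "Lambda_sa M h F \<in> vecs (fock M)" by blast
  then show "heq (fock M) (Lambda_sa M h F) (exp_comb (\<lambda>n. of_real c * of_nat n * a n) \<phi>)"
    using fock.limit_unique[OF _ G D _ conjunct2[OF *] lim] by (simp add: b_def)
qed

text \<open>The self-adjoint parts of multiplication by \<open>c\<close> are multiplications by
  \<open>Re c\<close> and \<open>Im c\<close>, and the two generators recombine to
  \<open>c\<close>.\<close>

lemma Lambda_exp_comb:
  assumes B: "B \<in> sets M" and h: "acts_as_mult M B c h"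
    and \<phi>: "\<phi> \<in> vecs (L2 M)" "\<And>x. x \<notin> B \<Longrightarrow> \<phi> x = 0"
    and a: "poly_growth a" and F: "F \<in> vecs (fock M)" and Fa: "heq (fock M) F (exp_comb a \<phi>)"
  shows "Lambda M h F \<in> vecs (fock M)"
    and "heq (fock M) (Lambda M h F) (exp_comb (\<lambda>n. c * of_nat n * a n) \<phi>)"
proof -
  let ?h1 = "\<lambda>f x. (h f x + op_adjoint (L2 M) h f x) / 2"
  let ?h2 = "\<lambda>f x. (h f x - op_adjoint (L2 M) h f x) / (2 * \<i>)"
  note adj = acts_as_mult_adjoint[OF B h]
  have 1: "acts_as_mult M B (of_real (Re c)) ?h1"
    using acts_as_mult_lincomb[OF h adj, of "1 / 2" "1 / 2"]
    by (simp add: add_divide_distrib[symmetric] complex_add_cnj)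
  have 2: "acts_as_mult M B (of_real (Im c)) ?h2"
  proof -
    have "?h2 = (\<lambda>f x. (- \<i> / 2) * h f x + (\<i> / 2) * op_adjoint (L2 M) h f x)"
      by (simp add: fun_eq_iff field_simps)
    moreover have "of_real (Im c) = (- \<i> / 2) * c + (\<i> / 2) * cnj c"
      by (simp add: complex_eq_iff)
    ultimately show ?thesis by (simp only: acts_as_mult_lincomb[OF h adj])
  qed
  let ?L1 = "Lambda_sa M ?h1 F" and ?L2 = "Lambda_sa M ?h2 F"
  note L1 = Lambda_sa_exp_comb[OF B 1 \<phi> a F Fa] and L2 = Lambda_sa_exp_comb[OF B 2 \<phi> a F Fa]
  show v: "Lambda M h F \<in> vecs (fock M)"
    unfolding Lambda_def by (intro fock.add_closed fock.scale_closed L1 L2)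
  have g: "poly_growth (\<lambda>n. d * of_nat n * a n)" for d
    by (intro poly_growth_mult poly_growth_const poly_growth_of_nat a)
  note gv = exp_comb_vecs[OF \<phi>(1) g]
  have "AE x in nfold M n. Lambda M h F (n, x) = exp_comb (\<lambda>n. c * of_nat n * a n) \<phi> (n, x)" for n
  proof -
    have "AE x in nfold M n. ?L1 (n, x) = exp_comb (\<lambda>n. of_real (Re c) * of_nat n * a n) \<phi> (n, x)"
         "AE x in nfold M n. ?L2 (n, x) = exp_comb (\<lambda>n. of_real (Im c) * of_nat n * a n) \<phi> (n, x)"
      using L1(2) L2(2) heq_fock_iff[OF L1(1) gv] heq_fock_iff[OF L2(1) gv] by blast+
    then show ?thesis
    proof eventually_elim
      case (elim x)
      have "c * of_nat n * a n * e
          = of_real (Re c) * of_nat n * a n * e + \<i> * (of_real (Im c) * of_nat n * a n * e)" for e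
        by (subst complex_eq[of c]) (simp add: algebra_simps)
      with elim show ?case by (simp only: Lambda_def exp_comb_def prod.case)
    qed
  qed
  then show "heq (fock M) (Lambda M h F) (exp_comb (\<lambda>n. c * of_nat n * a n) \<phi>)"
    using heq_fock_iff[OF v gv] by blast
qed

end

section \<open>Expectations in the state of an exponential vector\<close>

text \<open>With \<open>s\<close> the squared norm of \<open>\<phi>\<close>, this is the inner
  product of \<open>exp_comb a \<phi>\<close> with \<open>e(\<phi>)\<close>, normalized by the
  squared norm \<open>exp s\<close> of \<open>e(\<phi>)\<close>.\<close>

definition poisson_mean :: "real \<Rightarrow> (nat \<Rightarrow> complex) \<Rightarrow> complex" where
  "poisson_mean s a = suminf (\<lambda>n. a n * of_real (s ^ n / fact n)) / of_real (exp s)"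

lemma poisson_mean_cmult:
  assumes "0 \<le> s" "poly_growth a" shows "poisson_mean s (\<lambda>n. c * a n) = c * poisson_mean s a"
  using suminf_mult[OF summable_poly_growth_exp'[OF assms(2,1)], of c] by (simp add: poisson_mean_def mult.assoc)

lemma poisson_mean_sum:
  assumes "0 \<le> s" "finite I" "\<And>k. k \<in> I \<Longrightarrow> poly_growth (a k)"
  shows "poisson_mean s (\<lambda>n. \<Sum>k\<in>I. a k n) = (\<Sum>k\<in>I. poisson_mean s (a k))"
  using suminf_sum[of I "\<lambda>k n. a k n * of_real (s ^ n / fact n)"] summable_poly_growth_exp'[OF assms(3,1)]
  by (simp add: poisson_mean_def sum_distrib_right sum_divide_distrib)

text \<open>The Chen-Stein identity, from \<open>n s^n / n! = s s^(n-1) / (n-1)!\<close>. It drives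
  the recursion of the central moments.\<close>

lemma poisson_mean_shift:
  assumes "0 \<le> s" "poly_growth a"
  shows "poisson_mean s (\<lambda>n. of_nat n * a n) = of_real s * poisson_mean s (\<lambda>n. a (Suc n))"
proof -
  have eq: "of_nat (Suc n) * a (Suc n) * complex_of_real (s ^ Suc n / fact (Suc n))
      = of_real s * (a (Suc n) * complex_of_real (s ^ n / fact n))" for n
    by (simp add: field_simps del: of_nat_Suc)
  have 1: "summable (\<lambda>n. of_nat n * a n * complex_of_real (s ^ n / fact n))"
    by (intro summable_poly_growth_exp' poly_growth_mult poly_growth_of_nat assms)
  obtain K k where K: "\<And>n. cmod (a n) \<le> K * (1 + real n) ^ k" using assms(2) by (auto simp: poly_growth_def)
  have "poly_growth (\<lambda>n. a (Suc n))"
    unfolding poly_growth_def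
  proof (intro exI allI)
    fix n
    have "cmod (a (Suc n)) \<le> \<bar>K\<bar> * (1 + real (Suc n)) ^ k"
      using K[of "Suc n"] by (rule order_trans) (auto intro: mult_right_mono)
    also have "\<dots> \<le> \<bar>K\<bar> * (2 * (1 + real n)) ^ k"
      by (intro mult_left_mono power_mono) auto
    also have "\<dots> = (\<bar>K\<bar> * 2 ^ k) * (1 + real n) ^ k" by (simp only: power_mult_distrib mult.assoc)
    finally show "cmod (a (Suc n)) \<le> (\<bar>K\<bar> * 2 ^ k) * (1 + real n) ^ k" .
  qed
  from summable_poly_growth_exp'[OF this assms(1)]
  have 2: "summable (\<lambda>n. a (Suc n) * complex_of_real (s ^ n / fact n))" .
  show ?thesis
    using suminf_split_head[OF 1] suminf_mult[OF 2, of "of_real s"]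
    unfolding eq by (simp add: poisson_mean_def)
qed

lemma poisson_mean_1: "poisson_mean s (\<lambda>n. 1) = 1"
  using sums_of_real[OF exp_converges[of s], where 'a = complex]
  by (simp add: poisson_mean_def sums_iff divide_inverse mult.commute)

lemma poisson_mean_of_nat: "0 \<le> s \<Longrightarrow> poisson_mean s of_nat = of_real s"
  using poisson_mean_shift[OF _ poly_growth_const[of 1], of s] by (simp add: poisson_mean_1)

section \<open>The time space and the exponential state of a unit vector\<close>

lemma sigma_finite_time_space: "sigma_finite_measure (time_space d)"
  unfolding time_space_def
  by (intro sigma_finite_pair_measure sigma_finite_measure_restrict_space sigma_finite_lborel
      sigma_finite_measure_count_space_finite) auto

interpretation time_space: sigma_finite_measure "time_space d" for d
  by (rule sigma_finite_time_space)

lemma space_time_space: "space (time_space d) = {0..} \<times> {..<d}"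
  by (auto simp: time_space_def space_pair_measure space_restrict_space)

lemma rect_sets_time_space:
  assumes "A \<in> sets borel" "A \<subseteq> {0..}" "J \<subseteq> {..<d}" shows "A \<times> J \<in> sets (time_space d)"
  unfolding time_space_def using assms by (intro pair_measureI) (auto simp: sets_restrict_space)

lemma emeasure_rect_time_space:
  assumes "0 \<le> s" "i < d" shows "emeasure (time_space d) ({0..<s} \<times> {i}) = ennreal s"
proof -
  interpret c: sigma_finite_measure "count_space {..<d}"
    by (intro sigma_finite_measure_count_space_finite) auto
  have "{0..<s} \<subseteq> {0..}" by auto
  then show ?thesis
    unfolding time_space_def using assms
    by (subst c.emeasure_pair_measure_Times)
      (use emeasure_restrict_space[of "{0..}" lborel "{0..<s}"] in
        \<open>auto simp: sets_restrict_space intro!: image_eqI[of _ _ "{0..<s}"]\<close>)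
qed

lemma acts_as_mult_one_tensor:
  "acts_as_mult (time_space d) ({0..s} \<times> {..<d}) c (one_tensor d (c \<cdot>\<^sub>m 1\<^sub>m d) s)"
proof -
  have B: "{0..s} \<times> {..<d} \<in> sets (time_space d)" by (rule rect_sets_time_space) auto
  have eq: "one_tensor d (c \<cdot>\<^sub>m 1\<^sub>m d) s f x = c * indicator ({0..s} \<times> {..<d}) x * f x"
    if mem: "x \<in> space (time_space d)" for f x
  proof -
    obtain u i where x: "x = (u, i)" "i < d"
      using mem unfolding space_time_space by blast
    have "(\<Sum>j<d. (c \<cdot>\<^sub>m 1\<^sub>m d) $$ (i, j) * f (u, j)) = (\<Sum>j<d. if j = i then c * f (u, i) else 0)"
      using x(2) by (intro sum.cong) auto
    then show ?thesis using x by (simp add: one_tensor_def indicator_def)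
  qed
  show ?thesis unfolding acts_as_mult_def
  proof (intro ballI conjI)
    fix f assume "f \<in> vecs (L2 (time_space d))"
    then have "(\<lambda>x. c * indicator ({0..s} \<times> {..<d}) x * f x) \<in> vecs (L2 (time_space d))"
      using acts_as_mult_self[OF B, of c] by (simp add: acts_as_mult_def)
    \<comment> \<open>The two functions agree only on the measure space: for
      \<open>i \<ge> d\<close> the matrix entries are unspecified.\<close>
    moreover have "one_tensor d (c \<cdot>\<^sub>m 1\<^sub>m d) s f \<in> vecs (L2 (time_space d))
        \<longleftrightarrow> (\<lambda>x. c * indicator ({0..s} \<times> {..<d}) x * f x) \<in> vecs (L2 (time_space d))"
      by (rule L2_vecs_cong) (rule eq)
    ultimately show "one_tensor d (c \<cdot>\<^sub>m 1\<^sub>m d) s f \<in> vecs (L2 (time_space d))"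
      by blast
    show "AE x in time_space d. one_tensor d (c \<cdot>\<^sub>m 1\<^sub>m d) s f x = c * indicator ({0..s} \<times> {..<d}) x * f x"
      using eq by (intro AE_I2) simp
  qed
qed

text \<open>
  \<^const>\<open>state_vec\<close> is unconstrained outside of \<^term>\<open>space (time_space d)\<close>; the restriction removes
  the junk values there.
\<close>

definition restricted_state :: "nat \<Rightarrow> complex Matrix.vec \<Rightarrow> real \<Rightarrow> real \<times> nat \<Rightarrow> complex" where
  "restricted_state d \<psi> s = (\<lambda>(u, i). \<Sum>j<d. indicator ({0..<s} \<times> {j}) (u, i) * \<psi> $ j)"

lemma restricted_state_eq: "i < d \<Longrightarrow> restricted_state d \<psi> s (u, i) = state_vec \<psi> s (u, i)"
proof -
  assume i: "i < d"
  have "restricted_state d \<psi> s (u, i) = (\<Sum>j<d. if j = i then indicator {0..<s} u * \<psi> $ i else 0)"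
    unfolding restricted_state_def prod.case by (intro sum.cong) (auto simp: indicator_def)
  then show ?thesis using i by (simp add: state_vec_def)
qed

text \<open>The state lives on the half-open interval \<open>{0..<s}\<close>, the operator on the
  closed \<open>{0..s}\<close>. This inclusion makes the multiplier constant on the support of the
  state.\<close>

lemma restricted_state_0: "x \<notin> {0..s} \<times> {..<d} \<Longrightarrow> restricted_state d \<psi> s x = 0"
  by (cases x) (auto simp: restricted_state_def indicator_def intro!: sum.neutral)

lemma restricted_state_L2:
  assumes "0 \<le> s" "\<psi> \<in> carrier_vec d" "\<psi> \<bullet>c \<psi> = 1"
  shows "restricted_state d \<psi> s \<in> vecs (L2 (time_space d))"
    and "(hnorm (L2 (time_space d)) (restricted_state d \<psi> s))\<^sup>2 = s"
proof -
  let ?M = "time_space d" and ?I = "\<lambda>j. indicator ({0..<s} \<times> {j}) :: _ \<Rightarrow> real"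
  have R: "{0..<s} \<times> {j} \<in> sets ?M" if "j < d" for j
    using that by (intro rect_sets_time_space) auto
  have sq: "(cmod (restricted_state d \<psi> s x))\<^sup>2 = (\<Sum>j<d. (cmod (\<psi> $ j))\<^sup>2 * ?I j x)" for x
  proof (cases x)
    case (Pair u i)
    have "restricted_state d \<psi> s x = (\<Sum>j<d. if j = i then indicator {0..<s} u * \<psi> $ i else 0)"
      unfolding restricted_state_def Pair prod.case by (intro sum.cong) (auto simp: indicator_def)
    moreover have "(\<Sum>j<d. (cmod (\<psi> $ j))\<^sup>2 * ?I j x) = (\<Sum>j<d. if j = i then (cmod (\<psi> $ i))\<^sup>2 * indicator {0..<s} u else 0)"
      unfolding Pair by (intro sum.cong) (auto simp: indicator_def)
    ultimately show ?thesis by (simp add: norm_mult indicator_def)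
  qed
  have int: "integrable ?M (\<lambda>x. (cmod (\<psi> $ j))\<^sup>2 * ?I j x)" if "j < d" for j
    using that R emeasure_rect_time_space[OF assms(1)] by (intro integrable_mult_right integrable_real_indicator) auto
  have meas: "restricted_state d \<psi> s \<in> borel_measurable ?M"
    unfolding restricted_state_def split_beta prod.collapse using R
    by (intro borel_measurable_sum borel_measurable_times borel_measurable_indicator) auto
  show v: "restricted_state d \<psi> s \<in> vecs (L2 ?M)"
    unfolding L2_vecs_iff sq by (intro conjI meas Bochner_Integration.integrable_sum int) simp
  have "(hnorm (L2 ?M) (restricted_state d \<psi> s))\<^sup>2 = (\<Sum>j<d. LINT x|?M. (cmod (\<psi> $ j))\<^sup>2 * ?I j x)"
    unfolding hnorm_L2_sq[OF v] sq by (intro Bochner_Integration.integral_sum int) simp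
  also have "\<dots> = (\<Sum>j<d. (cmod (\<psi> $ j))\<^sup>2) * s"
    using R emeasure_rect_time_space[OF assms(1)] assms(1)
    by (simp add: sum_distrib_right measure_def)
  also have "(\<Sum>j<d. (cmod (\<psi> $ j))\<^sup>2) = 1"
  proof -
    have "\<psi> \<bullet>c \<psi> = complex_of_real (\<Sum>j<d. (cmod (\<psi> $ j))\<^sup>2)"
      unfolding scalar_prod_def of_real_sum using assms(2)
      by (intro sum.cong) (auto simp: complex_norm_square simp del: of_real_power)
    then show ?thesis using assms(3) by (metis of_real_eq_1_iff)
  qed
  finally show "(hnorm (L2 ?M) (restricted_state d \<psi> s))\<^sup>2 = s" by simp
qed

context
  fixes d :: nat and \<psi> :: "complex Matrix.vec" and s :: real
  assumes s: "0 \<le> s" and \<psi>: "\<psi> \<in> carrier_vec d" "\<psi> \<bullet>c \<psi> = 1"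
begin

lemma heq_exp_vec_state:
  "exp_vec (state_vec \<psi> s) \<in> vecs (fock (time_space d))"
  "heq (fock (time_space d)) (exp_vec (state_vec \<psi> s)) (exp_comb (\<lambda>n. 1) (restricted_state d \<psi> s))"
proof -
  let ?M = "time_space d"
  note r = restricted_state_L2(1)[OF s \<psi>]
  have eq: "state_vec \<psi> s x = restricted_state d \<psi> s x" if "x \<in> space ?M" for x
    using that by (auto simp: space_time_space restricted_state_eq)
  have v: "state_vec \<psi> s \<in> vecs (L2 ?M)"
    using r L2_vecs_cong[of ?M "state_vec \<psi> s" "restricted_state d \<psi> s"] eq by blast
  show ev: "exp_vec (state_vec \<psi> s) \<in> vecs (fock ?M)"
    by (rule time_space.exp_vec_vecs[OF v])
  show "heq (fock ?M) (exp_vec (state_vec \<psi> s)) (exp_comb (\<lambda>n. 1) (restricted_state d \<psi> s))"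
    unfolding exp_comb_1 heq_fock_iff[OF ev time_space.exp_vec_vecs[OF r]]
    by (intro allI time_space.AE_exp_vec_cong AE_I2 eq)
qed

text \<open>Inner products do not see the difference between representatives, so both entries may be
  replaced by \<open>exp_comb\<close> over a vector of squared norm \<open>s\<close>.\<close>

lemma fock_expect_eq_poisson_mean:
  assumes a: "poly_growth a" and v: "X (exp_vec (state_vec \<psi> s)) \<in> vecs (fock (time_space d))"
    and X: "heq (fock (time_space d)) (X (exp_vec (state_vec \<psi> s))) (exp_comb a (restricted_state d \<psi> s))"
  shows "fock_expect (time_space d) (state_vec \<psi> s) X = poisson_mean s a"
proof -
  let ?M = "time_space d" and ?\<phi> = "restricted_state d \<psi> s" and ?e = "exp_vec (state_vec \<psi> s)"
  note r = restricted_state_L2[OF s \<psi>]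
  note ec = time_space.exp_comb_vecs[OF r(1)]
  have *: "ip (fock ?M) F ?e = suminf (\<lambda>n. b n * of_real (s ^ n / fact n))"
    if "F \<in> vecs (fock ?M)" "heq (fock ?M) F (exp_comb b ?\<phi>)" "poly_growth b" for F b
  proof -
    have "ip (fock ?M) F ?e = ip (fock ?M) (exp_comb b ?\<phi>) ?e"
      by (rule fock.ip_heq_left[OF that(1) ec[OF that(3)] heq_exp_vec_state(1) that(2)])
    also have "\<dots> = ip (fock ?M) (exp_comb b ?\<phi>) (exp_comb (\<lambda>n. 1) ?\<phi>)"
      by (rule fock.ip_heq_right[OF heq_exp_vec_state(1) ec[OF poly_growth_const] ec[OF that(3)] heq_exp_vec_state(2)])
    finally show ?thesis by (simp add: time_space.ip_exp_comb[OF r(1)] r(2))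
  qed
  have "ip (fock ?M) ?e ?e = suminf (\<lambda>n. 1 * of_real (s ^ n / fact n))"
    by (rule *[OF heq_exp_vec_state poly_growth_const])
  also have "\<dots> = of_real (exp s)"
    using sums_of_real[OF exp_converges[of s], where 'a = complex] by (simp add: sums_iff divide_inverse mult.commute)
  finally show ?thesis
    unfolding fock_expect_def poisson_mean_def by (simp add: *[OF v X a])
qed

lemma X_op_exp_comb:
  assumes U: "U_rep N d \<pi> S = c \<cdot>\<^sub>m 1\<^sub>m d"
    and a: "poly_growth a" and F: "F \<in> vecs (fock (time_space d))"
    and Fa: "heq (fock (time_space d)) F (exp_comb a (restricted_state d \<psi> s))"
  shows "X_op N d \<pi> S s F \<in> vecs (fock (time_space d))"
    and "heq (fock (time_space d)) (X_op N d \<pi> S s F) (exp_comb (\<lambda>n. c * of_nat n * a n) (restricted_state d \<psi> s))"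
proof -
  have B: "{0..s} \<times> {..<d} \<in> sets (time_space d)" by (rule rect_sets_time_space) auto
  note * = time_space.Lambda_exp_comb[OF B acts_as_mult_one_tensor restricted_state_L2(1)[OF s \<psi>]
      restricted_state_0 a F Fa, of c]
  show "X_op N d \<pi> S s F \<in> vecs (fock (time_space d))"
    and "heq (fock (time_space d)) (X_op N d \<pi> S s F) (exp_comb (\<lambda>n. c * of_nat n * a n) (restricted_state d \<psi> s))"
    using * by (simp_all add: X_op_def Lambda_s_def U)
qed

lemma fock_expect_X_op:
  assumes U: "U_rep N d \<pi> S = c \<cdot>\<^sub>m 1\<^sub>m d"
  shows "fock_expect (time_space d) (state_vec \<psi> s) (X_op N d \<pi> S s) = c * of_real s"
proof -
  note * = X_op_exp_comb[OF U poly_growth_const heq_exp_vec_state]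
  have g: "poly_growth (\<lambda>n. c * of_nat n * 1)" by (intro poly_growth_mult poly_growth_const poly_growth_of_nat)
  have "fock_expect (time_space d) (state_vec \<psi> s) (X_op N d \<pi> S s) = poisson_mean s (\<lambda>n. c * of_nat n * 1)"
    by (rule fock_expect_eq_poisson_mean[where X = "X_op N d \<pi> S s", OF g *])
  also have "\<dots> = c * poisson_mean s of_nat"
    using poisson_mean_cmult[OF s poly_growth_of_nat, of c] by simp
  finally show ?thesis by (simp add: poisson_mean_of_nat s)
qed

text \<open>The expectation of the operator is \<open>c s\<close>, so centring turns the multiplier
  \<open>c n\<close> into \<open>c (n - s)\<close>.\<close>

lemma X_tilde_exp_comb:
  assumes U: "U_rep N d \<pi> S = c \<cdot>\<^sub>m 1\<^sub>m d"
    and a: "poly_growth a" and F: "F \<in> vecs (fock (time_space d))"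
    and Fa: "heq (fock (time_space d)) F (exp_comb a (restricted_state d \<psi> s))"
    and \<kappa>_def: "\<kappa> = c / complex_of_real (real N powr (real (sum_list \<mu>) + 1 / 2))"
  shows "X_tilde N d \<pi> \<psi> \<mu> S s F \<in> vecs (fock (time_space d))"
    and "heq (fock (time_space d)) (X_tilde N d \<pi> \<psi> \<mu> S s F)
           (exp_comb (\<lambda>n. \<kappa> * (of_nat n - of_real s) * a n) (restricted_state d \<psi> s))"
    and "poly_growth (\<lambda>n. \<kappa> * (of_nat n - of_real s) * a n)"
proof -
  let ?M = "time_space d" and ?\<phi> = "restricted_state d \<psi> s"
  let ?p = "complex_of_real (real N powr (real (sum_list \<mu>) + 1 / 2))"
  note r = restricted_state_L2[OF s \<psi>]
  note X = X_op_exp_comb[OF U a F Fa]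
  have Xt: "X_tilde N d \<pi> \<psi> \<mu> S s F = (\<lambda>y. (1 / ?p) * (X_op N d \<pi> S s F y - c * of_real s * F y))"
    by (simp add: X_tilde_def fock_expect_X_op[OF U])
  show v: "X_tilde N d \<pi> \<psi> \<mu> S s F \<in> vecs (fock ?M)"
    unfolding Xt by (intro fock.scale_closed fock.diff_closed X F)
  have "poly_growth (\<lambda>n. \<kappa> * (of_nat n + (- of_real s)) * a n)"
    by (intro poly_growth_mult poly_growth_add poly_growth_const poly_growth_of_nat a)
  then show g: "poly_growth (\<lambda>n. \<kappa> * (of_nat n - of_real s) * a n)" by simp
  have gn: "poly_growth (\<lambda>n. c * of_nat n * a n)"
    by (intro poly_growth_mult poly_growth_const poly_growth_of_nat a)
  show "heq (fock ?M) (X_tilde N d \<pi> \<psi> \<mu> S s F) (exp_comb (\<lambda>n. \<kappa> * (of_nat n - of_real s) * a n) ?\<phi>)"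
    unfolding heq_fock_iff[OF v time_space.exp_comb_vecs[OF r(1) g]]
  proof
    fix n
    have "AE x in nfold ?M n. X_op N d \<pi> S s F (n, x) = exp_comb (\<lambda>n. c * of_nat n * a n) ?\<phi> (n, x)"
         "AE x in nfold ?M n. F (n, x) = exp_comb a ?\<phi> (n, x)"
      using X(2) Fa heq_fock_iff[OF X(1) time_space.exp_comb_vecs[OF r(1) gn]]
        heq_fock_iff[OF F time_space.exp_comb_vecs[OF r(1) a]] by blast+
    then show "AE x in nfold ?M n. X_tilde N d \<pi> \<psi> \<mu> S s F (n, x)
        = exp_comb (\<lambda>n. \<kappa> * (of_nat n - of_real s) * a n) ?\<phi> (n, x)"
      by eventually_elim (simp add: Xt exp_comb_def \<kappa>_def field_simps)
  qed
qed

text \<open>Each factor multiplies the coefficients by a constant times \<open>n - s\<close>. The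
  composition therefore leaves the product of the constants and the \<open>m\<close>-th power of
  \<open>n - s\<close>.\<close>

lemma fock_expect_X_tilde_prod:
  assumes U: "\<And>i. i \<in> {1..m} \<Longrightarrow> U_rep N d \<pi> (S i) = c i \<cdot>\<^sub>m 1\<^sub>m d"
  shows "fock_expect (time_space d) (state_vec \<psi> s)
           (foldr (\<lambda>i T. X_tilde N d \<pi> \<psi> (\<mu> i) (S i) s \<circ> T) [1..<Suc m] id)
       = (\<Prod>i=1..m. c i / complex_of_real (real N powr (real (sum_list (\<mu> i)) + 1 / 2)))
         * poisson_mean s (\<lambda>n. (of_nat n - of_real s) ^ m)"
proof -
  let ?M = "time_space d" and ?\<phi> = "restricted_state d \<psi> s"
  define \<kappa> where "\<kappa> = (\<lambda>i. c i / complex_of_real (real N powr (real (sum_list (\<mu> i)) + 1 / 2)))"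
  define b where "b = (\<lambda>xs n. prod_list (map \<kappa> xs) * (of_nat n - complex_of_real s) ^ length xs)"
  define Y where "Y = (\<lambda>i. X_tilde N d \<pi> \<psi> (\<mu> i) (S i) s)"
  let ?T = "\<lambda>xs. foldr (\<lambda>i T. Y i \<circ> T) xs id"
  \<comment> \<open>Composition of operators as iterated application, on which the induction over
    the list runs.\<close>
  have T: "?T xs F = foldr Y xs F" for xs F by (induction xs) auto
  have *: "foldr Y xs (exp_vec (state_vec \<psi> s)) \<in> vecs (fock ?M) \<and>
      heq (fock ?M) (foldr Y xs (exp_vec (state_vec \<psi> s))) (exp_comb (b xs) ?\<phi>) \<and> poly_growth (b xs)"
    if "set xs \<subseteq> {1..m}" for xs
    using that
  proof (induction xs)
    case Nil
    then show ?case using heq_exp_vec_state by (simp add: b_def poly_growth_const)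
  next
    case (Cons i xs)
    then have IH: "foldr Y xs (exp_vec (state_vec \<psi> s)) \<in> vecs (fock ?M)"
      "heq (fock ?M) (foldr Y xs (exp_vec (state_vec \<psi> s))) (exp_comb (b xs) ?\<phi>)" "poly_growth (b xs)"
      and i: "i \<in> {1..m}" by auto
    have b: "b (i # xs) = (\<lambda>n. \<kappa> i * (of_nat n - of_real s) * b xs n)"
      by (simp add: b_def mult_ac)
    show ?case
      unfolding b using X_tilde_exp_comb[OF U[OF i] IH(3,1,2) refl, of "\<mu> i"] by (simp add: \<kappa>_def Y_def)
  qed
  have sub: "set [1..<Suc m] \<subseteq> {1..m}" by auto
  have "fock_expect ?M (state_vec \<psi> s) (?T [1..<Suc m]) = poisson_mean s (b [1..<Suc m])"
    using *[OF sub] by (intro fock_expect_eq_poisson_mean) (simp_all only: T)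
  also have "b [1..<Suc m] = (\<lambda>n. (\<Prod>i=1..m. \<kappa> i) * (of_nat n - of_real s) ^ m)"
    by (simp only: b_def interv_sum_list_conv_sum_set_nat prod.distinct_set_conv_list[symmetric] distinct_upt
        set_upt length_upt atLeastLessThanSuc_atLeastAtMost diff_Suc_1)
  also have "poisson_mean s \<dots> = (\<Prod>i=1..m. \<kappa> i) * poisson_mean s (\<lambda>n. (of_nat n - of_real s) ^ m)"
  proof -
    have "poly_growth (\<lambda>n. (of_nat n + (- complex_of_real s)) ^ m)"
      by (intro poly_growth_power poly_growth_add poly_growth_const poly_growth_of_nat)
    from poisson_mean_cmult[OF s this, of "\<Prod>i=1..m. \<kappa> i"] show ?thesis by simp
  qed
  finally show ?thesis unfolding \<kappa>_def Y_def .
qed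

end

section \<open>Central moments of the Poisson distribution and pairings\<close>

text \<open>The moments of the standard normal distribution, \<open>(m - 1)!!\<close> for even
  \<open>m\<close>, in the recursive form that both the Poisson limit and the count of pairings
  produce.\<close>

fun gauss_moment :: "nat \<Rightarrow> nat" where
  "gauss_moment 0 = 1"
| "gauss_moment (Suc 0) = 0"
| "gauss_moment (Suc (Suc m)) = Suc m * gauss_moment m"

lemma gauss_moment_odd: "odd m \<Longrightarrow> gauss_moment m = 0"
  by (induction m rule: gauss_moment.induct) auto

definition poisson_central :: "nat \<Rightarrow> real \<Rightarrow> complex" where
  "poisson_central m s = poisson_mean s (\<lambda>n. (of_nat n - of_real s) ^ m)"

lemma poly_growth_central: "poly_growth (\<lambda>n. (of_nat n - c) ^ m)"
  using poly_growth_power[OF poly_growth_add[OF poly_growth_of_nat poly_growth_const[of "- c"]], of m] by simp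

lemma poisson_central_0: "poisson_central 0 s = 1"
  by (simp add: poisson_central_def poisson_mean_1)

text \<open>For \<open>f(n) = (n - s)^m\<close> the shift identity gives
  \<open>E[(n - s) f(n)] = s (E f(n + 1) - E f(n))\<close>. In the binomial expansion of
  \<open>f(n + 1)\<close> around \<open>n - s\<close> the term \<open>k = m\<close> cancels.\<close>

lemma poisson_central_Suc:
  assumes "0 \<le> s"
  shows "poisson_central (Suc m) s = of_real s * (\<Sum>k<m. of_nat (m choose k) * poisson_central k s)"
proof -
  let ?f = "\<lambda>n. (of_nat n - complex_of_real s) ^ m"
  note g = poly_growth_central[of "of_real s"]
  \<comment> \<open>The two summands are indexed by booleans so that the lemma on finite sums
    applies.\<close>
  have "poisson_central (Suc m) s = poisson_mean s (\<lambda>n. \<Sum>b\<in>{True, False}. if b then of_nat n * ?f n else - of_real s * ?f n)"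
    by (simp add: poisson_central_def algebra_simps)
  also have "\<dots> = poisson_mean s (\<lambda>n. of_nat n * ?f n) + poisson_mean s (\<lambda>n. - of_real s * ?f n)"
  proof (subst poisson_mean_sum[OF assms])
    show "poly_growth (\<lambda>n. if b then of_nat n * ?f n else - of_real s * ?f n)" for b
      using poly_growth_mult[OF poly_growth_const[of "- of_real s"] g] poly_growth_mult[OF poly_growth_of_nat g]
      by (cases b) simp_all
  qed auto
  also have "poisson_mean s (\<lambda>n. - of_real s * ?f n) = - of_real s * poisson_central m s"
    unfolding poisson_central_def by (rule poisson_mean_cmult[OF assms g])
  also have "poisson_mean s (\<lambda>n. of_nat n * ?f n) = of_real s * poisson_mean s (\<lambda>n. ?f (Suc n))"
    by (rule poisson_mean_shift[OF assms g])
  also have "(\<lambda>n. ?f (Suc n)) = (\<lambda>n. \<Sum>k\<le>m. of_nat (m choose k) * (of_nat n - of_real s) ^ k)"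
  proof
    fix n
    show "?f (Suc n) = (\<Sum>k\<le>m. of_nat (m choose k) * (of_nat n - of_real s) ^ k)"
      using binomial_ring[of "of_nat n - complex_of_real s" 1 m] by (simp add: algebra_simps)
  qed
  also have "poisson_mean s \<dots> = (\<Sum>k\<le>m. of_nat (m choose k) * poisson_central k s)"
    unfolding poisson_central_def
    by (subst poisson_mean_sum[OF assms])
      (auto simp: poisson_mean_cmult[OF assms g] intro: poly_growth_mult poly_growth_const g)
  also have "{..m} = insert m {..<m}" by auto
  finally show ?thesis by (simp add: algebra_simps)
qed

text \<open>After division by \<open>s^(m/2)\<close> the term \<open>k\<close> of the recursion
  carries the power \<open>s^((k - (m - 2)) / 2)\<close>. Only \<open>k = m - 2\<close> survives,
  with binomial coefficient \<open>m - 1\<close>.\<close>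

lemma poisson_central_tendsto:
  assumes s: "filterlim s at_top sequentially"
  shows "(\<lambda>L. poisson_central m (s L) / of_real (s L powr (m / 2))) \<longlonglongrightarrow> of_nat (gauss_moment m)"
proof (induction m rule: less_induct)
  case (less m)
  have ev: "\<forall>\<^sub>F L in sequentially. 0 < s L" using s by (simp add: filterlim_at_top_dense)
  consider "m = 0" | "m = Suc 0" | m' where "m = Suc (Suc m')"
    by (metis not0_implies_Suc)
  then show ?case
  proof cases
    case 1
    show ?thesis
      by (rule tendsto_eventually, use ev in eventually_elim) (simp add: 1 poisson_central_0)
  next
    case 2
    show ?thesis
      by (rule tendsto_eventually, use ev in eventually_elim) (simp add: 2 poisson_central_Suc)
  next
    case 3
    define T where "T = (\<lambda>k L. of_nat (Suc m' choose k) * (poisson_central k (s L) / of_real (s L powr (k / 2)))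
        * complex_of_real (s L powr ((real k - real m') / 2)))"
    have "T k \<longlonglongrightarrow> of_nat (Suc m' choose k) * of_nat (gauss_moment k) * (if k = m' then 1 else 0)"
      if "k \<in> {..m'}" for k
    proof -
      have "(\<lambda>L. complex_of_real (s L powr ((real k - real m') / 2))) \<longlonglongrightarrow> (if k = m' then 1 else 0)"
      proof (cases "k = m'")
        case True
        show ?thesis
          by (rule tendsto_eventually, use ev in eventually_elim) (simp add: True)
      next
        case False
        then have "(\<lambda>L. s L powr ((real k - real m') / 2)) \<longlonglongrightarrow> 0"
          using that by (intro tendsto_neg_powr s) auto
        from tendsto_of_real[OF this, where 'a = complex] show ?thesis using False by simp
      qed
      then show ?thesis unfolding T_def
        using that 3 by (intro tendsto_mult tendsto_const less) auto
    qed
    then have "(\<lambda>L. \<Sum>k\<le>m'. T k L)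
        \<longlonglongrightarrow> (\<Sum>k\<le>m'. of_nat (Suc m' choose k) * of_nat (gauss_moment k) * (if k = m' then 1 else 0))"
      by (intro tendsto_sum) auto
    also have "(\<Sum>k\<le>m'. of_nat (Suc m' choose k) * of_nat (gauss_moment k) * (if k = m' then 1 else 0))
        = complex_of_nat (gauss_moment m)"
      by (simp add: 3 if_distrib[of "\<lambda>x. _ * x"] binomial_symmetric[of m' "Suc m'"] algebra_simps cong: if_cong)
    finally have lim: "(\<lambda>L. \<Sum>k\<le>m'. T k L) \<longlonglongrightarrow> of_nat (gauss_moment m)" .
    have "\<forall>\<^sub>F L in sequentially. (\<Sum>k\<le>m'. T k L) = poisson_central m (s L) / of_real (s L powr (m / 2))"
      using ev
    proof eventually_elim
      case (elim L)
      have "T k L = of_real (s L) * (of_nat (Suc m' choose k) * poisson_central k (s L)) / of_real (s L powr (m / 2))" for k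
      proof -
        have e: "(real k - real m') / 2 = 1 + k / 2 - m / 2" by (simp add: 3 field_simps)
        have "s L powr ((real k - real m') / 2) = s L * s L powr (k / 2) / s L powr (m / 2)"
          unfolding e powr_diff powr_add using elim by simp
        then show ?thesis using elim by (simp add: T_def)
      qed
      then show ?case using elim
        by (simp add: 3 poisson_central_Suc sum_distrib_left sum_divide_distrib lessThan_Suc_atMost)
    qed
    then show ?thesis using lim by (rule Lim_transform_eventually[rotated])
  qed
qed

section \<open>Pairings of a finite set\<close>

definition pairings :: "'a set \<Rightarrow> 'a set set set" where
  "pairings A = {P. partition_on A P \<and> (\<forall>B\<in>P. card B = 2)}"

lemma finite_pairings: "finite A \<Longrightarrow> finite (pairings A)"
  by (rule finite_subset[of _ "Pow (Pow A)"]) (auto simp: pairings_def partition_on_def)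

text \<open>Pairings are sorted by the partner \<open>b\<close> of the fixed element
  \<open>a\<close>. Arbitrary ground sets are allowed because removing a pair from an interval does
  not leave an interval.\<close>

lemma pairings_split:
  assumes a: "a \<in> A"
  shows "pairings A = (\<Union>b\<in>A - {a}. insert {a, b} ` pairings (A - {a, b}))"
proof (intro equalityI subsetI)
  fix P assume P: "P \<in> pairings A"
  then have part: "partition_on A P" and two: "\<And>B. B \<in> P \<Longrightarrow> card B = 2" by (auto simp: pairings_def)
  obtain B where B: "B \<in> P" "a \<in> B" using part a by (auto simp: partition_on_def)
  obtain b where b: "B = {a, b}" "b \<noteq> a"
    using two[OF B(1)] B(2) by (auto simp: card_2_iff doubleton_eq_iff)
  have bA: "b \<in> A" using part B(1) b by (auto simp: partition_on_def)
  have "partition_on (A - {a, b}) (P - {B})"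
  proof -
    have "\<Union>P = A" "{} \<notin> P" "\<And>C. C \<in> P \<Longrightarrow> C \<noteq> B \<Longrightarrow> C \<inter> B = {}" "disjoint P"
      using part B(1) by (auto simp: partition_on_def disjoint_def)
    then have "\<Union>(P - {B}) = A - B" by blast
    then show ?thesis using part unfolding partition_on_def b(1)[symmetric] by (auto simp: disjoint_def)
  qed
  then have "P - {B} \<in> pairings (A - {a, b})" using two by (auto simp: pairings_def)
  moreover have "P = insert {a, b} (P - {B})" using B(1) b(1) by auto
  ultimately show "P \<in> (\<Union>b\<in>A - {a}. insert {a, b} ` pairings (A - {a, b}))" using bA b(2) by blast
next
  fix P assume "P \<in> (\<Union>b\<in>A - {a}. insert {a, b} ` pairings (A - {a, b}))"
  then obtain b Q where b: "b \<in> A" "b \<noteq> a" and Q: "Q \<in> pairings (A - {a, b})" "P = insert {a, b} Q" by auto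
  have "partition_on A P"
    using Q a b unfolding pairings_def partition_on_def disjoint_def by auto
  then show "P \<in> pairings A" using Q b by (auto simp: pairings_def)
qed

text \<open>The partner of a fixed element can be chosen in \<open>Suc m\<close> ways and leaves
  \<open>m\<close> elements, which is the recursion of \<open>gauss_moment\<close>.\<close>

lemma card_pairings: "finite A \<Longrightarrow> card (pairings A) = gauss_moment (card A)"
proof (induction "card A" arbitrary: A rule: gauss_moment.induct)
  case 1
  then have "pairings A = {{}}" by (auto simp: pairings_def partition_on_def)
  then show ?case using 1 by simp
next
  case 2
  then obtain x where A: "A = {x}" by (metis One_nat_def card_1_singletonE)
  have "pairings A = {}"
    using pairings_split[of x A] by (simp add: A)
  then show ?case by (simp flip: 2(1))
next
  case (3 m)
  then have "A \<noteq> {}" by auto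
  then obtain a where a: "a \<in> A" by auto
  have cA: "card (A - {a, b}) = m" if "b \<in> A - {a}" for b
    using that a 3(2,3) by (subst card_Diff_subset) auto
  have inj: "inj_on (insert {a, b}) (pairings (A - {a, b}))" for b
  proof (rule inj_onI)
    fix P Q assume PQ: "P \<in> pairings (A - {a, b})" "Q \<in> pairings (A - {a, b})" "insert {a, b} P = insert {a, b} Q"
    have "{a, b} \<notin> R" if "R \<in> pairings (A - {a, b})" for R
      using that by (auto simp: pairings_def partition_on_def)
    then show "P = Q" using PQ by (metis insert_ident)
  qed
  have disj: "insert {a, b} ` pairings (A - {a, b}) \<inter> insert {a, c} ` pairings (A - {a, c}) = {}" if "b \<noteq> c" for b c
  proof (rule ccontr)
    assume "\<not> ?thesis"
    then obtain P Q where PQ: "P \<in> pairings (A - {a, b})" "insert {a, b} P = insert {a, c} Q" by auto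
    then have "{a, c} \<in> insert {a, b} P" by (simp only: insertI1)
    then have "{a, c} = {a, b} \<or> {a, c} \<in> P" by (simp only: insert_iff)
    moreover have "{a, c} \<notin> P" using PQ(1) by (auto simp: pairings_def partition_on_def)
    ultimately show False using that by (auto simp: doubleton_eq_iff)
  qed
  have "card (pairings A) = (\<Sum>b\<in>A - {a}. card (insert {a, b} ` pairings (A - {a, b})))"
    unfolding pairings_split[OF a]
    using 3(3) by (intro card_UN_disjoint ballI impI disj finite_imageI finite_pairings) auto
  also have "\<dots> = (\<Sum>b\<in>A - {a}. gauss_moment m)"
    using 3(3) by (intro sum.cong refl) (simp add: card_image inj 3(1)[OF cA[symmetric]] cA)
  also have "\<dots> = Suc m * gauss_moment m"
    using a by (simp add: card_Diff_subset flip: 3(2))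
  finally show ?case using 3(2) by (metis gauss_moment.simps(3))
qed

text \<open>The covariance is a product of one-index factors and the blocks cover
  \<open>{1..m}\<close> exactly once, so every pairing contributes the same product. For odd
  \<open>m\<close> both sides are 0.\<close>

lemma sum_pair_partitions:
  fixes f :: "nat \<Rightarrow> 'a :: comm_semiring_1"
  shows "(\<Sum>P\<in>pair_partitions m. \<Prod>B\<in>P. c * (\<Prod>i\<in>B. f i))
    = of_nat (gauss_moment m) * c ^ (m div 2) * (\<Prod>i=1..m. f i)"
proof -
  have pp: "pair_partitions m = pairings {1..m}" by (simp add: pair_partitions_def pairings_def)
  have "(\<Prod>B\<in>P. c * (\<Prod>i\<in>B. f i)) = c ^ (m div 2) * (\<Prod>i=1..m. f i)" if "P \<in> pairings {1..m}" for P
  proof -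
    have P: "\<Union>P = {1..m}" "\<And>B C. B \<in> P \<Longrightarrow> C \<in> P \<Longrightarrow> B \<noteq> C \<Longrightarrow> B \<inter> C = {}" "\<And>B. B \<in> P \<Longrightarrow> card B = 2"
      using that by (auto simp: pairings_def partition_on_def disjoint_def)
    have fin: "finite B" if "B \<in> P" for B using P(3)[OF that] by (metis card.infinite zero_neq_numeral)
    have "m = card (\<Union>P)" using P(1) by simp
    also have "\<dots> = (\<Sum>B\<in>P. card B)"
      by (rule card_Union_disjoint) (use P fin in \<open>auto simp: pairwise_def disjnt_def\<close>)
    also have "\<dots> = 2 * card P" using P(3) by simp
    finally have "card P = m div 2" by simp
    moreover have "(\<Prod>i\<in>\<Union>P. f i) = (\<Prod>B\<in>P. \<Prod>i\<in>B. f i)"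
      using prod.Union_disjoint[of P f] P(2) fin by auto
    ultimately show ?thesis using P(1) by (simp add: prod.distrib)
  qed
  then show ?thesis using card_pairings[of "{1..m}"] by (simp add: pp mult.assoc)
qed

section \<open>Shifted Schur polynomials and the basis of falling factorials\<close>

definition falling_poly :: "nat \<Rightarrow> complex poly" where
  "falling_poly r = (\<Prod>i<r. [:- of_nat i, 1:])"

lemma poly_falling_poly: "poly (falling_poly r) z = falling z r"
  by (simp add: falling_poly_def falling_def poly_prod)

lemma monic_falling_poly: "degree (falling_poly r) = r" "coeff (falling_poly r) r = 1"
proof -
  have "monic (falling_poly r) \<and> degree (falling_poly r) = r"
  proof (induction r)
    case (Suc r)
    have eq: "falling_poly (Suc r) = falling_poly r * [:- of_nat r, 1:]"
      by (simp add: falling_poly_def del: mult_pCons_right)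
    have "falling_poly r \<noteq> 0" using Suc by auto
    then have "degree (falling_poly (Suc r)) = Suc r"
      using Suc by (simp add: eq degree_mult_eq del: mult_pCons_right)
    moreover have "lead_coeff (falling_poly (Suc r)) = 1"
      unfolding eq lead_coeff_mult using conjunct1[OF Suc] by simp
    ultimately show ?case by simp
  qed (simp add: falling_poly_def)
  then show "degree (falling_poly r) = r" "coeff (falling_poly r) r = 1" by auto
qed

lemma falling_Suc: "falling z (Suc r) = (z - of_nat r) * falling z r"
  by (simp add: falling_def)

text \<open>With \<open>a = N - 1\<close> this splits a falling factorial of degree
  \<open>N - 1 + q\<close> into a factor that does not depend on \<open>q\<close> and a falling
  factorial of the centred node.\<close>

lemma falling_add: "falling z (a + b) = falling z a * falling (z - of_nat a) b"
proof (induction b)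
  case (Suc b)
  have "falling z (a + Suc b) = (z - of_nat (a + b)) * falling z (a + b)"
    by (simp only: add_Suc_right falling_Suc)
  also have "\<dots> = falling z a * ((z - of_nat a - of_nat b) * falling (z - of_nat a) b)"
    unfolding Suc of_nat_add diff_diff_eq by (rule mult.left_commute)
  finally show ?case by (simp only: falling_Suc)
qed (simp add: falling_def)

lemma falling_of_nat_eq_0: "k < r \<Longrightarrow> falling (of_nat k) r = 0"
  by (auto simp: falling_def)

lemma falling_of_nat_self: "falling (of_nat k) k \<noteq> 0"
  by (auto simp: falling_def)

text \<open>A polynomial of degree below \<open>N\<close> with \<open>N\<close> distinct roots is
  zero. Its values at 0, 1, 2, ... then kill the coefficients one by one, since
  \<open>falling k r\<close> vanishes for natural \<open>k < r\<close>.\<close>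

lemma falling_independent:
  assumes inj: "inj_on l {..<N}"
    and eq: "\<And>i. i < N \<Longrightarrow> (\<Sum>r<N. v r * falling (l i) r) = 0" and "r < N"
  shows "v r = 0"
proof -
  define p where "p = (\<Sum>r<N. Polynomial.smult (v r) (falling_poly r))"
  have pz: "poly p z = (\<Sum>r<N. v r * falling z r)" for z
    by (simp add: p_def poly_sum poly_falling_poly)
  have "p = 0"
  proof (rule ccontr)
    assume "p \<noteq> 0"
    have "degree p \<le> N - 1"
      unfolding p_def by (intro degree_sum_le) (auto simp: monic_falling_poly intro: order_trans[OF degree_smult_le])
    moreover have "l ` {..<N} \<subseteq> {z. poly p z = 0}" using eq by (auto simp: pz)
    then have "card (l ` {..<N}) \<le> card {z. poly p z = 0}"
      by (rule card_mono[OF poly_roots_finite[OF \<open>p \<noteq> 0\<close>]])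
    then have "N \<le> card {z. poly p z = 0}" by (simp add: card_image[OF inj])
    moreover have "card {z. poly p z = 0} \<le> degree p" by (rule card_poly_roots_bound[OF \<open>p \<noteq> 0\<close>])
    ultimately show False using \<open>r < N\<close> by linarith
  qed
  then have z: "(\<Sum>r<N. v r * falling (of_nat k) r) = 0" for k by (metis pz poly_0)
  show ?thesis using \<open>r < N\<close>
  proof (induction r rule: less_induct)
    case (less r)
    have "(\<Sum>j<N. v j * falling (of_nat r) j) = (\<Sum>j\<in>{r}. v j * falling (of_nat r) j)"
    proof (rule sum.mono_neutral_right)
      show "\<forall>j\<in>{..<N} - {r}. v j * falling (of_nat r) j = 0"
      proof
        fix j assume j: "j \<in> {..<N} - {r}"
        then consider "j < r" | "r < j" by fastforce
        then show "v j * falling (of_nat r) j = 0"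
          using less.IH[of j] j by cases (auto simp: falling_of_nat_eq_0)
      qed
    qed (use less in auto)
    then show ?case using z[of r] falling_of_nat_self[of r] by simp
  qed
qed

lemma det_falling_nonzero:
  assumes inj: "inj_on l {..<N}"
  shows "Determinant.det (Matrix.mat N N (\<lambda>(i, r). falling (l i) r)) \<noteq> 0" (is "Determinant.det ?V \<noteq> 0")
proof
  assume "Determinant.det ?V = 0"
  then obtain v where v: "v \<in> carrier_vec N" "v \<noteq> 0\<^sub>v N" "?V *\<^sub>v v = 0\<^sub>v N"
    using det_0_iff_vec_prod_zero[of ?V N] by auto
  have "v $ r = 0" if "r < N" for r
  proof (rule falling_independent[OF inj _ that])
    fix i assume i: "i < N"
    have "(\<Sum>r<N. v $ r * falling (l i) r) = (?V *\<^sub>v v) $ i"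
      using v(1) i by (simp add: scalar_prod_def lessThan_atLeast0 mult.commute)
    then show "(\<Sum>r<N. v $ r * falling (l i) r) = 0" using v(3) i by simp
  qed
  then show False using v(1,2) by auto
qed

text \<open>
  Coordinates in the basis \<open>z\<^sup>\<down>\<^sup>r\<close>, \<open>r < N\<close>, of the functions on the nodes; unspecified for \<open>r \<ge> N\<close>
  and, if the nodes are not distinct, not unique.
\<close>

definition falling_coeff :: "nat \<Rightarrow> (nat \<Rightarrow> complex) \<Rightarrow> nat \<Rightarrow> nat \<Rightarrow> complex" where
  "falling_coeff N l = (SOME T. \<forall>m. \<forall>i<N. falling (l i) m = (\<Sum>r<N. T m r * falling (l i) r))"

context
  fixes N :: nat and l :: "nat \<Rightarrow> complex"
  assumes inj: "inj_on l {..<N}"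
begin

lemma falling_basis_unique:
  assumes "\<And>i. i < N \<Longrightarrow> (\<Sum>r<N. a r * falling (l i) r) = (\<Sum>r<N. b r * falling (l i) r)" "r < N"
  shows "a r = b r"
  using falling_independent[OF inj, of "\<lambda>r. a r - b r" r] assms
  by (simp add: left_diff_distrib sum_subtractf)

text \<open>Interpolation through the inverse of the Vandermonde matrix in falling
  factorials.\<close>

lemma falling_inverse:
  obtains W where "\<And>i m. i < N \<Longrightarrow> falling (l i) m = (\<Sum>r<N. (\<Sum>j<N. W r j * falling (l j) m) * falling (l i) r)"
proof -
  let ?V = "Matrix.mat N N (\<lambda>(i, r). falling (l i) r)"
  have "?V \<in> Units (ring_mat TYPE(complex) N ())"
    by (rule det_non_zero_imp_unit[OF _ det_falling_nonzero[OF inj]]) simp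
  then obtain W where W: "W \<in> carrier_mat N N" "?V * W = 1\<^sub>m N"
    unfolding Units_def ring_mat_def by (simp only: monoid.simps partial_object.simps mem_Collect_eq) blast
  have VW: "(\<Sum>r<N. falling (l i) r * W $$ (r, j)) = (if i = j then 1 else 0)" if "i < N" "j < N" for i j
  proof -
    have "(\<Sum>r<N. falling (l i) r * W $$ (r, j)) = (?V * W) $$ (i, j)"
      using that W(1) by (simp add: scalar_prod_def lessThan_atLeast0)
    then show ?thesis using that W(2) by simp
  qed
  have "falling (l i) m = (\<Sum>r<N. (\<Sum>j<N. W $$ (r, j) * falling (l j) m) * falling (l i) r)" if i: "i < N" for i m
  proof -
    have "(\<Sum>r<N. (\<Sum>j<N. W $$ (r, j) * falling (l j) m) * falling (l i) r)
      = (\<Sum>r<N. \<Sum>j<N. falling (l i) r * W $$ (r, j) * falling (l j) m)"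
      by (simp add: sum_distrib_left sum_distrib_right mult_ac)
    also have "\<dots> = (\<Sum>j<N. (\<Sum>r<N. falling (l i) r * W $$ (r, j)) * falling (l j) m)"
      by (subst sum.swap) (simp add: sum_distrib_right)
    also have "\<dots> = (\<Sum>j<N. if j = i then falling (l i) m else 0)"
      using i by (intro sum.cong) (auto simp: VW)
    finally show ?thesis using i by simp
  qed
  then show ?thesis using that[of "\<lambda>r j. W $$ (r, j)"] by blast
qed

lemma falling_coeff: "i < N \<Longrightarrow> falling (l i) m = (\<Sum>r<N. falling_coeff N l m r * falling (l i) r)"
proof -
  have "\<exists>T. \<forall>m. \<forall>i<N. falling (l i) m = (\<Sum>r<N. T m r * falling (l i) r)"
  proof (rule falling_inverse)
    fix W assume "\<And>i m. i < N \<Longrightarrow> falling (l i) m = (\<Sum>r<N. (\<Sum>j<N. W r j * falling (l j) m) * falling (l i) r)"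
    then show ?thesis by (intro exI[of _ "\<lambda>m r. \<Sum>j<N. W r j * falling (l j) m"]) blast
  qed
  from someI_ex[OF this] show "i < N \<Longrightarrow> ?thesis" unfolding falling_coeff_def by blast
qed

text \<open>Coordinates depend linearly on the values at the nodes, through weights that do not
  involve the degree \<open>m\<close>. For \<open>r = N - 1\<close> they are the divided difference
  weights: \<open>w j\<close> is the inverse of the product of \<open>l j - l i\<close> over
  \<open>i \<noteq> j\<close>.\<close>

lemma falling_coeff_weights:
  assumes "r < N"
  obtains w where "\<And>m. falling_coeff N l m r = (\<Sum>j<N. w j * falling (l j) m)"
proof -
  obtain W where W: "\<And>i m. i < N \<Longrightarrow> falling (l i) m = (\<Sum>r<N. (\<Sum>j<N. W r j * falling (l j) m) * falling (l i) r)"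
    using falling_inverse by blast
  have "falling_coeff N l m r = (\<Sum>j<N. W r j * falling (l j) m)" for m
    by (rule falling_basis_unique[OF _ assms]) (rule trans[OF falling_coeff[symmetric] W])
  then show ?thesis using that by blast
qed

lemma falling_coeff_less: 
  assumes "m < N" "r < N" shows "falling_coeff N l m r = (if r = m then 1 else 0)"
proof (rule falling_basis_unique[OF _ assms(2)])
  fix i assume "i < N"
  have "(\<Sum>r<N. (if r = m then 1 else 0) * falling (l i) r) = (\<Sum>r<N. if r = m then falling (l i) m else 0)"
    by (intro sum.cong) auto
  then show "(\<Sum>r<N. falling_coeff N l m r * falling (l i) r) = (\<Sum>r<N. (if r = m then 1 else 0) * falling (l i) r)"
    unfolding falling_coeff[OF \<open>i < N\<close>, symmetric] using assms(1) by simp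
qed

text \<open>The falling factorial of degree \<open>m + 1\<close> is \<open>z - m\<close> times that
  of degree \<open>m\<close>. On the basis, multiplication by \<open>z - m\<close> raises the degree
  \<open>j\<close> by one and adds \<open>j - m\<close> times the same element; the overflow of
  degree \<open>N\<close>, from \<open>j = N - 1\<close>, is reduced again. Coefficients are
  compared at \<open>Suc r\<close>.\<close>

lemma falling_coeff_rec:
  assumes r: "Suc r < N"
  shows "falling_coeff N l m r = falling_coeff N l (Suc m) (Suc r)
     + (of_nat m - of_nat (Suc r)) * falling_coeff N l m (Suc r)
     - falling_coeff N l m (N - 1) * falling_coeff N l N (Suc r)"
proof -
  let ?T = "falling_coeff N l"
  define b where "b = (\<lambda>j. (case j of 0 \<Rightarrow> 0 | Suc j' \<Rightarrow> ?T m j') + ?T m (N - 1) * ?T N j + (of_nat j - of_nat m) * ?T m j)"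
  have "?T (Suc m) (Suc r) = b (Suc r)"
  proof (rule falling_basis_unique[OF _ r])
    fix i assume i: "i < N"
    obtain n where n: "N = Suc n" using r by (cases N) auto
    let ?f = "falling (l i)"
    have "(\<Sum>j<N. ?T (Suc m) j * ?f j) = (l i - of_nat m) * ?f m"
      using falling_coeff[OF i, of "Suc m"] by (simp add: falling_Suc)
    also have "\<dots> = (\<Sum>j<N. ?T m j * (?f (Suc j) + (of_nat j - of_nat m) * ?f j))"
      unfolding falling_coeff[OF i, of m] sum_distrib_left
      by (intro sum.cong refl) (simp add: falling_Suc algebra_simps)
    also have "\<dots> = (\<Sum>j<N. ?T m j * ?f (Suc j)) + (\<Sum>j<N. (of_nat j - of_nat m) * ?T m j * ?f j)"
      by (simp add: distrib_left sum.distrib mult_ac)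
    also have "(\<Sum>j<N. ?T m j * ?f (Suc j)) = (\<Sum>j<n. ?T m j * ?f (Suc j)) + ?T m n * ?f N"
      by (simp add: n)
    also have "(\<Sum>j<n. ?T m j * ?f (Suc j)) = (\<Sum>j<N. (case j of 0 \<Rightarrow> 0 | Suc j' \<Rightarrow> ?T m j') * ?f j)"
      unfolding n by (subst sum.lessThan_Suc_shift) simp
    also have "?T m n * ?f N = (\<Sum>j<N. ?T m n * ?T N j * ?f j)"
      by (subst falling_coeff[OF i, of N]) (simp add: sum_distrib_left mult.assoc)
    finally show "(\<Sum>j<N. ?T (Suc m) j * ?f j) = (\<Sum>j<N. b j * ?f j)"
      by (simp add: b_def distrib_right sum.distrib n)
  qed
  then show ?thesis by (simp add: b_def algebra_simps)
qed

text \<open>True for falling factorials of degree below \<open>N\<close> by the choice of the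
  weights, hence for all polynomials of such degree, by removing leading terms one at a
  time.\<close>

lemma weights_coeff:
  assumes w: "\<And>m. falling_coeff N l m (N - 1) = (\<Sum>j<N. w j * falling (l j) m)"
    and "N > 0" and f: "\<And>r. n \<le> r \<Longrightarrow> coeff f r = 0" "n \<le> N"
  shows "(\<Sum>j<N. w j * poly f (l j)) = coeff f (N - 1)"
  using f
proof (induction n arbitrary: f)
  case 0
  then have "f = 0" by (intro poly_eqI) auto
  then show ?case by simp
next
  case (Suc n)
  define g where "g = f - Polynomial.smult (coeff f n) (falling_poly n)"
  have "coeff g r = 0" if "n \<le> r" for r
    using that Suc.prems(1)[of r] monic_falling_poly[of n] coeff_eq_0[of "falling_poly n" r]
    by (cases "r = n") (auto simp: g_def)
  then have "(\<Sum>j<N. w j * poly g (l j)) = coeff g (N - 1)" using Suc by auto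
  moreover have "(\<Sum>j<N. w j * poly g (l j))
      = (\<Sum>j<N. w j * poly f (l j)) - coeff f n * (\<Sum>j<N. w j * falling (l j) n)"
    by (simp add: g_def poly_falling_poly algebra_simps sum_subtractf sum_distrib_left)
  moreover have "(\<Sum>j<N. w j * falling (l j) n) = (if N - 1 = n then 1 else 0)"
    using falling_coeff_less[of n "N - 1"] Suc.prems(2) \<open>N > 0\<close> w[of n] by simp
  moreover have "coeff (falling_poly n) (N - 1) = (if N - 1 = n then 1 else 0)"
    using Suc.prems(2) monic_falling_poly[of n] coeff_eq_0[of "falling_poly n" "N - 1"] by auto
  ultimately show ?case by (simp add: g_def)
qed

text \<open>Partial fractions of \<open>R / P\<close>, with \<open>P\<close> the node polynomial and
  \<open>R\<close> the falling factorial of degree \<open>N - 1\<close>. The polynomial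
  \<open>P(v) R - R(v) P\<close> is divisible by \<open>z - v\<close>. Applied to the quotient, the
  weights give its coefficient \<open>- R(v)\<close> of degree \<open>N - 1\<close>, while
  \<open>P\<close> drops out at the nodes.\<close>

lemma weights_partial_fractions:
  assumes w: "\<And>m. falling_coeff N l m (N - 1) = (\<Sum>j<N. w j * falling (l j) m)"
    and "N > 0" and v: "\<And>j. j < N \<Longrightarrow> v \<noteq> l j"
  shows "(\<Sum>j<N. w j * falling (l j) (N - 1) / (v - l j)) * (\<Prod>j<N. v - l j) = falling v (N - 1)"
proof -
  let ?R = "falling_poly (N - 1)" and ?P = "\<Prod>j<N. [:- l j, 1:]"
  define q where "q = Polynomial.smult (poly ?P v) ?R - Polynomial.smult (poly ?R v) ?P"
  have dP: "degree ?P = N" by (subst degree_prod_eq_sum_degree) auto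
  have cP: "coeff ?P N = 1"
    using monic_prod[of "{..<N}" "\<lambda>j. [:- l j, 1:]"] unfolding dP by auto
  have Pv: "poly ?P z = (\<Prod>j<N. z - l j)" for z by (simp add: poly_prod)
  have "poly q v = 0" by (simp add: q_def)
  then obtain f where f: "q = [:- v, 1:] * f" using poly_eq_0_iff_dvd by (metis dvdE)
  have dq: "coeff q r = 0" if "r > N" for r
    using that dP coeff_eq_0[of ?P r] coeff_eq_0[of ?R r] monic_falling_poly[of "N - 1"] by (simp add: q_def)
  have qN: "coeff q N = - falling v (N - 1)"
    using cP \<open>N > 0\<close> coeff_eq_0[of ?R N] monic_falling_poly[of "N - 1"] by (simp add: q_def poly_falling_poly)
  have df: "coeff f r = 0" if "N \<le> r" for r
  proof (cases "f = 0")
    case False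
    then have "degree q = Suc (degree f)" unfolding f by (subst degree_mult_eq) auto
    moreover have "degree q \<le> N" using dq by (intro degree_le) auto
    ultimately show ?thesis using that by (intro coeff_eq_0) auto
  qed auto
  have "coeff q N = coeff f (N - 1)"
    using df[of N] \<open>N > 0\<close> by (cases N) (auto simp: f)
  then have "(\<Sum>j<N. w j * poly f (l j)) = - falling v (N - 1)"
    using weights_coeff[OF w \<open>N > 0\<close> df order_refl] qN by simp
  moreover have "poly f (l j) = - (falling (l j) (N - 1) / (v - l j)) * (\<Prod>j<N. v - l j)" if j: "j < N" for j
  proof -
    have "poly q (l j) = (\<Prod>j<N. v - l j) * falling (l j) (N - 1)"
      using j by (auto simp: q_def Pv poly_falling_poly)
    moreover have "poly q (l j) = (l j - v) * poly f (l j)" by (simp add: f algebra_simps)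
    ultimately show ?thesis using v[OF j] by (simp add: field_simps)
  qed
  ultimately show ?thesis by (simp add: sum_distrib_right sum_negf mult.assoc)
qed

end

section \<open>Logarithmic derivatives of formal power series and Newton's identities\<close>

definition fps_logderiv :: "complex fps \<Rightarrow> complex fps \<Rightarrow> bool" where
  "fps_logderiv f L \<longleftrightarrow> fps_deriv f = f * L"

lemma fps_logderiv_prod:
  assumes "\<And>i. i \<in> I \<Longrightarrow> fps_logderiv (f i) (L i)"
  shows "fps_logderiv (prod f I) (sum L I)"
  using assms
  by (induction I rule: infinite_finite_induct) (auto simp: fps_logderiv_def algebra_simps)

lemma fps_logderiv_mult:
  "fps_logderiv f L \<Longrightarrow> fps_logderiv g K \<Longrightarrow> fps_logderiv (f * g) (L + K)"
  by (simp add: fps_logderiv_def algebra_simps)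

lemma fps_nth_0_prod: "fps_nth (prod f I) 0 = (\<Prod>i\<in>I. fps_nth (f i :: complex fps) 0)"
  by (induction I rule: infinite_finite_induct) (simp_all add: fps_mult_nth_0)

lemma fps_geometric: "Abs_fps (\<lambda>n. c ^ n) * (1 - fps_const c * fps_X) = (1 :: complex fps)"
proof (rule fps_ext)
  fix n show "fps_nth (Abs_fps (\<lambda>n. c ^ n) * (1 - fps_const c * fps_X)) n = fps_nth 1 n"
    by (cases n) (simp_all add: right_diff_distrib mult.assoc[symmetric] fps_mult_right_const_nth)
qed

lemma fps_logderiv_linear:
  "fps_logderiv (1 + fps_const c * fps_X) (Abs_fps (\<lambda>n. c * (- c) ^ n))"
proof -
  have "Abs_fps (\<lambda>n. c * (- c) ^ n) = fps_const c * Abs_fps (\<lambda>n. (- c) ^ n)"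
    by (rule fps_ext) simp
  then have "(1 + fps_const c * fps_X) * Abs_fps (\<lambda>n. c * (- c) ^ n)
      = fps_const c * (Abs_fps (\<lambda>n. (- c) ^ n) * (1 - fps_const (- c) * fps_X))"
    by (simp add: mult_ac)
  then show ?thesis unfolding fps_geometric by (simp add: fps_logderiv_def)
qed

text \<open>The quotient is given as \<open>g * a = b\<close>, so no inverse series is formed: the
  product rule yields the claim multiplied by \<open>a\<close>, and \<open>a\<close>
  cancels.\<close>

lemma fps_logderiv_quotient:
  assumes "g * a = b" "fps_logderiv a La" "fps_logderiv b Lb" "a \<noteq> 0"
  shows "fps_logderiv g (Lb - La)"
proof -
  have "fps_deriv g * a + g * (a * La) = g * a * Lb"
    using assms(2,3) fps_deriv_mult[of g a] unfolding assms(1)[symmetric] fps_logderiv_def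
    by (simp add: add.commute)
  then have "a * fps_deriv g = a * (g * (Lb - La))" by (simp add: algebra_simps)
  then show ?thesis using assms(4) by (simp add: fps_logderiv_def)
qed

text \<open>Newton's identities are the coefficients of \<open>f' = f L\<close>, with
  \<open>L\<close> the generating function of the power sums.\<close>

lemma fps_logderiv_newton:
  assumes "fps_logderiv f L"
  shows "of_nat (Suc k) * fps_nth f (Suc k) = (\<Sum>j\<le>k. fps_nth f j * fps_nth L (k - j))"
  using assms arg_cong[of _ _ "\<lambda>g. fps_nth g k", OF assms[unfolded fps_logderiv_def]]
  by (simp add: fps_mult_nth atLeast0AtMost)

section \<open>Moments of the weights of the top coefficient\<close>

context
  fixes N :: nat and l x w :: "nat \<Rightarrow> complex"
  assumes inj: "inj_on l {..<N}" and N: "N > 0"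
    and w: "\<And>m. falling_coeff N l m (N - 1) = (\<Sum>j<N. w j * falling (l j) m)"
    and x_def: "x = (\<lambda>j. l j - of_nat (N - 1))"
begin

text \<open>Substituting \<open>v = 1 / Y + N - 1\<close> in the partial fractions gives
  \<open>(v - l j) Y = 1 - x j Y\<close>; then powers of \<open>Y\<close> are cleared. The
  computation excludes only \<open>Y = 0\<close> and the finitely many \<open>Y = 1 / x j\<close>,
  and infinitely many values suffice for polynomials.\<close>

lemma weights_polynomial_identity:
  "(\<Sum>j<N. Polynomial.smult (w j * falling (l j) (N - 1)) (\<Prod>i\<in>{..<N} - {j}. [:1, - x i:])) = (\<Prod>k<N. [:1, of_nat k:])"
  (is "?p = ?q")
proof (rule ccontr)
  assume "?p \<noteq> ?q"
  then have "finite {Y. poly (?p - ?q) Y = 0}" by (intro poly_roots_finite) simp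
  moreover have "{Y. Y \<noteq> 0 \<and> (\<forall>j<N. x j * Y \<noteq> 1)} \<subseteq> {Y. poly (?p - ?q) Y = 0}"
  proof
    fix Y assume "Y \<in> {Y. Y \<noteq> 0 \<and> (\<forall>j<N. x j * Y \<noteq> 1)}"
    then have Y: "Y \<noteq> 0" "\<And>j. j < N \<Longrightarrow> x j * Y \<noteq> 1" by auto
    define v where "v = 1 / Y + of_nat (N - 1)"
    obtain M where M: "N = Suc M" using N by (cases N) auto
    have vl: "(v - l j) * Y = 1 - x j * Y" for j using Y(1) by (simp add: v_def x_def field_simps)
    have v: "v \<noteq> l j" if "j < N" for j using vl[of j] Y(2)[OF that] by auto
    have "poly ?p Y = (\<Sum>j<N. w j * falling (l j) (N - 1) * (\<Prod>i\<in>{..<N} - {j}. 1 - x i * Y))"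
      by (simp add: poly_sum poly_prod mult.commute)
    also have "\<dots> = (\<Sum>j<N. w j * falling (l j) (N - 1) / (v - l j) * (\<Prod>i<N. v - l i) * Y ^ M)"
    proof (intro sum.cong refl)
      fix j assume j: "j \<in> {..<N}"
      have "(\<Prod>i<N. v - l i) * Y ^ M * Y = (\<Prod>i<N. (v - l i) * Y)"
        by (simp add: prod.distrib M mult_ac)
      also have "\<dots> = (1 - x j * Y) * (\<Prod>i\<in>{..<N} - {j}. 1 - x i * Y)"
        unfolding vl using j by (subst prod.remove[of _ j]) auto
      also have "1 - x j * Y = (v - l j) * Y" by (simp add: vl)
      finally have e: "(\<Prod>i<N. v - l i) * Y ^ M = (v - l j) * (\<Prod>i\<in>{..<N} - {j}. 1 - x i * Y)"
        using Y(1) by (simp add: mult_ac)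
      have "w j * falling (l j) (N - 1) / (v - l j) * (\<Prod>i<N. v - l i) * Y ^ M
          = w j * falling (l j) (N - 1) / (v - l j) * ((v - l j) * (\<Prod>i\<in>{..<N} - {j}. 1 - x i * Y))"
        unfolding e[symmetric] by (simp only: mult.assoc)
      then show "w j * falling (l j) (N - 1) * (\<Prod>i\<in>{..<N} - {j}. 1 - x i * Y)
          = w j * falling (l j) (N - 1) / (v - l j) * (\<Prod>i<N. v - l i) * Y ^ M"
        using v[of j] j by simp
    qed
    also have "\<dots> = (\<Sum>j<N. w j * falling (l j) (N - 1) / (v - l j)) * (\<Prod>i<N. v - l i) * Y ^ M"
      by (simp add: sum_distrib_right)
    also have "\<dots> = falling v M * Y ^ M"
      using weights_partial_fractions[OF inj w N v] by (simp add: M)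
    also have "\<dots> = (\<Prod>i<M. 1 + of_nat (M - i) * Y)"
    proof -
      have "falling v M * Y ^ M = (\<Prod>i<M. (v - of_nat i) * Y)" by (simp add: falling_def prod.distrib)
      also have "\<dots> = (\<Prod>i<M. 1 + of_nat (M - i) * Y)"
        using Y(1) by (intro prod.cong refl) (simp add: v_def M of_nat_diff field_simps)
      finally show ?thesis .
    qed
    also have "\<dots> = (\<Prod>k<M. 1 + of_nat (Suc k) * Y)"
      by (rule prod.reindex_bij_witness[of _ "\<lambda>k. M - Suc k" "\<lambda>k. M - Suc k"]) (auto simp: Suc_diff_Suc)
    \<comment> \<open>The factor of \<open>?q\<close> with \<open>k = 0\<close> is 1, which accounts
      for the shift of the index.\<close>
    also have "\<dots> = poly ?q Y"
      unfolding M by (simp add: poly_prod prod.lessThan_Suc_shift mult.commute del: prod.lessThan_Suc)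
    finally show "Y \<in> {Y. poly (?p - ?q) Y = 0}" by simp
  qed
  moreover have "infinite {Y. Y \<noteq> 0 \<and> (\<forall>j<N. x j * Y \<noteq> 1)}"
  proof
    assume "finite {Y. Y \<noteq> 0 \<and> (\<forall>j<N. x j * Y \<noteq> 1)}"
    moreover have "UNIV \<subseteq> {Y. Y \<noteq> 0 \<and> (\<forall>j<N. x j * Y \<noteq> 1)} \<union> ({0} \<union> (\<lambda>j. 1 / x j) ` {..<N})"
    proof
      fix Y :: complex
      have "Y = 1 / x j" if "x j * Y = 1" for j
        using that by (metis mult_zero_left nonzero_mult_div_cancel_left zero_neq_one)
      then show "Y \<in> {Y. Y \<noteq> 0 \<and> (\<forall>j<N. x j * Y \<noteq> 1)} \<union> ({0} \<union> (\<lambda>j. 1 / x j) ` {..<N})"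
        by blast
    qed
    ultimately have "finite (UNIV :: complex set)" by (meson finite.simps finite_UnI finite_imageI finite_lessThan finite_subset)
    then show False using infinite_UNIV_char_0 by blast
  qed
  ultimately show False by (meson finite_subset)
qed

text \<open>By the polynomial identity the generating function of \<open>G\<close> is the product of
  the \<open>1 + i X\<close> divided by the product of the \<open>1 - x i X\<close>. Its logarithmic
  derivative has differences of power sums as coefficients.\<close>

lemma weights_moments_newton:
  defines "G \<equiv> (\<lambda>s. \<Sum>j<N. w j * falling (l j) (N - 1) * x j ^ s)"
  shows "G 0 = 1"
    and "of_nat (Suc k) * G (Suc k) = (\<Sum>j\<le>k. G j * (\<Sum>i<N. x i ^ Suc (k - j) - (- of_nat i) ^ Suc (k - j)))"
proof -
  define W where "W = (\<lambda>j. w j * falling (l j) (N - 1))"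
  let ?a = "\<Prod>i<N. 1 + fps_const (- x i) * fps_X" and ?b = "\<Prod>i<N. 1 + fps_const (of_nat i :: complex) * fps_X"
  have GA: "Abs_fps G = (\<Sum>j<N. fps_const (W j) * Abs_fps (\<lambda>s. x j ^ s))"
    by (rule fps_ext) (simp add: fps_sum_nth G_def W_def)
  have "Abs_fps G * ?a = (\<Sum>j<N. fps_const (W j) * (\<Prod>i\<in>{..<N} - {j}. 1 + fps_const (- x i) * fps_X))"
    unfolding GA sum_distrib_right
  proof (intro sum.cong refl)
    fix j assume "j \<in> {..<N}"
    then have "?a = (1 - fps_const (x j) * fps_X) * (\<Prod>i\<in>{..<N} - {j}. 1 + fps_const (- x i) * fps_X)"
      by (subst prod.remove[of _ j]) auto
    then have "fps_const (W j) * Abs_fps ((^) (x j)) * ?a = fps_const (W j) * (Abs_fps ((^) (x j)) *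
        (1 - fps_const (x j) * fps_X)) * (\<Prod>i\<in>{..<N} - {j}. 1 + fps_const (- x i) * fps_X)"
      by (simp only: mult.assoc)
    then show "fps_const (W j) * Abs_fps ((^) (x j)) * ?a = fps_const (W j) * (\<Prod>i\<in>{..<N} - {j}. 1 + fps_const (- x i) * fps_X)"
      by (simp only: fps_geometric mult_1_right)
  qed
  also have "\<dots> = fps_of_poly (\<Sum>j<N. Polynomial.smult (W j) (\<Prod>i\<in>{..<N} - {j}. [:1, - x i:]))"
    by (simp add: fps_of_poly_sum fps_of_poly_smult fps_of_poly_prod fps_of_poly_linear')
  also have "\<dots> = ?b"
    unfolding W_def weights_polynomial_identity by (simp add: fps_of_poly_prod fps_of_poly_linear')
  finally have ab: "Abs_fps G * ?a = ?b" .
  have a0: "fps_nth ?a 0 = 1" and b0: "fps_nth ?b 0 = 1"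
    by (simp_all add: fps_nth_0_prod)
  have "fps_logderiv (Abs_fps G) ((\<Sum>i<N. Abs_fps (\<lambda>n. of_nat i * (- of_nat i) ^ n)) - (\<Sum>i<N. Abs_fps (\<lambda>n. - x i * (- (- x i)) ^ n)))"
  proof (rule fps_logderiv_quotient[OF ab])
    show "?a \<noteq> 0" using a0 by auto
  qed (intro fps_logderiv_prod fps_logderiv_linear)+
  also have "((\<Sum>i<N. Abs_fps (\<lambda>n. of_nat i * (- of_nat i) ^ n)) - (\<Sum>i<N. Abs_fps (\<lambda>n. - x i * (- (- x i)) ^ n)))
      = Abs_fps (\<lambda>n. \<Sum>i<N. x i ^ Suc n - (- of_nat i) ^ Suc n)"
    by (rule fps_ext) (simp add: fps_sum_nth sum_negf sum_subtractf)
  finally have "fps_logderiv (Abs_fps G) (Abs_fps (\<lambda>n. \<Sum>i<N. x i ^ Suc n - (- of_nat i) ^ Suc n))" .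
  from fps_logderiv_newton[OF this, of k]
  show "of_nat (Suc k) * G (Suc k) = (\<Sum>j\<le>k. G j * (\<Sum>i<N. x i ^ Suc (k - j) - (- of_nat i) ^ Suc (k - j)))"
    by (simp only: fps_nth_Abs_fps)
  show "G 0 = 1" using arg_cong[OF ab, of "\<lambda>f. fps_nth f 0"] a0 b0 by (simp add: fps_mult_nth_0)
qed

end

section \<open>Limits of shifted Schur polynomials\<close>

text \<open>The recursion is homogeneous if \<open>G k\<close> and \<open>p k\<close> are given
  degree \<open>k\<close>, so it survives division by \<open>N^k\<close> and determines the limits
  one after the other.\<close>

lemma newton_limit:
  fixes G p :: "nat \<Rightarrow> nat \<Rightarrow> complex" and N :: "nat \<Rightarrow> nat"
  assumes N: "filterlim N at_top sequentially"
    and G0: "\<forall>\<^sub>F L in sequentially. G L 0 = 1"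
    and G: "\<And>k. \<forall>\<^sub>F L in sequentially. of_nat (Suc k) * G L (Suc k) = (\<Sum>j\<le>k. G L j * p L (Suc (k - j)))"
    and p: "\<And>k. (\<lambda>L. p L (Suc k) / of_nat (N L) ^ Suc k) \<longlonglongrightarrow> P (Suc k)"
    and h: "h 0 = 1" "\<And>k. of_nat (Suc k) * h (Suc k) = (\<Sum>j\<le>k. h j * P (Suc (k - j)))"
  shows "(\<lambda>L. G L k / of_nat (N L) ^ k) \<longlonglongrightarrow> h k"
proof (induction k rule: less_induct)
  case (less k)
  show ?case
  proof (cases k)
    case 0
    show ?thesis by (rule tendsto_eventually, use G0 in eventually_elim) (simp add: 0 h(1))
  next
    case (Suc k')
    have "(\<lambda>L. (\<Sum>j\<le>k'. (G L j / of_nat (N L) ^ j) * (p L (Suc (k' - j)) / of_nat (N L) ^ Suc (k' - j))) / of_nat (Suc k'))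
        \<longlonglongrightarrow> (\<Sum>j\<le>k'. h j * P (Suc (k' - j))) / of_nat (Suc k')"
      by (intro tendsto_divide tendsto_sum tendsto_mult less p tendsto_const) (auto simp: Suc simp del: of_nat_Suc)
    also have "(\<Sum>j\<le>k'. h j * P (Suc (k' - j))) / of_nat (Suc k') = h k"
      unfolding h(2)[symmetric] Suc by (simp del: of_nat_Suc)
    finally have lim: "(\<lambda>L. (\<Sum>j\<le>k'. (G L j / of_nat (N L) ^ j) * (p L (Suc (k' - j)) / of_nat (N L) ^ Suc (k' - j))) / of_nat (Suc k'))
        \<longlonglongrightarrow> h k" .
    have "\<forall>\<^sub>F L in sequentially. (\<Sum>j\<le>k'. (G L j / of_nat (N L) ^ j) * (p L (Suc (k' - j)) / of_nat (N L) ^ Suc (k' - j))) / of_nat (Suc k')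
        = G L k / of_nat (N L) ^ k"
      using G[of k'] eventually_compose_filterlim[OF eventually_gt_at_top[of 0] N]
    proof eventually_elim
      case (elim L)
      have "(G L j / of_nat (N L) ^ j) * (p L (Suc (k' - j)) / of_nat (N L) ^ Suc (k' - j))
          = G L j * p L (Suc (k' - j)) / of_nat (N L) ^ k" if "j \<le> k'" for j
      proof -
        have "k = j + Suc (k' - j)" using that Suc by simp
        then show ?thesis by (simp only: power_add times_divide_times_eq)
      qed
      then have "(\<Sum>j\<le>k'. (G L j / of_nat (N L) ^ j) * (p L (Suc (k' - j)) / of_nat (N L) ^ Suc (k' - j)))
          = (\<Sum>j\<le>k'. G L j * p L (Suc (k' - j))) / of_nat (N L) ^ k"
        unfolding sum_divide_distrib by (intro sum.cong refl) auto
      also have "\<dots> = of_nat (Suc k') * (G L k / of_nat (N L) ^ k)"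
        using elim(1) Suc by (simp only: times_divide_eq_right)
      finally show ?case by (simp del: of_nat_Suc)
    qed
    with lim show ?thesis by (rule Lim_transform_eventually)
  qed
qed

section \<open>The limiting recursion and the Jacobi-Trudi determinant\<close>

definition int_seq :: "(nat \<Rightarrow> complex) \<Rightarrow> int \<Rightarrow> complex" where
  "int_seq h q = (if q < 0 then 0 else h (nat q))"

text \<open>The limit of \<open>falling_coeff N l (N - 1 + q) (N - 1 - i) / N\<^sup>q\<^sup>+\<^sup>i\<close>, given that of the case \<open>i = 0\<close>.\<close>

fun coeff_limit :: "(nat \<Rightarrow> complex) \<Rightarrow> nat \<Rightarrow> int \<Rightarrow> complex" where
  "coeff_limit h 0 q = int_seq h q"
| "coeff_limit h (Suc i) q = coeff_limit h i (q + 1) - int_seq h q * coeff_limit h i 1"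

text \<open>The recursion shifts \<open>q\<close> by one and subtracts a multiple of
  \<open>int_seq h q\<close> whose factor \<open>coeff_limit h i 1\<close> does not depend on
  \<open>q\<close>. All columns thus undergo the same row operations.\<close>

lemma coeff_limit_unitriangular:
  "\<exists>c. c i = 1 \<and> (\<forall>a>i. c a = 0) \<and> (\<forall>q. coeff_limit h i q = (\<Sum>a\<le>i. c a * int_seq h (q + int a)))"
proof (induction i)
  case 0
  show ?case by (intro exI[of _ "\<lambda>a. if a = 0 then 1 else 0"]) auto
next
  case (Suc i)
  then obtain c where c: "c i = 1" "\<And>a. a > i \<Longrightarrow> c a = 0"
    "\<And>q. coeff_limit h i q = (\<Sum>a\<le>i. c a * int_seq h (q + int a))" by blast
  define c' where "c' = (\<lambda>a. case a of 0 \<Rightarrow> - coeff_limit h i 1 | Suc a' \<Rightarrow> c a')"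
  have "coeff_limit h (Suc i) q = (\<Sum>a\<le>Suc i. c' a * int_seq h (q + int a))" for q
    unfolding sum.atMost_Suc_shift using c(3)[of "q + 1"] by (simp add: c'_def add_ac)
  then show ?case using c by (intro exI[of _ c']) (auto simp: c'_def split: nat.splits)
qed

text \<open>The row operations form a triangular matrix with unit diagonal; what remains is the
  transposed Jacobi-Trudi matrix.\<close>

lemma det_coeff_limit:
  "Determinant.det (Matrix.mat n n (\<lambda>(r, j). coeff_limit h r (q j)))
    = Determinant.det (Matrix.mat n n (\<lambda>(i, j). int_seq h (q i + int j)))"
proof -
  obtain c where c: "\<And>i. c i i = 1" "\<And>i a. a > i \<Longrightarrow> c i a = 0"
    "\<And>i q. coeff_limit h i q = (\<Sum>a\<le>i. c i a * int_seq h (q + int a))"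
    using coeff_limit_unitriangular[of _ h] by metis
  let ?C = "Matrix.mat n n (\<lambda>(i, a). c i a)" and ?H = "Matrix.mat n n (\<lambda>(i, j). int_seq h (q i + int j))"
  have "Matrix.mat n n (\<lambda>(r, j). coeff_limit h r (q j)) = ?C * transpose_mat ?H"
  proof (rule eq_matI)
    fix r j assume "r < dim_row (?C * transpose_mat ?H)" "j < dim_col (?C * transpose_mat ?H)"
    then have rj: "r < n" "j < n" by auto
    have "(\<Sum>a\<le>r. c r a * int_seq h (q j + int a)) = (\<Sum>a\<in>{0..<n}. c r a * int_seq h (q j + int a))"
      using rj by (intro sum.mono_neutral_left) (auto simp: c(2))
    then show "Matrix.mat n n (\<lambda>(r, j). coeff_limit h r (q j)) $$ (r, j) = (?C * transpose_mat ?H) $$ (r, j)"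
      using rj by (simp add: scalar_prod_def c(3))
  qed auto
  moreover have "Determinant.det ?C = 1"
  proof -
    have "Determinant.det ?C = prod_list (diag_mat ?C)"
      by (rule det_lower_triangular[of n]) (auto simp: c(2))
    also have "diag_mat ?C = map (\<lambda>_. 1) [0..<n]" by (simp add: diag_mat_def c(1))
    finally show ?thesis by (simp add: map_replicate_const)
  qed
  ultimately show ?thesis
    by (simp add: det_mult[of _ n] det_transpose[of _ n])
qed

lemma powi_sum: "finite I \<Longrightarrow> x \<noteq> 0 \<Longrightarrow> (\<Prod>i\<in>I. x powi f i) = (x :: complex) powi (\<Sum>i\<in>I. f i)"
  by (induction I rule: finite_induct) (simp_all add: power_int_add)

text \<open>In the Leibniz formula the exponents \<open>q (p r) + r\<close> have the same sum for
  every permutation \<open>p\<close>, so scaling the entries scales the determinant by a single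
  power of \<open>N\<close>. Individual exponents may be negative, hence
  \<open>powi\<close>.\<close>

lemma det_scaled_limit:
  fixes B :: "nat \<Rightarrow> nat \<Rightarrow> nat \<Rightarrow> complex" and N :: "nat \<Rightarrow> nat" and q :: "nat \<Rightarrow> int"
  assumes N: "filterlim N at_top sequentially"
    and B: "\<And>r j. r < n \<Longrightarrow> j < n \<Longrightarrow> (\<lambda>L. B L r j / of_nat (N L) powi (q j + int r)) \<longlonglongrightarrow> \<tau> r j"
    and k: "(\<Sum>j<n. q j + int j) = int k"
  shows "(\<lambda>L. Determinant.det (Matrix.mat n n (\<lambda>(r, j). B L r j)) / of_nat (N L) ^ k)
     \<longlonglongrightarrow> Determinant.det (Matrix.mat n n (\<lambda>(r, j). \<tau> r j))"
proof -
  let ?S = "{p. p permutes {0..<n}}"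
  have det: "Determinant.det (Matrix.mat n n (\<lambda>(r, j). A r j)) = (\<Sum>p\<in>?S. signof p * (\<Prod>r=0..<n. A r (p r)))" for A :: "nat \<Rightarrow> nat \<Rightarrow> complex"
  proof -
    have "(\<Prod>r=0..<n. Matrix.mat n n (\<lambda>(r, j). A r j) $$ (r, p r)) = (\<Prod>r=0..<n. A r (p r))" if "p \<in> ?S" for p
      using that by (intro prod.cong refl) (auto dest: permutes_in_image[of p "{0..<n}"])
    then show ?thesis by (subst det_def'[of _ n]) auto
  qed
  have "(\<lambda>L. \<Sum>p\<in>?S. signof p * (\<Prod>r=0..<n. B L r (p r) / of_nat (N L) powi (q (p r) + int r)))
      \<longlonglongrightarrow> (\<Sum>p\<in>?S. signof p * (\<Prod>r=0..<n. \<tau> r (p r)))"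
    by (intro tendsto_sum tendsto_mult tendsto_const tendsto_prod B) (auto dest: permutes_in_image)
  moreover have "\<forall>\<^sub>F L in sequentially.
      (\<Sum>p\<in>?S. signof p * (\<Prod>r=0..<n. B L r (p r) / of_nat (N L) powi (q (p r) + int r)))
      = Determinant.det (Matrix.mat n n (\<lambda>(r, j). B L r j)) / of_nat (N L) ^ k"
    using eventually_compose_filterlim[OF eventually_gt_at_top[of 0] N]
  proof eventually_elim
    case (elim L)
    have "(\<Prod>r=0..<n. B L r (p r) / of_nat (N L) powi (q (p r) + int r)) = (\<Prod>r=0..<n. B L r (p r)) / of_nat (N L) ^ k"
      if p: "p \<in> ?S" for p
    proof -
      have "(\<Sum>r=0..<n. q (p r) + int r) = (\<Sum>r=0..<n. q (p r)) + (\<Sum>r=0..<n. int r)" by (rule sum.distrib)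
      also have "(\<Sum>r=0..<n. q (p r)) = (\<Sum>r=0..<n. q r)"
        using p by (intro sum.reindex_bij_betw) (auto intro: permutes_imp_bij)
      finally have "(\<Sum>r=0..<n. q (p r) + int r) = int k"
        using k by (simp add: sum.distrib lessThan_atLeast0)
      then show ?thesis using elim
        by (simp add: prod_dividef powi_sum)
    qed
    then show ?case by (simp add: det sum_divide_distrib)
  qed
  ultimately show ?thesis unfolding det by (rule Lim_transform_eventually)
qed

text \<open>Expansion in the basis writes the numerator matrix as the denominator matrix times the
  coefficient matrix. For \<open>j \<ge> n\<close> the column belongs to a falling factorial that is
  itself a basis element, so it is a unit column and only the leading block of size \<open>n\<close>
  counts.\<close>

lemma shifted_schur_eq_det:
  fixes x l :: "nat \<Rightarrow> complex"
  assumes l_def: "l = (\<lambda>i. x i + of_nat (N - 1 - i))"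
    and inj: "inj_on l {..<N}" and n: "n \<le> N" and \<mu>: "\<And>j. j \<ge> n \<Longrightarrow> part \<mu> j = 0"
  shows "shifted_schur N \<mu> x
    = Determinant.det (Matrix.mat n n (\<lambda>(r, j). falling_coeff N l (part \<mu> j + (N - 1 - j)) (N - 1 - r)))"
proof -
  let ?T = "falling_coeff N l"
  let ?V = "Matrix.mat N N (\<lambda>(i, r). falling (l i) (N - 1 - r))"
  let ?M = "Matrix.mat N N (\<lambda>(r, j). ?T (part \<mu> j + (N - 1 - j)) (N - 1 - r))"
  let ?A = "Matrix.mat N N (\<lambda>(i, j). falling (l i) (part \<mu> j + (N - 1 - j)))"
  let ?B = "Matrix.mat n n (\<lambda>(r, j). ?T (part \<mu> j + (N - 1 - j)) (N - 1 - r))"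
  let ?C = "Matrix.mat (N - n) n (\<lambda>(r, j). ?T (part \<mu> j + (N - 1 - j)) (N - 1 - (r + n)))"
  have rev: "(\<Sum>r<N. f (N - 1 - r)) = (\<Sum>r<N. f r)" for f :: "nat \<Rightarrow> complex"
    by (rule sum.reindex_bij_witness[of _ "\<lambda>r. N - 1 - r" "\<lambda>r. N - 1 - r"]) auto
  \<comment> \<open>The columns of \<open>?V\<close> come in decreasing degree, so independence is
    applied to the reversed vector.\<close>
  have "Determinant.det ?V \<noteq> 0"
  proof
    assume "Determinant.det ?V = 0"
    then obtain v where v: "v \<in> carrier_vec N" "v \<noteq> 0\<^sub>v N" "?V *\<^sub>v v = 0\<^sub>v N"
      using det_0_iff_vec_prod_zero[of ?V N] by auto
    have "v $ (N - 1 - r) = 0" if "r < N" for r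
    proof (rule falling_independent[OF inj _ that])
      fix i assume i: "i < N"
      have "(\<Sum>r<N. v $ (N - 1 - r) * falling (l i) r) = (\<Sum>r<N. v $ r * falling (l i) (N - 1 - r))"
        using rev[of "\<lambda>r. v $ r * falling (l i) (N - 1 - r)", symmetric] by simp
      also have "\<dots> = (?V *\<^sub>v v) $ i"
        using v(1) i by (simp add: scalar_prod_def lessThan_atLeast0 mult.commute)
      also have "\<dots> = 0" unfolding v(3) using i by simp
      finally show "(\<Sum>r<N. v $ (N - 1 - r) * falling (l i) r) = 0" .
    qed
    then have "v $ r = 0" if "r < N" for r
      using that by (metis Suc_pred' diff_Suc_1 diff_diff_cancel diff_less_Suc less_Suc_eq_le order_le_less_trans zero_le)
    then show False using v(1,2) by auto
  qed
  moreover have "?A = ?V * ?M"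
  proof (rule eq_matI)
    fix i j assume "i < dim_row (?V * ?M)" "j < dim_col (?V * ?M)"
    then have ij: "i < N" "j < N" by auto
    let ?m = "part \<mu> j + (N - 1 - j)"
    have "falling (l i) ?m = (\<Sum>r<N. ?T ?m r * falling (l i) r)" by (rule falling_coeff[OF inj ij(1)])
    also have "\<dots> = (\<Sum>r<N. falling (l i) (N - 1 - r) * ?T ?m (N - 1 - r))"
      using rev[of "\<lambda>r. ?T ?m r * falling (l i) r"] by (simp add: mult.commute)
    also have "\<dots> = (?V * ?M) $$ (i, j)"
      using ij by (simp add: scalar_prod_def lessThan_atLeast0)
    finally show "?A $$ (i, j) = (?V * ?M) $$ (i, j)" using ij by simp
  qed auto
  then have "Determinant.det ?A = Determinant.det ?V * Determinant.det ?M"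
    by (simp add: det_mult[of _ N])
  moreover have "?M = four_block_mat ?B (0\<^sub>m n (N - n)) ?C (1\<^sub>m (N - n))"
  proof (rule eq_matI)
    fix r j assume "r < dim_row (four_block_mat ?B (0\<^sub>m n (N - n)) ?C (1\<^sub>m (N - n)))"
      "j < dim_col (four_block_mat ?B (0\<^sub>m n (N - n)) ?C (1\<^sub>m (N - n)))"
    then have rj: "r < N" "j < N" using n by auto
    have "?T (part \<mu> j + (N - 1 - j)) (N - 1 - r) = (if r = j then 1 else 0)" if "j \<ge> n"
    proof -
      have "N - 1 - r < N" "N - 1 - j < N" using rj by auto
      from falling_coeff_less[OF inj this(2,1)] show ?thesis
        using \<mu>[OF that] rj by auto
    qed
    then show "?M $$ (r, j) = four_block_mat ?B (0\<^sub>m n (N - n)) ?C (1\<^sub>m (N - n)) $$ (r, j)"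
      using rj n by (auto simp: index_mat_four_block)
  qed (use n in auto)
  then have "Determinant.det ?M = Determinant.det ?B"
    using det_four_block_mat_upper_right_zero[of ?B n "0\<^sub>m n (N - n)" "N - n" ?C "1\<^sub>m (N - n)"] by simp
  ultimately show ?thesis
    by (simp add: shifted_schur_def l_def)
qed

section \<open>Asymptotics of the reduction coefficients\<close>

context
  fixes N :: "nat \<Rightarrow> nat" and x :: "nat \<Rightarrow> nat \<Rightarrow> complex" and P h :: "nat \<Rightarrow> complex"
    and l :: "nat \<Rightarrow> nat \<Rightarrow> complex"
  assumes N: "filterlim N at_top sequentially"
    and l_def: "l = (\<lambda>L i. x L i + of_nat (N L - 1 - i))"
    and inj: "\<forall>\<^sub>F L in sequentially. inj_on (l L) {..<N L}"
    and p: "\<And>k. (\<lambda>L. (\<Sum>i<N L. (x L i - of_nat i) ^ Suc k - (- of_nat i) ^ Suc k) / of_nat (N L) ^ Suc k) \<longlonglongrightarrow> P (Suc k)"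
    and h: "h 0 = 1" "\<And>k. of_nat (Suc k) * h (Suc k) = (\<Sum>j\<le>k. h j * P (Suc (k - j)))"
begin

lemma eventually_N_gt: "\<forall>\<^sub>F L in sequentially. c < N L"
  by (rule eventually_compose_filterlim[OF eventually_gt_at_top N])

text \<open>At each node the falling factorial of degree \<open>N - 1 + q\<close> is the one of
  degree \<open>N - 1\<close> times the one of degree \<open>q\<close> at the centred node.
  Expanding the latter in powers gives moments \<open>G s\<close> of order at most
  \<open>N^s\<close>, so only \<open>s = q\<close> survives division by \<open>N^q\<close>.\<close>

lemma top_coeff_limit_nat:
  "(\<lambda>L. falling_coeff (N L) (l L) (N L - 1 + q) (N L - 1) / of_nat (N L) ^ q) \<longlonglongrightarrow> h q"
proof -
  \<comment> \<open>The nodes are known to be distinct only for large \<open>L\<close>, so the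
    premise stays inside the quantifier from which \<open>w\<close> is chosen.\<close>
  have "\<forall>L. \<exists>w. 0 < N L \<and> inj_on (l L) {..<N L} \<longrightarrow>
      (\<forall>m. falling_coeff (N L) (l L) m (N L - 1) = (\<Sum>j<N L. w j * falling (l L j) m))"
    using falling_coeff_weights by (metis One_nat_def diff_less zero_less_Suc)
  then obtain w where w: "\<And>L m. 0 < N L \<Longrightarrow> inj_on (l L) {..<N L} \<Longrightarrow>
      falling_coeff (N L) (l L) m (N L - 1) = (\<Sum>j<N L. w L j * falling (l L j) m)"
    by metis
  define y where "y = (\<lambda>L j. l L j - of_nat (N L - 1))"
  define G where "G = (\<lambda>L s. \<Sum>j<N L. w L j * falling (l L j) (N L - 1) * y L j ^ s)"
  define ps where "ps = (\<lambda>L k. \<Sum>i<N L. y L i ^ k - (- of_nat i) ^ k)"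
  have y: "y L i = x L i - of_nat i" if "i < N L" for L i
    using that by (simp add: y_def l_def of_nat_diff)
  have eq: "ps L (Suc k) = (\<Sum>i<N L. (x L i - of_nat i) ^ Suc k - (- of_nat i) ^ Suc k)" for L k
    unfolding ps_def by (intro sum.cong refl) (simp add: y)
  have pl: "(\<lambda>L. ps L (Suc k) / of_nat (N L) ^ Suc k) \<longlonglongrightarrow> P (Suc k)" for k
    unfolding eq by (rule p)
  have Gl: "(\<lambda>L. G L k / of_nat (N L) ^ k) \<longlonglongrightarrow> h k" for k
  proof (rule newton_limit[OF N _ _ pl h])
    show "\<forall>\<^sub>F L in sequentially. G L 0 = 1"
      using eventually_N_gt[of 0] inj
    proof eventually_elim
      case (elim L)
      show ?case
        using weights_moments_newton(1)[OF elim(2,1) w[OF elim] refl] by (simp add: G_def y_def)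
    qed
    show "\<forall>\<^sub>F L in sequentially. of_nat (Suc k) * G L (Suc k) = (\<Sum>j\<le>k. G L j * ps L (Suc (k - j)))" for k
      using eventually_N_gt[of 0] inj
    proof eventually_elim
      case (elim L)
      show ?case
        using weights_moments_newton(2)[OF elim(2,1) w[OF elim] refl, of k] by (simp only: G_def y_def ps_def)
    qed
  qed
  have "(\<lambda>L. \<Sum>s\<le>q. coeff (falling_poly q) s * (G L s / of_nat (N L) ^ s) * (1 / of_nat (N L)) ^ (q - s))
      \<longlonglongrightarrow> (\<Sum>s\<le>q. coeff (falling_poly q) s * h s * 0 ^ (q - s))"
  proof (intro tendsto_sum tendsto_mult tendsto_const Gl tendsto_power)
    have "filterlim (\<lambda>L. complex_of_nat (N L)) at_infinity sequentially"
      by (rule filterlim_compose[OF tendsto_of_nat N])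
    then show "(\<lambda>L. 1 / complex_of_nat (N L)) \<longlonglongrightarrow> 0"
      by (rule tendsto_divide_0[OF tendsto_const])
  qed
  also have "(\<Sum>s\<le>q. coeff (falling_poly q) s * h s * 0 ^ (q - s)) = h q"
  proof -
    have "(\<Sum>s\<le>q. coeff (falling_poly q) s * h s * 0 ^ (q - s)) = (\<Sum>s\<le>q. if s = q then h q else 0)"
      by (intro sum.cong refl) (auto simp: monic_falling_poly power_0_left)
    then show ?thesis by simp
  qed
  finally have lim: "(\<lambda>L. \<Sum>s\<le>q. coeff (falling_poly q) s * (G L s / of_nat (N L) ^ s) * (1 / of_nat (N L)) ^ (q - s))
      \<longlonglongrightarrow> h q" .
  have fq: "falling z q = (\<Sum>s\<le>q. coeff (falling_poly q) s * z ^ s)" for z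
    unfolding poly_falling_poly[symmetric] poly_altdef monic_falling_poly ..
  have "\<forall>\<^sub>F L in sequentially. (\<Sum>s\<le>q. coeff (falling_poly q) s * (G L s / of_nat (N L) ^ s) * (1 / of_nat (N L)) ^ (q - s))
      = falling_coeff (N L) (l L) (N L - 1 + q) (N L - 1) / of_nat (N L) ^ q"
    using eventually_N_gt[of 0] inj
  proof eventually_elim
    case (elim L)
    have "falling_coeff (N L) (l L) (N L - 1 + q) (N L - 1)
        = (\<Sum>j<N L. w L j * falling (l L j) (N L - 1) * (\<Sum>s\<le>q. coeff (falling_poly q) s * y L j ^ s))"
      unfolding w[OF elim] falling_add y_def fq by (simp only: mult.assoc)
    also have "\<dots> = (\<Sum>s\<le>q. coeff (falling_poly q) s * G L s)"
      unfolding G_def sum_distrib_left by (subst sum.swap) (simp add: mult_ac)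
    finally have "falling_coeff (N L) (l L) (N L - 1 + q) (N L - 1) / of_nat (N L) ^ q
        = (\<Sum>s\<le>q. coeff (falling_poly q) s * G L s / of_nat (N L) ^ q)"
      by (simp only: sum_divide_distrib)
    also have "\<dots> = (\<Sum>s\<le>q. coeff (falling_poly q) s * (G L s / of_nat (N L) ^ s) * (1 / of_nat (N L)) ^ (q - s))"
    proof (intro sum.cong refl)
      fix s assume "s \<in> {..q}"
      then have "complex_of_nat (N L) ^ q = of_nat (N L) ^ s * of_nat (N L) ^ (q - s)"
        by (simp flip: power_add)
      then show "coeff (falling_poly q) s * G L s / of_nat (N L) ^ q
          = coeff (falling_poly q) s * (G L s / of_nat (N L) ^ s) * (1 / of_nat (N L)) ^ (q - s)"
        by (simp add: power_divide)
    qed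
    finally show ?case by simp
  qed
  with lim show ?thesis by (rule Lim_transform_eventually)
qed

text \<open>For negative \<open>q\<close> and large \<open>N\<close> the falling factorial is a
  basis element of degree below \<open>N - 1\<close>, so its top coefficient is 0, as
  \<open>int_seq\<close> prescribes.\<close>

lemma top_coeff_limit:
  "(\<lambda>L. falling_coeff (N L) (l L) (nat (int (N L) - 1 + q)) (N L - 1) / of_nat (N L) powi q)
     \<longlonglongrightarrow> int_seq h q"
proof (cases "q < 0")
  case True
  have "\<forall>\<^sub>F L in sequentially. falling_coeff (N L) (l L) (nat (int (N L) - 1 + q)) (N L - 1) / of_nat (N L) powi q = 0"
    using eventually_N_gt[of "nat \<bar>q\<bar> + 1"] inj
  proof eventually_elim
    case (elim L)
    have "nat (int (N L) - 1 + q) < N L" "N L - 1 < N L" "nat (int (N L) - 1 + q) \<noteq> N L - 1"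
      using elim(1) True by auto
    then show ?case using falling_coeff_less[OF elim(2)] by simp
  qed
  then show ?thesis using True by (simp add: tendsto_eventually int_seq_def)
next
  case False
  have "\<forall>\<^sub>F L in sequentially. falling_coeff (N L) (l L) (N L - 1 + nat q) (N L - 1) / of_nat (N L) ^ nat q
      = falling_coeff (N L) (l L) (nat (int (N L) - 1 + q)) (N L - 1) / of_nat (N L) powi q"
    using eventually_N_gt[of 0]
  proof eventually_elim
    case (elim L)
    have "nat (int (N L) - 1 + q) = N L - 1 + nat q" using elim False by auto
    then show ?case using False by (simp add: power_int_def)
  qed
  with top_coeff_limit_nat[of "nat q"] show ?thesis
    using False by (simp add: int_seq_def Lim_transform_eventually)
qed

text \<open>The three-term recursion is used at \<open>m = N - 1 + q\<close> and
  \<open>r = N - 2 - i\<close>. Its middle term has the bounded factor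
  \<open>m - (r + 1) = q + i\<close> where the scaling would allow a factor of order
  \<open>N\<close>, so it disappears; the other two terms give the recursion of
  \<open>coeff_limit\<close>.\<close>

lemma falling_coeff_limit:
  "(\<lambda>L. falling_coeff (N L) (l L) (nat (int (N L) - 1 + q)) (N L - 1 - i) / of_nat (N L) powi (q + int i))
     \<longlonglongrightarrow> coeff_limit h i q"
proof (induction i arbitrary: q)
  case 0
  then show ?case using top_coeff_limit by simp
next
  case (Suc i)
  define R where "R = (\<lambda>q i L. falling_coeff (N L) (l L) (nat (int (N L) - 1 + q)) (N L - 1 - i) / of_nat (N L) powi (q + int i))"
  have R0: "R q 0 \<longlonglongrightarrow> int_seq h q" for q using top_coeff_limit by (simp add: R_def)
  have IH: "R q i \<longlonglongrightarrow> coeff_limit h i q" for q using Suc by (simp add: R_def)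
  have inf: "(\<lambda>L. 1 / complex_of_nat (N L)) \<longlonglongrightarrow> 0"
    by (rule tendsto_divide_0[OF tendsto_const]) (rule filterlim_compose[OF tendsto_of_nat N])
  have "(\<lambda>L. R (q + 1) i L + of_int (q + int i) * (1 / of_nat (N L)) * R q i L - R q 0 L * R 1 i L)
      \<longlonglongrightarrow> coeff_limit h i (q + 1) + of_int (q + int i) * 0 * coeff_limit h i q - int_seq h q * coeff_limit h i 1"
    by (intro tendsto_intros IH R0 inf)
  then have lim: "(\<lambda>L. R (q + 1) i L + of_int (q + int i) * (1 / of_nat (N L)) * R q i L - R q 0 L * R 1 i L)
      \<longlonglongrightarrow> coeff_limit h (Suc i) q" by simp
  have "\<forall>\<^sub>F L in sequentially. R (q + 1) i L + of_int (q + int i) * (1 / of_nat (N L)) * R q i L - R q 0 L * R 1 i L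
      = R q (Suc i) L"
    using eventually_N_gt[of "nat \<bar>q\<bar> + i + 5"] inj
  proof eventually_elim
    case (elim L)
    define m where "m = nat (int (N L) - 1 + q)"
    have m: "nat (int (N L) - 1 + (q + 1)) = Suc m" "nat (int (N L) - 1 + 1) = N L"
      "Suc (N L - 1 - Suc i) = N L - 1 - i" "Suc (N L - 1 - Suc i) < N L"
      using elim(1) by (auto simp: m_def)
    have mi: "complex_of_nat m - of_nat (N L - 1 - i) = of_int (q + int i)"
    proof -
      have "int m - int (N L - 1 - i) = q + int i" using elim(1) by (auto simp: m_def)
      then show ?thesis by (metis of_int_diff of_int_of_nat_eq)
    qed
    have rec: "falling_coeff (N L) (l L) m (N L - 1 - Suc i)
        = falling_coeff (N L) (l L) (Suc m) (N L - 1 - i)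
          + of_int (q + int i) * falling_coeff (N L) (l L) m (N L - 1 - i)
          - falling_coeff (N L) (l L) m (N L - 1) * falling_coeff (N L) (l L) (N L) (N L - 1 - i)"
      using falling_coeff_rec[OF elim(2) m(4), of m] unfolding m(3) mi .
    have N0: "complex_of_nat (N L) \<noteq> 0" using elim(1) by auto
    have e: "complex_of_nat (N L) powi (q + 1 + int i) = of_nat (N L) powi (q + int (Suc i))"
      "complex_of_nat (N L) powi (q + int i) * of_nat (N L) = of_nat (N L) powi (q + int (Suc i))"
      "complex_of_nat (N L) powi (q + int 0) * of_nat (N L) powi (1 + int i) = of_nat (N L) powi (q + int (Suc i))"
      using N0 by (simp_all add: power_int_add add_ac)
    have split: "X / E + c * (1 / n) * (Y / a) - Z / A * (W / B) = (X + c * Y - Z * W) / E"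
      if "E = a * n" "A * B = E" for X Y Z W E a n A B c :: complex
      unfolding times_divide_times_eq that(2)
      by (simp add: that(1) add_divide_distrib diff_divide_distrib mult.commute)
    show ?case unfolding R_def m m_def[symmetric] rec diff_zero e(1)
      by (rule split[OF e(2)[symmetric] e(3)])
  qed
  with lim show ?case unfolding R_def by (rule Lim_transform_eventually)
qed

lemma shifted_schur_limit:
  assumes \<mu>: "int_partition \<mu>"
  shows "(\<lambda>L. shifted_schur (N L) \<mu> (x L) / of_nat (N L) ^ sum_list \<mu>)
    \<longlonglongrightarrow> Determinant.det (Matrix.mat (length \<mu>) (length \<mu>) (\<lambda>(i, j). int_seq h (int (\<mu> ! i) - int i + int j)))"
proof -
  let ?n = "length \<mu>" and ?q = "\<lambda>j. int (part \<mu> j) - int j"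
  define B where "B = (\<lambda>L r j. falling_coeff (N L) (l L) (nat (int (N L) - 1 + ?q j)) (N L - 1 - r))"
  have "(\<lambda>L. Determinant.det (Matrix.mat ?n ?n (\<lambda>(r, j). B L r j)) / of_nat (N L) ^ sum_list \<mu>)
     \<longlonglongrightarrow> Determinant.det (Matrix.mat ?n ?n (\<lambda>(r, j). coeff_limit h r (?q j)))"
  proof (rule det_scaled_limit[OF N])
    show "(\<lambda>L. B L r j / of_nat (N L) powi (?q j + int r)) \<longlonglongrightarrow> coeff_limit h r (?q j)" for r j
      unfolding B_def by (rule falling_coeff_limit)
    show "(\<Sum>j<?n. ?q j + int j) = int (sum_list \<mu>)"
      by (simp add: part_def sum_list_sum_nth lessThan_atLeast0)
  qed
  moreover have "\<forall>\<^sub>F L in sequentially. Determinant.det (Matrix.mat ?n ?n (\<lambda>(r, j). B L r j)) / of_nat (N L) ^ sum_list \<mu>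
      = shifted_schur (N L) \<mu> (x L) / of_nat (N L) ^ sum_list \<mu>"
    using eventually_N_gt[of ?n] inj
  proof eventually_elim
    case (elim L)
    have "shifted_schur (N L) \<mu> (x L)
        = Determinant.det (Matrix.mat ?n ?n (\<lambda>(r, j). falling_coeff (N L) (l L) (part \<mu> j + (N L - 1 - j)) (N L - 1 - r)))"
      by (rule shifted_schur_eq_det) (use elim in \<open>auto simp: l_def part_def\<close>)
    also have "Matrix.mat ?n ?n (\<lambda>(r, j). falling_coeff (N L) (l L) (part \<mu> j + (N L - 1 - j)) (N L - 1 - r))
        = Matrix.mat ?n ?n (\<lambda>(r, j). B L r j)"
    proof (rule eq_matI)
      fix r j assume "r < dim_row (Matrix.mat ?n ?n (\<lambda>(r, j). B L r j))" "j < dim_col (Matrix.mat ?n ?n (\<lambda>(r, j). B L r j))"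
      then have rj: "r < ?n" "j < ?n" by auto
      then have "nat (int (N L) - 1 + ?q j) = part \<mu> j + (N L - 1 - j)" using elim(1) by auto
      then show "Matrix.mat ?n ?n (\<lambda>(r, j). falling_coeff (N L) (l L) (part \<mu> j + (N L - 1 - j)) (N L - 1 - r)) $$ (r, j)
          = Matrix.mat ?n ?n (\<lambda>(r, j). B L r j) $$ (r, j)" using rj by (simp add: B_def)
    qed auto
    finally show ?case by simp
  qed
  ultimately have "(\<lambda>L. shifted_schur (N L) \<mu> (x L) / of_nat (N L) ^ sum_list \<mu>)
    \<longlonglongrightarrow> Determinant.det (Matrix.mat ?n ?n (\<lambda>(r, j). coeff_limit h r (?q j)))"
    by (rule Lim_transform_eventually)
  also have "Matrix.mat ?n ?n (\<lambda>(r, j). coeff_limit h r (?q j)) = Matrix.mat ?n ?n (\<lambda>(r, j). coeff_limit h r (int (\<mu> ! j) - int j))"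
    by (rule eq_matI) (auto simp: part_def)
  finally show ?thesis unfolding det_coeff_limit .
qed

end

section \<open>Power sums of a Vershik--Kerov sequence\<close>

text \<open>Rows of length 0 contribute nothing, so the value depends on the diagram alone once
  \<open>N\<close> bounds its number of rows.\<close>

definition shifted_power_sum :: "nat \<Rightarrow> (nat \<Rightarrow> nat) \<Rightarrow> nat \<Rightarrow> real" where
  "shifted_power_sum N f k = (\<Sum>i<N. (real (f i) - real i) ^ k - (- real i) ^ k)"

text \<open>In a decreasing sequence the rows longer than \<open>j\<close> form an initial segment,
  so their number decides membership.\<close>

lemma transposed_iff:
  assumes "antimono f" "\<And>i. i \<ge> N \<Longrightarrow> f i = 0"
  shows "j < f i \<longleftrightarrow> i < transposed f j"
proof -
  let ?S = "{i. j < f i}"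
  have fin: "finite ?S" 
    by (rule finite_subset[of _ "{..<N}"]) (use assms(2) in \<open>auto simp: not_le[symmetric]\<close>)
  have down: "i' \<in> ?S" if "i \<in> ?S" "i' \<le> i" for i i'
    using that antimonoD[OF assms(1) that(2)] by auto
  have "?S = {..<card ?S}"
  proof (cases "?S = {}")
    case False
    have "?S = {..Max ?S}"
      using down[OF Max_in[OF fin False]] Max_ge[OF fin] by blast
    then show ?thesis by (metis card_atMost lessThan_Suc_atMost)
  qed auto
  then show ?thesis unfolding transposed_def by blast
qed

lemma sum_telescope_real:
  fixes c :: real
  assumes "a \<le> b"
  shows "(\<Sum>j=a..<b. (real j + 1 + c) ^ k - (real j + c) ^ k) = (real b + c) ^ k - (real a + c) ^ k"
  using sum_Suc_diff'[OF assms, of "\<lambda>j. (real j + c) ^ k"] by (simp add: add_ac)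

text \<open>
  Both sides are a sum over the cells \<open>(i, j)\<close> of the diagram of \<open>g (j - i)\<close>, where
  \<open>g c = (c + 1)\<^sup>k - c\<^sup>k\<close>.  The right-hand side sums along the rows on and above the diagonal, and
  along the columns below it.
\<close>

lemma shifted_power_sum_frobenius:
  assumes f: "antimono f" "\<And>i. i \<ge> N \<Longrightarrow> f i = 0" and k: "k > 0" and M: "\<And>i. f i \<le> M"
  shows "shifted_power_sum N f k
    = (\<Sum>i<N. max (real (f i) - real i) 0 ^ k) - (\<Sum>j<M. (- max (real (transposed f j) - real j - 1) 0) ^ k)"
proof -
  note tr = transposed_iff[where N = N, OF f]
  define g where "g = (\<lambda>i j. (real j + 1 - real i) ^ k - (real j - real i) ^ k)"
  \<comment> \<open>The cells \<open>j \<ge> i\<close> of row \<open>i\<close> telescope to a power;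
    the cells \<open>j < i\<close> are left for the columns.\<close>
  have row: "(real (f i) - real i) ^ k - (- real i) ^ k
      = max (real (f i) - real i) 0 ^ k + (\<Sum>j<M. if j < i \<and> j < f i then g i j else 0)" for i
  proof -
    have "(real (f i) - real i) ^ k - (- real i) ^ k = (\<Sum>j\<in>{0..<f i}. g i j)"
      using sum_telescope_real[of 0 "f i" "- real i" k] by (simp add: g_def algebra_simps)
    also have "{0..<f i} = {i..<f i} \<union> {j. j < i \<and> j < f i}" by auto
    also have "(\<Sum>j\<in>\<dots>. g i j) = (\<Sum>j\<in>{i..<f i}. g i j) + (\<Sum>j\<in>{j. j < i \<and> j < f i}. g i j)"
      by (rule sum.union_disjoint) auto
    also have "(\<Sum>j\<in>{i..<f i}. g i j) = max (real (f i) - real i) 0 ^ k"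
    proof (cases "i \<le> f i")
      case True
      then show ?thesis
        using sum_telescope_real[of i "f i" "- real i" k] k
        by (simp add: g_def algebra_simps max_def zero_power)
    qed (use k in \<open>auto simp: max_def\<close>)
    also have "(\<Sum>j\<in>{j. j < i \<and> j < f i}. g i j) = (\<Sum>j<M. if j < i \<and> j < f i then g i j else 0)"
      using M[of i] by (intro sum.mono_neutral_cong_left) auto
    finally show ?thesis .
  qed
  \<comment> \<open>Below the diagonal the sum telescopes in \<open>i\<close>. Its end at
    \<open>i = j + 1\<close> is \<open>0^k\<close>, which vanishes because
    \<open>k > 0\<close>.\<close>
  have col: "(\<Sum>i<N. if j < i \<and> j < f i then g i j else 0)
      = - ((- max (real (transposed f j) - real j - 1) 0) ^ k)" for j
  proof -
    let ?t = "transposed f j"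
    have tN: "?t \<le> N" using tr[of j N] f(2)[of N] by (metis leI not_less_zero order_refl)
    have "(\<Sum>i<N. if j < i \<and> j < f i then g i j else 0) = (\<Sum>i\<in>{Suc j..<?t}. g i j)"
      using tN by (intro sum.mono_neutral_cong_right) (auto simp: tr)
    also have "\<dots> = - ((- max (real ?t - real j - 1) 0) ^ k)"
    proof (cases "Suc j \<le> ?t")
      case True
      have "(\<Sum>i=Suc j..<?t. (real j + 1 - real (Suc i)) ^ k - (real j + 1 - real i) ^ k)
          = (real j + 1 - real ?t) ^ k - (real j + 1 - real (Suc j)) ^ k"
        by (rule sum_Suc_diff'[OF True])
      moreover have "(\<Sum>i=Suc j..<?t. g i j)
          = - (\<Sum>i=Suc j..<?t. (real j + 1 - real (Suc i)) ^ k - (real j + 1 - real i) ^ k)"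
        by (simp add: g_def sum_negf[symmetric])
      moreover have "max (real ?t - real j - 1) 0 = real ?t - real j - 1" using True by (simp add: max_def)
      ultimately show ?thesis using k by (simp add: algebra_simps zero_power)
    qed (use k in \<open>auto simp: max_def\<close>)
    finally show ?thesis .
  qed
  have "shifted_power_sum N f k
      = (\<Sum>i<N. max (real (f i) - real i) 0 ^ k) + (\<Sum>i<N. \<Sum>j<M. if j < i \<and> j < f i then g i j else 0)"
    unfolding shifted_power_sum_def row by (rule sum.distrib)
  also have "(\<Sum>i<N. \<Sum>j<M. if j < i \<and> j < f i then g i j else 0)
      = - (\<Sum>j<M. (- max (real (transposed f j) - real j - 1) 0) ^ k)"
    by (subst sum.swap) (simp add: col sum_negf)
  finally show ?thesis by simp
qed

lemma diagram_size_eq: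
  assumes "\<And>i. i \<ge> N \<Longrightarrow> f i = 0" shows "diagram_size f = (\<Sum>i<N. f i)"
proof -
  have "{i. f i \<noteq> 0} \<subseteq> {..<N}" using assms by (metis (mono_tags) lessThan_iff linorder_not_le mem_Collect_eq subsetI)
  then show ?thesis unfolding diagram_size_def by (intro sum.mono_neutral_left) auto
qed

text \<open>The rows up to row \<open>i\<close> are at least as long as row \<open>i\<close>. This
  is the source of the majorant \<open>C / (i + 1)\<close> for dominated convergence.\<close>

lemma row_bound:
  assumes f: "antimono f" "\<And>i. i \<ge> N \<Longrightarrow> f i = 0"
  shows "Suc i * f i \<le> diagram_size f"
proof (cases "i < N")
  case True
  have "Suc i * f i = (\<Sum>j<Suc i. f i)" by simp
  also have "\<dots> \<le> (\<Sum>j<Suc i. f j)" by (intro sum_mono antimonoD[OF f(1)]) auto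
  also have "\<dots> \<le> (\<Sum>j<N. f j)" using True by (intro sum_mono2) auto
  finally show ?thesis using diagram_size_eq[OF f(2)] by simp
qed (use f in auto)

lemma column_bound:
  assumes f: "antimono f" "\<And>i. i \<ge> N \<Longrightarrow> f i = 0"
  shows "Suc j * transposed f j \<le> diagram_size f"
proof -
  note tr = transposed_iff[where N = N, OF f]
  have tN: "transposed f j \<le> N" using tr[of j N] f(2)[of N] by (metis leI not_less_zero order_refl)
  have "Suc j * transposed f j = (\<Sum>i<transposed f j. Suc j)" by simp
  also have "\<dots> \<le> (\<Sum>i<transposed f j. f i)"
  proof (rule sum_mono)
    fix i assume "i \<in> {..<transposed f j}"
    then show "Suc j \<le> f i" using tr[of j i] by simp
  qed
  also have "\<dots> \<le> (\<Sum>i<N. f i)" using tN by (intro sum_mono2) auto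
  finally show ?thesis using diagram_size_eq[OF f(2)] by simp
qed

lemma max_0_divide: "0 \<le> n \<Longrightarrow> max (x / n) 0 = max x 0 / (n :: real)"
  by (auto simp: max_def divide_le_0_iff zero_le_divide_iff)

text \<open>The majorant \<open>C / (i + 1)\<close> becomes summable on taking a power
  \<open>k \<ge> 2\<close>. For \<open>k = 1\<close> mass may escape to large indices, and
  \<open>\<gamma>\<close> records it.\<close>

lemma tannery_power_sum:
  fixes a :: "nat \<Rightarrow> nat \<Rightarrow> real"
  assumes lim: "\<And>i. (\<lambda>L. a i L) \<longlonglongrightarrow> b i" and bd: "\<forall>\<^sub>F L in sequentially. \<forall>i. \<bar>a i L\<bar> \<le> C / real (Suc i)"
    and k: "k \<ge> 2"
  shows "(\<lambda>L. suminf (\<lambda>i. a i L ^ k)) \<longlonglongrightarrow> suminf (\<lambda>i. b i ^ k)" and "summable (\<lambda>i. b i ^ k)"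
proof -
  \<comment> \<open>Tannery's theorem asks for the bound along the product filter; the bound at hand
    is uniform in \<open>i\<close>.\<close>
  have ev: "\<forall>\<^sub>F (i, L) in sequentially \<times>\<^sub>F sequentially. norm (a i L ^ k) \<le> \<bar>C\<bar> ^ k * (1 / real (Suc i) ^ k)"
  proof -
    have "\<forall>\<^sub>F L in sequentially. \<forall>i. norm (a i L ^ k) \<le> \<bar>C\<bar> ^ k * (1 / real (Suc i) ^ k)"
      using bd
    proof eventually_elim
      case (elim L)
      show ?case
      proof
        fix i
        have "\<bar>a i L\<bar> \<le> \<bar>C\<bar> / real (Suc i)"
          using elim[rule_format, of i] divide_right_mono[OF abs_ge_self[of C], of "real (Suc i)"] by linarith
        then have "\<bar>a i L\<bar> ^ k \<le> (\<bar>C\<bar> / real (Suc i)) ^ k" by (intro power_mono) auto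
        then show "norm (a i L ^ k) \<le> \<bar>C\<bar> ^ k * (1 / real (Suc i) ^ k)"
          by (simp add: power_abs power_divide)
      qed
    qed
    note unif = this
    show ?thesis unfolding eventually_prod_filter
    proof (intro exI conjI allI impI)
      show "\<forall>\<^sub>F i in sequentially. (\<lambda>i::nat. True) i" by simp
      show "\<forall>\<^sub>F L in sequentially. \<forall>i. norm (a i L ^ k) \<le> \<bar>C\<bar> ^ k * (1 / real (Suc i) ^ k)"
        by (rule unif)
      fix i L assume "\<forall>i. norm (a i L ^ k) \<le> \<bar>C\<bar> ^ k * (1 / real (Suc i) ^ k)"
      then show "case (i, L) of (i, L) \<Rightarrow> norm (a i L ^ k) \<le> \<bar>C\<bar> ^ k * (1 / real (Suc i) ^ k)"
        unfolding prod.case by (rule spec)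
    qed
  qed
  have "summable (\<lambda>i. 1 / real (Suc i) ^ k)"
    using inverse_power_summable[OF k, where 'a = real] by (subst summable_Suc_iff) (simp add: divide_inverse)
  then have sm: "summable (\<lambda>i. \<bar>C\<bar> ^ k * (1 / real (Suc i) ^ k))" by (rule summable_mult)
  from tannerys_theorem[OF tendsto_power[OF lim] ev sm]
  show "(\<lambda>L. suminf (\<lambda>i. a i L ^ k)) \<longlonglongrightarrow> suminf (\<lambda>i. b i ^ k)" and "summable (\<lambda>i. b i ^ k)"
    by (auto intro: summable_norm_cancel)
qed

text \<open>The limiting power sum of one diagram in Frobenius coordinates. For \<open>k = 1\<close>
  the added \<open>\<gamma>\<close> restores the limit \<open>\<delta>\<close> of the diagram
  sizes.\<close>

definition half_power_sum :: "(nat \<Rightarrow> real) \<Rightarrow> (nat \<Rightarrow> real) \<Rightarrow> real \<Rightarrow> nat \<Rightarrow> real" where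
  "half_power_sum \<alpha> \<beta> \<gamma> k = suminf (\<lambda>i. \<alpha> i ^ k - (- \<beta> i) ^ k) + (if k = 1 then \<gamma> else 0)"

lemma shifted_power_sum_limit:
  fixes N :: "nat \<Rightarrow> nat"
  assumes N: "filterlim N at_top sequentially"
    and f: "\<And>L. L \<ge> 1 \<Longrightarrow> antimono (f L)" "\<And>L i. L \<ge> 1 \<Longrightarrow> i \<ge> N L \<Longrightarrow> f L i = 0"
    and vk: "vk_half N f \<alpha> \<beta> \<gamma>" and nonneg: "\<And>i. 0 \<le> \<alpha> i" "\<And>i. 0 \<le> \<beta> i" and k: "k > 0"
  shows "(\<lambda>L. shifted_power_sum (N L) (f L) k / real (N L) ^ k) \<longlonglongrightarrow> half_power_sum \<alpha> \<beta> \<gamma> k"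
proof -
  obtain \<delta> where \<delta>: "(\<lambda>L. real (diagram_size (f L)) / real (N L)) \<longlonglongrightarrow> \<delta>" "\<gamma> = \<delta> - suminf (\<lambda>i. \<alpha> i + \<beta> i)"
    and al: "\<And>i. (\<lambda>L. frob_coord (f L) i / real (N L)) \<longlonglongrightarrow> \<alpha> i"
    and be: "\<And>i. (\<lambda>L. frob_coord (transposed (f L)) i / real (N L)) \<longlonglongrightarrow> \<beta> i"
    using vk by (auto simp: vk_half_def)
  have ev: "\<forall>\<^sub>F L in sequentially. 1 \<le> L \<and> 0 < N L"
    using eventually_compose_filterlim[OF eventually_gt_at_top[of 0] N] eventually_ge_at_top[of 1]
    by eventually_elim simp
  show ?thesis
  proof (cases "k = 1")
    \<comment> \<open>For \<open>k = 1\<close> the power sum is the number of cells, whose limit is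
      given.\<close>
    case True
    have "\<forall>\<^sub>F L in sequentially. real (diagram_size (f L)) / real (N L) = shifted_power_sum (N L) (f L) k / real (N L) ^ k"
      using ev
    proof eventually_elim
      case (elim L)
      then show ?case using diagram_size_eq[of "N L" "f L"] f(2)[of L] True
        by (simp add: shifted_power_sum_def)
    qed
    moreover have "half_power_sum \<alpha> \<beta> \<gamma> k = \<delta>" using True \<delta>(2) by (simp add: half_power_sum_def)
    ultimately show ?thesis using \<delta>(1) by (simp add: Lim_transform_eventually)
  next
    case False
    then have k2: "k \<ge> 2" using k by simp
    \<comment> \<open>\<open>A\<close> and \<open>- B\<close> are truncated Frobenius coordinates,
      moved by \<open>1/2\<close> up and down respectively. The shift dies after scaling, and so
      does the truncation at 0, because the limits are nonnegative.\<close>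
    define A where "A = (\<lambda>i L. max (real (f L i) - real i) 0 / real (N L))"
    define B where "B = (\<lambda>i L. - (max (real (transposed (f L) i) - real i - 1) 0) / real (N L))"
    have inf: "(\<lambda>L. (1 / 2) / real (N L)) \<longlonglongrightarrow> 0"
      by (rule real_tendsto_divide_at_top[OF tendsto_const]) (rule filterlim_compose[OF filterlim_real_sequentially N])
    have A: "(\<lambda>L. A i L) \<longlonglongrightarrow> \<alpha> i" for i
    proof -
      have "(\<lambda>L. max (frob_coord (f L) i / real (N L) + (1 / 2) / real (N L)) 0) \<longlonglongrightarrow> max (\<alpha> i + 0) 0"
        by (intro tendsto_intros al inf)
      moreover have "max (frob_coord (f L) i / real (N L) + (1 / 2) / real (N L)) 0 = A i L" for L
        unfolding A_def frob_coord_def add_divide_distrib[symmetric] max_0_divide[OF of_nat_0_le_iff] by simp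
      ultimately show ?thesis using nonneg(1)[of i] by (simp add: max_def)
    qed
    have B: "(\<lambda>L. B i L) \<longlonglongrightarrow> - \<beta> i" for i
    proof -
      have "(\<lambda>L. - max (frob_coord (transposed (f L)) i / real (N L) - (1 / 2) / real (N L)) 0) \<longlonglongrightarrow> - max (\<beta> i - 0) 0"
        by (intro tendsto_intros be inf)
      moreover have "- max (frob_coord (transposed (f L)) i / real (N L) - (1 / 2) / real (N L)) 0 = B i L" for L
        unfolding B_def frob_coord_def diff_divide_distrib[symmetric] max_0_divide[OF of_nat_0_le_iff]
        by (simp add: algebra_simps)
      ultimately show ?thesis using nonneg(2)[of i] by (simp add: max_def)
    qed
    have evC: "\<forall>\<^sub>F L in sequentially. real (diagram_size (f L)) / real (N L) < \<delta> + 1"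
      using \<delta>(1) by (rule order_tendstoD) simp
    have bd: "\<forall>\<^sub>F L in sequentially. \<forall>i. \<bar>C i L\<bar> \<le> (\<delta> + 1) / real (Suc i)"
      if g: "\<And>L i. 1 \<le> L \<Longrightarrow> Suc i * g L i \<le> diagram_size (f L)"
        and C: "\<And>i L. \<bar>C i L\<bar> \<le> real (g L i) / real (N L)" for C :: "nat \<Rightarrow> nat \<Rightarrow> real" and g
      using evC ev
    proof eventually_elim
      case (elim L)
      show ?case
      proof
        fix i
        have "real (Suc i) * real (g L i) \<le> real (diagram_size (f L))"
          using g[of L i] elim(2) by (metis of_nat_le_iff of_nat_mult)
        then have "real (g L i) / real (N L) * real (Suc i) \<le> real (diagram_size (f L)) / real (N L)"
          by (simp add: divide_right_mono mult.commute del: of_nat_Suc)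
        then have "\<bar>C i L\<bar> * real (Suc i) \<le> \<delta> + 1"
          using elim(1) mult_right_mono[OF C[of i L], of "real (Suc i)"] by linarith
        then show "\<bar>C i L\<bar> \<le> (\<delta> + 1) / real (Suc i)" by (simp add: pos_le_divide_eq del: of_nat_Suc)
      qed
    qed
    have bdA: "\<forall>\<^sub>F L in sequentially. \<forall>i. \<bar>A i L\<bar> \<le> (\<delta> + 1) / real (Suc i)"
    proof (rule bd[of f])
      show "Suc i * f L i \<le> diagram_size (f L)" if "1 \<le> L" for L i
        by (rule row_bound[OF f(1)[OF that] f(2)[OF that]])
    qed (auto simp: A_def max_def divide_right_mono)
    have bdB: "\<forall>\<^sub>F L in sequentially. \<forall>i. \<bar>B i L\<bar> \<le> (\<delta> + 1) / real (Suc i)"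
    proof (rule bd[of "\<lambda>L. transposed (f L)"])
      show "Suc i * transposed (f L) i \<le> diagram_size (f L)" if "1 \<le> L" for L i
        by (rule column_bound[OF f(1)[OF that] f(2)[OF that]])
    qed (auto simp: B_def max_def divide_right_mono)
    note tA = tannery_power_sum[OF A bdA k2] and tB = tannery_power_sum[OF B bdB k2]
    have "half_power_sum \<alpha> \<beta> \<gamma> k = suminf (\<lambda>i. \<alpha> i ^ k) - suminf (\<lambda>i. (- \<beta> i) ^ k)"
      using suminf_diff[OF tA(2) tB(2)] False by (simp add: half_power_sum_def)
    moreover have "(\<lambda>L. suminf (\<lambda>i. A i L ^ k) - suminf (\<lambda>i. B i L ^ k))
        \<longlonglongrightarrow> suminf (\<lambda>i. \<alpha> i ^ k) - suminf (\<lambda>i. (- \<beta> i) ^ k)"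
      by (intro tendsto_diff tA tB)
    moreover have "\<forall>\<^sub>F L in sequentially. suminf (\<lambda>i. A i L ^ k) - suminf (\<lambda>i. B i L ^ k)
        = shifted_power_sum (N L) (f L) k / real (N L) ^ k"
      using ev
    proof eventually_elim
      case (elim L)
      then have fL: "antimono (f L)" "\<And>i. i \<ge> N L \<Longrightarrow> f L i = 0" using f[of L] by auto
      have M: "f L i \<le> f L 0" for i using antimonoD[OF fL(1), of 0 i] by simp
      have t0: "transposed (f L) j = 0" if "j \<ge> f L 0" for j
        using transposed_iff[where N = "N L", OF fL, of j 0] that by auto
      have "suminf (\<lambda>i. A i L ^ k) = (\<Sum>i<N L. A i L ^ k)"
        by (rule suminf_finite) (use fL(2) k in \<open>auto simp: A_def max_def\<close>)
      moreover have "suminf (\<lambda>i. B i L ^ k) = (\<Sum>j<f L 0. B j L ^ k)"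
        by (rule suminf_finite) (use t0 k in \<open>auto simp: B_def max_def\<close>)
      ultimately show ?case
        using shifted_power_sum_frobenius[where N = "N L", OF fL k M]
        by (simp only: A_def B_def power_divide diff_divide_distrib sum_divide_distrib)
    qed
    ultimately show ?thesis by (simp add: Lim_transform_eventually)
  qed
qed

section \<open>The positive and negative halves of a signature\<close>

lemma Sign_parts:
  assumes "l \<in> Sign N"
  shows "antimono (pos_part l)" "antimono (neg_part l)"
    "\<And>i. i \<ge> N \<Longrightarrow> pos_part l i = 0" "\<And>i. i \<ge> N \<Longrightarrow> neg_part l i = 0"
    "\<And>i. i < N \<Longrightarrow> l ! i = int (pos_part l i) - int (neg_part l (N - 1 - i))"
    "\<And>i. i < N \<Longrightarrow> pos_part l i = 0 \<or> neg_part l (N - 1 - i) = 0"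
proof -
  have len: "length l = N" and dec: "\<And>i j. i \<le> j \<Longrightarrow> j < N \<Longrightarrow> l ! j \<le> l ! i"
    using assms sorted_wrt_nth_less[of "(\<ge>)" l] by (auto simp: Sign_def le_less)
  show "antimono (pos_part l)"
    by (rule antimonoI) (auto simp: pos_part_def len intro!: nat_mono dec)
  show "antimono (neg_part l)"
    by (rule antimonoI) (auto simp: neg_part_def len intro!: nat_mono dec)
  show "pos_part l i = 0" "neg_part l i = 0" if "i \<ge> N" for i
    using that by (auto simp: pos_part_def neg_part_def len)
  show "l ! i = int (pos_part l i) - int (neg_part l (N - 1 - i))"
    "pos_part l i = 0 \<or> neg_part l (N - 1 - i) = 0" if "i < N" for i
    using that by (auto simp: pos_part_def neg_part_def len)
qed

text \<open>In each row one of the two parts is 0, so their contributions add. For the negative part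
  the reversal of the index produces a row of its diagram moved by \<open>N - 1\<close>, with a
  global sign; the translation is expanded binomially.\<close>

lemma signature_power_sum:
  assumes l: "l \<in> Sign N"
  shows "(\<Sum>i<N. (real_of_int (l ! i) - real i) ^ k - (- real i) ^ k)
    = shifted_power_sum N (pos_part l) k
      + (-1) ^ k * (\<Sum>r\<le>k. real (k choose r) * real (N - 1) ^ (k - r) * shifted_power_sum N (neg_part l) r)"
proof -
  note parts = Sign_parts[OF l]
  have bin: "(y + c) ^ k - (z + c) ^ k = (\<Sum>r\<le>k. real (k choose r) * c ^ (k - r) * (y ^ r - z ^ r))" for y z c :: real
    unfolding binomial_ring sum_subtractf[symmetric] by (intro sum.cong refl) (simp add: algebra_simps)
  have "(\<Sum>i<N. (real_of_int (l ! i) - real i) ^ k - (- real i) ^ k)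
      = (\<Sum>i<N. (real (pos_part l i) - real i) ^ k - (- real i) ^ k)
        + (\<Sum>i<N. (- real (neg_part l (N - 1 - i)) - real i) ^ k - (- real i) ^ k)"
    unfolding sum.distrib[symmetric]
  proof (intro sum.cong refl)
    fix i assume "i \<in> {..<N}"
    then have "i < N" by simp
    then show "(real_of_int (l ! i) - real i) ^ k - (- real i) ^ k =
        (real (pos_part l i) - real i) ^ k - (- real i) ^ k
        + ((- real (neg_part l (N - 1 - i)) - real i) ^ k - (- real i) ^ k)"
      using parts(6)[of i] by (auto simp: parts(5))
  qed
  also have "(\<Sum>i<N. (- real (neg_part l (N - 1 - i)) - real i) ^ k - (- real i) ^ k)
      = (\<Sum>i<N. (-1) ^ k * ((real (neg_part l i) - real i + real (N - 1)) ^ k - (- real i + real (N - 1)) ^ k))"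
  proof (rule sum.reindex_bij_witness[of _ "\<lambda>i. N - 1 - i" "\<lambda>i. N - 1 - i"])
    fix i assume "i \<in> {..<N}"
    then have "real i = real (N - 1) - real (N - 1 - i)" by auto
    then have "- real (neg_part l (N - 1 - i)) - real i = (-1) * (real (neg_part l (N - 1 - i)) - real (N - 1 - i) + real (N - 1))"
      "- real i = (-1) * (- real (N - 1 - i) + real (N - 1))" by simp_all
    then show "(-1) ^ k * ((real (neg_part l (N - 1 - i)) - real (N - 1 - i) + real (N - 1)) ^ k - (- real (N - 1 - i) + real (N - 1)) ^ k)
        = (- real (neg_part l (N - 1 - i)) - real i) ^ k - (- real i) ^ k"
      by (simp only: power_mult_distrib right_diff_distrib)
  qed auto
  also have "\<dots> = (-1) ^ k * (\<Sum>i<N. \<Sum>r\<le>k. real (k choose r) * real (N - 1) ^ (k - r) * ((real (neg_part l i) - real i) ^ r - (- real i) ^ r))"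
    unfolding bin by (simp only: sum_distrib_left)
  also have "(\<Sum>i<N. \<Sum>r\<le>k. real (k choose r) * real (N - 1) ^ (k - r) * ((real (neg_part l i) - real i) ^ r - (- real i) ^ r))
      = (\<Sum>r\<le>k. real (k choose r) * real (N - 1) ^ (k - r) * shifted_power_sum N (neg_part l) r)"
    unfolding shifted_power_sum_def by (subst sum.swap) (simp only: sum_distrib_left)
  finally show ?thesis unfolding shifted_power_sum_def .
qed

text \<open>The translation by \<open>N - 1\<close> of the negative half becomes a translation by 1
  after scaling, whence the binomial sum. Its term \<open>r = 0\<close> is absent because the power
  sums of exponent 0 vanish.\<close>

definition omega_power_sum :: "vk_param \<Rightarrow> nat \<Rightarrow> real" where
  "omega_power_sum \<omega> k = half_power_sum (alpha_p \<omega>) (beta_p \<omega>) (gamma_p \<omega>) k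
     + (-1) ^ k * (\<Sum>r=1..k. real (k choose r) * half_power_sum (alpha_m \<omega>) (beta_m \<omega>) (gamma_m \<omega>) r)"

lemma signature_power_sum_limit:
  assumes N: "filterlim N at_top sequentially"
    and lam: "\<And>L. L \<ge> 1 \<Longrightarrow> lam L \<in> Sign (N L)"
    and vk: "vershik_kerov N lam \<omega>" and \<omega>: "\<omega> \<in> Omega" and k: "k > 0"
  shows "(\<lambda>L. (\<Sum>i<N L. (real_of_int (lam L ! i) - real i) ^ k - (- real i) ^ k) / real (N L) ^ k)
     \<longlonglongrightarrow> omega_power_sum \<omega> k"
proof -
  have nn: "0 \<le> alpha_p \<omega> i" "0 \<le> beta_p \<omega> i" "0 \<le> alpha_m \<omega> i" "0 \<le> beta_m \<omega> i" for i
    using \<omega> by (auto simp: Omega_def)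
  have p: "(\<lambda>L. shifted_power_sum (N L) (pos_part (lam L)) k / real (N L) ^ k)
      \<longlonglongrightarrow> half_power_sum (alpha_p \<omega>) (beta_p \<omega>) (gamma_p \<omega>) k" if "k > 0" for k
    by (rule shifted_power_sum_limit[OF N Sign_parts(1)[OF lam] Sign_parts(3)[OF lam] _ nn(1,2) that])
      (use vk in \<open>simp_all add: vershik_kerov_def\<close>)
  have n: "(\<lambda>L. shifted_power_sum (N L) (neg_part (lam L)) k / real (N L) ^ k)
      \<longlonglongrightarrow> half_power_sum (alpha_m \<omega>) (beta_m \<omega>) (gamma_m \<omega>) k" if "k > 0" for k
    by (rule shifted_power_sum_limit[OF N Sign_parts(2)[OF lam] Sign_parts(4)[OF lam] _ nn(3,4) that])
      (use vk in \<open>simp_all add: vershik_kerov_def\<close>)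
  have ev: "\<forall>\<^sub>F L in sequentially. 1 \<le> L \<and> 0 < N L"
    using eventually_compose_filterlim[OF eventually_gt_at_top[of 0] N] eventually_ge_at_top[of 1]
    by eventually_elim simp
  have r1: "(\<lambda>L. real (N L - 1) / real (N L)) \<longlonglongrightarrow> 1"
  proof -
    have "(\<lambda>L. 1 / real (N L)) \<longlonglongrightarrow> 0"
      by (rule real_tendsto_divide_at_top[OF tendsto_const]) (rule filterlim_compose[OF filterlim_real_sequentially N])
    then have "(\<lambda>L. 1 - 1 / real (N L)) \<longlonglongrightarrow> 1 - 0" by (intro tendsto_intros)
    moreover have "\<forall>\<^sub>F L in sequentially. 1 - 1 / real (N L) = real (N L - 1) / real (N L)"
      using ev by eventually_elim (simp add: field_simps of_nat_diff)
    ultimately show ?thesis by (simp add: Lim_transform_eventually)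
  qed
  have "(\<lambda>L. shifted_power_sum (N L) (pos_part (lam L)) k / real (N L) ^ k
        + (-1) ^ k * (\<Sum>r=1..k. real (k choose r) * (real (N L - 1) / real (N L)) ^ (k - r)
             * (shifted_power_sum (N L) (neg_part (lam L)) r / real (N L) ^ r)))
      \<longlonglongrightarrow> half_power_sum (alpha_p \<omega>) (beta_p \<omega>) (gamma_p \<omega>) k
        + (-1) ^ k * (\<Sum>r=1..k. real (k choose r) * 1 ^ (k - r) * half_power_sum (alpha_m \<omega>) (beta_m \<omega>) (gamma_m \<omega>) r)"
    by (intro tendsto_intros p n k r1) auto
  also have "half_power_sum (alpha_p \<omega>) (beta_p \<omega>) (gamma_p \<omega>) k
        + (-1) ^ k * (\<Sum>r=1..k. real (k choose r) * 1 ^ (k - r) * half_power_sum (alpha_m \<omega>) (beta_m \<omega>) (gamma_m \<omega>) r)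
      = omega_power_sum \<omega> k" by (simp add: omega_power_sum_def)
  finally have lim: "(\<lambda>L. shifted_power_sum (N L) (pos_part (lam L)) k / real (N L) ^ k
        + (-1) ^ k * (\<Sum>r=1..k. real (k choose r) * (real (N L - 1) / real (N L)) ^ (k - r)
             * (shifted_power_sum (N L) (neg_part (lam L)) r / real (N L) ^ r))) \<longlonglongrightarrow> omega_power_sum \<omega> k" .
  have "\<forall>\<^sub>F L in sequentially. shifted_power_sum (N L) (pos_part (lam L)) k / real (N L) ^ k
        + (-1) ^ k * (\<Sum>r=1..k. real (k choose r) * (real (N L - 1) / real (N L)) ^ (k - r)
             * (shifted_power_sum (N L) (neg_part (lam L)) r / real (N L) ^ r))
      = (\<Sum>i<N L. (real_of_int (lam L ! i) - real i) ^ k - (- real i) ^ k) / real (N L) ^ k"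
    using ev
  proof eventually_elim
    case (elim L)
    have "(\<Sum>r=1..k. real (k choose r) * (real (N L - 1) / real (N L)) ^ (k - r)
             * (shifted_power_sum (N L) (neg_part (lam L)) r / real (N L) ^ r))
        = (\<Sum>r=1..k. real (k choose r) * real (N L - 1) ^ (k - r) * shifted_power_sum (N L) (neg_part (lam L)) r) / real (N L) ^ k"
      unfolding sum_divide_distrib
    proof (intro sum.cong refl)
      fix r assume "r \<in> {1..k}"
      then have "real (N L) ^ k = real (N L) ^ (k - r) * real (N L) ^ r" by (simp flip: power_add)
      then show "real (k choose r) * (real (N L - 1) / real (N L)) ^ (k - r)
             * (shifted_power_sum (N L) (neg_part (lam L)) r / real (N L) ^ r)
          = real (k choose r) * real (N L - 1) ^ (k - r) * shifted_power_sum (N L) (neg_part (lam L)) r / real (N L) ^ k"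
        by (simp add: power_divide)
    qed
    also have "(\<Sum>r=1..k. real (k choose r) * real (N L - 1) ^ (k - r) * shifted_power_sum (N L) (neg_part (lam L)) r)
        = (\<Sum>r\<le>k. real (k choose r) * real (N L - 1) ^ (k - r) * shifted_power_sum (N L) (neg_part (lam L)) r)"
      by (rule sum.mono_neutral_left) (auto simp: shifted_power_sum_def not_less_eq_eq)
    finally show ?case
      using signature_power_sum[OF lam[of L], of k] elim by (simp add: add_divide_distrib)
  qed
  with lim show ?thesis by (rule Lim_transform_eventually)
qed

section \<open>The generating function of a parameter\<close>

lemma fps_logderiv_of_deriv:
  assumes f: "f has_fps_expansion F" and g: "g has_fps_expansion G"
    and "\<forall>\<^sub>F x in nhds 0. deriv f x = f x * g x"
  shows "fps_logderiv F G"
proof -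
  have "deriv f has_fps_expansion fps_deriv F" by (rule has_fps_expansion_deriv[OF f])
  then have "(\<lambda>x. f x * g x) has_fps_expansion fps_deriv F"
    using has_fps_expansion_cong[OF assms(3) refl] by blast
  then show ?thesis
    using fps_expansion_unique_complex has_fps_expansion_mult[OF f g] unfolding fps_logderiv_def by blast
qed

lemma has_fps_expansion_linear: "(\<lambda>x. 1 + c * x) has_fps_expansion (1 + fps_const c * fps_X :: complex fps)"
  by (intro fps_expansion_intros)

text \<open>
  The \<open>j\<close>-th factor of \<open>\<Phi>(1 + x)\<close>; the part in \<open>z\<^sup>-\<^sup>1\<close> is simplified by
  \<open>1 + d ((1 + x)\<^sup>-\<^sup>1 - 1) = (1 + (1 - d) x) / (1 + x)\<close>.
\<close>

definition phi_factor :: "real \<Rightarrow> real \<Rightarrow> real \<Rightarrow> real \<Rightarrow> complex \<Rightarrow> complex" where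
  "phi_factor a b c d x = ((1 + of_real b * x) * (1 + of_real (1 - d) * x))
      / ((1 + of_real (- a) * x) * (1 + of_real (1 + c) * x))"

text \<open>The coefficient of \<open>x^(k - 1)\<close> in the logarithmic derivative of
  \<open>phi_factor\<close>.\<close>

definition phi_log_coeff :: "real \<Rightarrow> real \<Rightarrow> real \<Rightarrow> real \<Rightarrow> nat \<Rightarrow> real" where
  "phi_log_coeff a b c d k = (a ^ k - (- b) ^ k) + (-1) ^ k * ((1 + c) ^ k - (1 - d) ^ k)"

lemma one_plus_ge:
  assumes "cmod (of_real t * x) \<le> 1 / 4" shows "3 / 4 \<le> cmod (1 + of_real t * x)"
  using norm_triangle_ineq2[of 1 "- (of_real t * x)"] assms by simp

text \<open>The radius makes each linear term at most \<open>1/4\<close> in modulus, so the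
  denominator is at least \<open>(3/4)^2 > 1/2\<close>. In the difference of numerator and
  denominator the parameter-free part \<open>1 + x\<close> cancels; the rest is bounded by a
  multiple of \<open>a + b + c + d\<close>, which is summable over the factors.\<close>

lemma phi_factor_bounds:
  fixes a b c d A :: real and x :: complex
  assumes nn: "0 \<le> a" "0 \<le> b" "0 \<le> c" "0 \<le> d" and le: "a \<le> A" "b \<le> A" "c \<le> A" "d \<le> A"
    and x: "cmod x \<le> 1 / (4 * (1 + A))"
  shows "1 + of_real b * x \<noteq> 0" "1 + of_real (1 - d) * x \<noteq> 0"
    "1 + of_real (- a) * x \<noteq> 0" "1 + of_real (1 + c) * x \<noteq> 0"
    "cmod (phi_factor a b c d x - 1) \<le> a + b + c + d"
proof -
  have A: "0 \<le> A" using nn le by linarith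
  have small: "cmod (of_real t * x) \<le> 1 / 4" if "\<bar>t\<bar> \<le> 1 + A" for t
  proof -
    have "\<bar>t\<bar> * cmod x \<le> (1 + A) * (1 / (4 * (1 + A)))" using that x A by (intro mult_mono) auto
    also have "\<dots> = 1 / 4" using A by (simp add: field_simps)
    finally show ?thesis by (simp add: norm_mult)
  qed
  have bnd: "3 / 4 \<le> cmod (1 + of_real b * x)" "3 / 4 \<le> cmod (1 + of_real (1 - d) * x)"
    "3 / 4 \<le> cmod (1 + of_real (- a) * x)" "3 / 4 \<le> cmod (1 + of_real (1 + c) * x)"
    by (rule one_plus_ge[OF small], use nn le in linarith)+
  then show nz: "1 + of_real b * x \<noteq> 0" "1 + of_real (1 - d) * x \<noteq> 0"
    "1 + of_real (- a) * x \<noteq> 0" "1 + of_real (1 + c) * x \<noteq> 0" by auto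
  define D where "D = (1 + of_real (- a) * x) * (1 + of_real (1 + c) * x)"
  have Dn: "1 / 2 \<le> cmod D"
    using mult_mono[OF bnd(3,4)] by (simp add: D_def norm_mult)
  have "phi_factor a b c d x - 1 = x * (of_real (a + b - c - d) + (of_real (b * (1 - d) + a * (1 + c))) * x) / D"
  proof -
    have "phi_factor a b c d x - 1 = ((1 + of_real b * x) * (1 + of_real (1 - d) * x) - D) / D"
    proof -
      have "D \<noteq> 0" using Dn by auto
      then show ?thesis
        unfolding phi_factor_def D_def[symmetric] by (simp add: diff_divide_distrib)
    qed
    also have "(1 + of_real b * x) * (1 + of_real (1 - d) * x) - D
        = x * (of_real (a + b - c - d) + (of_real (b * (1 - d) + a * (1 + c))) * x)"
      by (simp add: D_def algebra_simps)
    finally show ?thesis .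
  qed
  moreover have "cmod (x * (of_real (a + b - c - d) + (of_real (b * (1 - d) + a * (1 + c))) * x)) \<le> (a + b + c + d) / 2"
  proof -
    have x1: "cmod x \<le> 1 / 4" using small[of 1] A by simp
    have "cmod (of_real (b * (1 - d) + a * (1 + c)) * x) \<le> b * cmod (of_real (1 - d) * x) + a * cmod (of_real (1 + c) * x)"
    proof -
      have "of_real (b * (1 - d) + a * (1 + c)) * x = of_real b * (of_real (1 - d) * x) + of_real a * (of_real (1 + c) * x)"
        by (simp add: algebra_simps)
      moreover have "cmod (of_real b * (of_real (1 - d) * x)) = b * cmod (of_real (1 - d) * x)"
        "cmod (of_real a * (of_real (1 + c) * x)) = a * cmod (of_real (1 + c) * x)"
        using nn by (simp_all only: norm_mult norm_of_real abs_of_nonneg)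
      ultimately show ?thesis by (metis norm_triangle_ineq)
    qed
    also have "\<dots> \<le> b * (1 / 4) + a * (1 / 4)"
      using nn le by (intro add_mono mult_left_mono small) auto
    finally have 1: "cmod (of_real (b * (1 - d) + a * (1 + c)) * x) \<le> (a + b) / 4" by simp
    have "cmod (of_real (a + b - c - d) :: complex) \<le> a + b + c + d"
      unfolding norm_of_real using nn by linarith
    with 1 have "cmod (of_real (a + b - c - d) + (of_real (b * (1 - d) + a * (1 + c))) * x) \<le> (a + b + c + d) + (a + b) / 4"
      by (intro norm_triangle_le) linarith
    also have "\<dots> \<le> 2 * (a + b + c + d)" using nn by (simp add: field_simps)
    finally have "cmod x * cmod (of_real (a + b - c - d) + (of_real (b * (1 - d) + a * (1 + c))) * x) \<le> 1 / 4 * (2 * (a + b + c + d))"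
      using x1 by (intro mult_mono) auto
    then show ?thesis by (simp add: norm_mult)
  qed
  ultimately have "cmod (phi_factor a b c d x - 1) \<le> ((a + b + c + d) / 2) / (1 / 2)"
    unfolding norm_divide using Dn nn by (simp only: norm_divide) (intro frac_le, auto)
  then show "cmod (phi_factor a b c d x - 1) \<le> a + b + c + d" by simp
qed

lemma phi_factor_logderiv:
  obtains F where "phi_factor a b c d has_fps_expansion F"
    "fps_logderiv F (Abs_fps (\<lambda>n. of_real (phi_log_coeff a b c d (Suc n))))"
proof -
  let ?l = "\<lambda>c :: real. 1 + fps_const (of_real c) * fps_X :: complex fps"
  let ?F = "(?l b * ?l (1 - d)) * inverse (?l (- a) * ?l (1 + c))"
  have n0: "fps_nth (?l (- a) * ?l (1 + c)) 0 \<noteq> 0" by (simp add: fps_mult_nth_0)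
  have "phi_factor a b c d = (\<lambda>x. ((1 + of_real b * x) * (1 + of_real (1 - d) * x))
      * inverse ((1 + of_real (- a) * x) * (1 + of_real (1 + c) * x)))"
    by (simp add: phi_factor_def divide_inverse fun_eq_iff)
  then have 1: "phi_factor a b c d has_fps_expansion ?F"
    using has_fps_expansion_mult[OF has_fps_expansion_mult[OF has_fps_expansion_linear[of "of_real b"] has_fps_expansion_linear[of "of_real (1 - d)"]]
        has_fps_expansion_inverse[OF has_fps_expansion_mult[OF has_fps_expansion_linear[of "of_real (- a)"] has_fps_expansion_linear[of "of_real (1 + c)"]] n0]]
    by simp
  have "?F * (?l (- a) * ?l (1 + c)) = (?l b * ?l (1 - d)) * (inverse (?l (- a) * ?l (1 + c)) * (?l (- a) * ?l (1 + c)))"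
    by (simp only: mult.assoc)
  also have "\<dots> = ?l b * ?l (1 - d)" unfolding inverse_mult_eq_1[OF n0] by simp
  finally have "fps_logderiv ?F
      ((Abs_fps (\<lambda>n. of_real b * (- of_real b) ^ n) + Abs_fps (\<lambda>n. of_real (1 - d) * (- of_real (1 - d)) ^ n))
       - (Abs_fps (\<lambda>n. of_real (- a) * (- of_real (- a)) ^ n) + Abs_fps (\<lambda>n. of_real (1 + c) * (- of_real (1 + c)) ^ n)))"
  proof (rule fps_logderiv_quotient)
    show "?l (- a) * ?l (1 + c) \<noteq> 0" using n0 by auto
  qed (intro fps_logderiv_mult fps_logderiv_linear)+
  also have "((Abs_fps (\<lambda>n. of_real b * (- of_real b) ^ n) + Abs_fps (\<lambda>n. of_real (1 - d) * (- of_real (1 - d)) ^ n))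
       - (Abs_fps (\<lambda>n. of_real (- a) * (- of_real (- a)) ^ n) + Abs_fps (\<lambda>n. of_real (1 + c) * (- of_real (1 + c)) ^ n)))
      = Abs_fps (\<lambda>n. complex_of_real (phi_log_coeff a b c d (Suc n)))"
  proof (rule fps_ext)
    fix n
    have key: "u * (- u) ^ n + p * (- p) ^ n - (t * (- t) ^ n + q * (- q) ^ n)
        = ((- t) ^ Suc n - (- u) ^ Suc n) + (- 1) ^ Suc n * (q ^ Suc n - p ^ Suc n)" for t u p q :: complex
      by (simp add: power_minus[of p] power_minus[of q] algebra_simps)
    show "fps_nth ((Abs_fps (\<lambda>n. of_real b * (- of_real b) ^ n) + Abs_fps (\<lambda>n. of_real (1 - d) * (- of_real (1 - d)) ^ n))
       - (Abs_fps (\<lambda>n. of_real (- a) * (- of_real (- a)) ^ n) + Abs_fps (\<lambda>n. of_real (1 + c) * (- of_real (1 + c)) ^ n))) n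
      = fps_nth (Abs_fps (\<lambda>n. complex_of_real (phi_log_coeff a b c d (Suc n)))) n"
      unfolding fps_add_nth fps_sub_nth fps_nth_Abs_fps key by (simp add: phi_log_coeff_def)
  qed
  finally show ?thesis using that 1 by blast
qed


section \<open>From single factors to the infinite product\<close>

context
  fixes \<omega> :: vk_param
  assumes \<omega>: "\<omega> \<in> Omega"
begin

definition omega_bound :: real where
  "omega_bound = alpha_p \<omega> 0 + beta_p \<omega> 0 + alpha_m \<omega> 0 + beta_m \<omega> 0"

abbreviation omega_log_coeff :: "nat \<Rightarrow> nat \<Rightarrow> real" where
  "omega_log_coeff j \<equiv> phi_log_coeff (alpha_p \<omega> j) (beta_p \<omega> j) (alpha_m \<omega> j) (beta_m \<omega> j)"

definition omega_factor :: "nat \<Rightarrow> complex \<Rightarrow> complex" where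
  "omega_factor j = phi_factor (alpha_p \<omega> j) (beta_p \<omega> j) (alpha_m \<omega> j) (beta_m \<omega> j)"

lemma omega_nonneg: "0 \<le> alpha_p \<omega> j" "0 \<le> beta_p \<omega> j" "0 \<le> alpha_m \<omega> j" "0 \<le> beta_m \<omega> j"
  using \<omega> by (auto simp: Omega_def)

lemma omega_le_bound:
  "alpha_p \<omega> j \<le> omega_bound" "beta_p \<omega> j \<le> omega_bound"
  "alpha_m \<omega> j \<le> omega_bound" "beta_m \<omega> j \<le> omega_bound"
proof -
  have "antimono (alpha_p \<omega>)" "antimono (beta_p \<omega>)" "antimono (alpha_m \<omega>)" "antimono (beta_m \<omega>)"
    using \<omega> by (auto simp: Omega_def)
  from this[THEN antimonoD, of 0 j]
  have "alpha_p \<omega> j \<le> alpha_p \<omega> 0" "beta_p \<omega> j \<le> beta_p \<omega> 0" "alpha_m \<omega> j \<le> alpha_m \<omega> 0" "beta_m \<omega> j \<le> beta_m \<omega> 0"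
    by auto
  with omega_nonneg[of 0] show "alpha_p \<omega> j \<le> omega_bound" "beta_p \<omega> j \<le> omega_bound"
    "alpha_m \<omega> j \<le> omega_bound" "beta_m \<omega> j \<le> omega_bound"
    by (auto simp: omega_bound_def)
qed

lemma omega_summable:
  "summable (alpha_p \<omega>)" "summable (beta_p \<omega>)" "summable (alpha_m \<omega>)" "summable (beta_m \<omega>)"
proof -
  have s: "summable (\<lambda>i. alpha_p \<omega> i + beta_p \<omega> i)" "summable (\<lambda>i. alpha_m \<omega> i + beta_m \<omega> i)"
    using \<omega> by (auto simp: Omega_def)
  show "summable (alpha_p \<omega>)" "summable (beta_p \<omega>)"
    by (rule summable_comparison_test'[OF s(1)], simp add: omega_nonneg)+
  show "summable (alpha_m \<omega>)" "summable (beta_m \<omega>)"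
    by (rule summable_comparison_test'[OF s(2)], simp add: omega_nonneg)+
qed

lemma summable_power_le:
  fixes a :: "nat \<Rightarrow> real"
  assumes "summable a" "\<And>j. 0 \<le> a j" "\<And>j. a j \<le> C"
  shows "summable (\<lambda>j. a j ^ Suc k)"
proof (rule summable_comparison_test')
  show "summable (\<lambda>j. C ^ k * a j)" using assms(1) by (rule summable_mult)
  show "norm (a j ^ Suc k) \<le> C ^ k * a j" for j
  proof -
    have "a j ^ k * a j \<le> C ^ k * a j" using assms(2,3)[of j] by (intro mult_right_mono power_mono) auto
    then show ?thesis using assms(2)[of j] by (simp add: mult.commute)
  qed
qed

lemma summable_half:
  assumes "k > 0"
  shows "summable (\<lambda>j. alpha_p \<omega> j ^ k - (- beta_p \<omega> j) ^ k)" "summable (\<lambda>j. alpha_m \<omega> j ^ k - (- beta_m \<omega> j) ^ k)"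
proof -
  obtain k' where k: "k = Suc k'" using assms by (cases k) auto
  have m: "(- t) ^ k = (- 1) ^ k * t ^ k" for t :: real by (rule power_minus)
  show "summable (\<lambda>j. alpha_p \<omega> j ^ k - (- beta_p \<omega> j) ^ k)"
    unfolding m[of "beta_p \<omega> _"] unfolding k
    by (intro summable_diff summable_mult summable_power_le[where C = omega_bound] omega_summable omega_nonneg omega_le_bound)
  show "summable (\<lambda>j. alpha_m \<omega> j ^ k - (- beta_m \<omega> j) ^ k)"
    unfolding m[of "beta_m \<omega> _"] unfolding k
    by (intro summable_diff summable_mult summable_power_le[where C = omega_bound] omega_summable omega_nonneg omega_le_bound)
qed

text \<open>The binomial expansion of \<open>(1 + c)^k - (1 - d)^k\<close> reproduces the sum over
  \<open>r\<close> in \<open>omega_power_sum\<close>. What is subtracted are the contributions of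
  \<open>gamma_p\<close> and \<open>gamma_m\<close>, the latter from \<open>r = 1\<close> with
  binomial coefficient \<open>k\<close>; the factors themselves do not see them.\<close>

lemma phi_log_coeff_sums:
  assumes k: "k > 0"
  shows "(\<lambda>j. omega_log_coeff j k)
    sums (omega_power_sum \<omega> k - (if k = 1 then gamma_p \<omega> else 0) - (-1) ^ k * real k * gamma_m \<omega>)"
proof -
  have bin: "(1 + c) ^ k - (1 - d) ^ k = (\<Sum>r=1..k. real (k choose r) * (c ^ r - (- d) ^ r))" for c d :: real
  proof -
    have "(c + 1) ^ k - (- d + 1) ^ k = (\<Sum>r\<le>k. real (k choose r) * (c ^ r - (- d) ^ r))"
      unfolding binomial_ring sum_subtractf[symmetric] by (intro sum.cong refl) (simp add: algebra_simps)
    also have "\<dots> = (\<Sum>r=1..k. real (k choose r) * (c ^ r - (- d) ^ r))"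
      by (rule sum.mono_neutral_right) (auto simp: not_less_eq_eq)
    finally show ?thesis by (simp add: add.commute)
  qed
  let ?m = "\<lambda>r j. alpha_m \<omega> j ^ r - (- beta_m \<omega> j) ^ r"
  have "(\<lambda>j. (alpha_p \<omega> j ^ k - (- beta_p \<omega> j) ^ k) + (-1) ^ k * (\<Sum>r=1..k. real (k choose r) * ?m r j))
      sums (suminf (\<lambda>j. alpha_p \<omega> j ^ k - (- beta_p \<omega> j) ^ k) + (-1) ^ k * (\<Sum>r=1..k. real (k choose r) * suminf (?m r)))"
    by (intro sums_add sums_mult sums_sum summable_sums summable_half) (use k in auto)
  moreover have "(\<Sum>r=1..k. real (k choose r) * suminf (?m r))
      = (\<Sum>r=1..k. real (k choose r) * half_power_sum (alpha_m \<omega>) (beta_m \<omega>) (gamma_m \<omega>) r) - real k * gamma_m \<omega>"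
  proof -
    have "(\<Sum>r=1..k. real (k choose r) * half_power_sum (alpha_m \<omega>) (beta_m \<omega>) (gamma_m \<omega>) r)
        = (\<Sum>r=1..k. real (k choose r) * suminf (?m r)) + (\<Sum>r=1..k. if r = 1 then real k * gamma_m \<omega> else 0)"
      unfolding sum.distrib[symmetric]
      by (intro sum.cong refl) (simp add: half_power_sum_def distrib_left)
    also have "(\<Sum>r=1..k. if r = 1 then real k * gamma_m \<omega> else 0) = real k * gamma_m \<omega>"
      using k by (subst sum.delta) auto
    finally show ?thesis by simp
  qed
  moreover have "suminf (\<lambda>j. alpha_p \<omega> j ^ k - (- beta_p \<omega> j) ^ k)
        + (-1) ^ k * ((\<Sum>r=1..k. real (k choose r) * half_power_sum (alpha_m \<omega>) (beta_m \<omega>) (gamma_m \<omega>) r) - real k * gamma_m \<omega>)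
      = omega_power_sum \<omega> k - (if k = 1 then gamma_p \<omega> else 0) - (-1) ^ k * real k * gamma_m \<omega>"
    by (simp add: omega_power_sum_def half_power_sum_def[of "alpha_p \<omega>"] right_diff_distrib mult.assoc)
  ultimately show ?thesis by (simp only: phi_log_coeff_def bin)
qed

text \<open>The M-test gives uniform convergence on the closed disc, and absolute convergence at
  each point identifies the limit with \<open>prodinf\<close>.\<close>

lemma factor_converge:
  defines "r \<equiv> 1 / (4 * (1 + omega_bound))"
  obtains Q where "uniform_limit (cball 0 r) (\<lambda>J x. \<Prod>j<J. omega_factor j x) Q sequentially"
    "\<And>x. x \<in> cball 0 r \<Longrightarrow> prodinf (\<lambda>j. omega_factor j x) = Q x"
proof -
  let ?M = "\<lambda>j. alpha_p \<omega> j + beta_p \<omega> j + alpha_m \<omega> j + beta_m \<omega> j"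
  have M: "summable ?M" by (intro summable_add omega_summable)
  note fb = phi_factor_bounds[OF omega_nonneg omega_le_bound]
  have bd: "norm (norm (omega_factor j x - 1)) \<le> ?M j" if "x \<in> cball 0 r" for j x
    using fb(5)[of x j] that by (simp add: omega_factor_def r_def)
  have "uniformly_convergent_on (cball 0 r) (\<lambda>J x. \<Prod>j<J. omega_factor j x)"
  proof (rule uniformly_convergent_on_prod')
    show "continuous_on (cball 0 r) (omega_factor j)" for j
      unfolding omega_factor_def phi_factor_def using fb(3,4)[of _ j]
      by (intro continuous_intros) (auto simp: r_def)
    show "uniformly_convergent_on (cball 0 r) (\<lambda>J x. \<Sum>j<J. norm (omega_factor j x - 1))"
      by (rule Weierstrass_m_test'[OF bd M])
  qed auto
  then obtain Q where Q: "uniform_limit (cball 0 r) (\<lambda>J x. \<Prod>j<J. omega_factor j x) Q sequentially"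
    by (auto simp: uniformly_convergent_on_def)
  have "prodinf (\<lambda>j. omega_factor j x) = Q x" if x: "x \<in> cball 0 r" for x
  proof -
    have "summable (\<lambda>j. norm (omega_factor j x - 1))"
      by (rule summable_comparison_test'[OF M]) (rule bd[OF x])
    then have "convergent_prod (\<lambda>j. omega_factor j x)"
      by (intro abs_convergent_prod_imp_convergent_prod summable_imp_abs_convergent_prod)
    then have "(\<lambda>J. \<Prod>j\<le>J. omega_factor j x) \<longlonglongrightarrow> prodinf (\<lambda>j. omega_factor j x)"
      by (rule convergent_prod_LIMSEQ)
    moreover have "(\<lambda>J. \<Prod>j<Suc J. omega_factor j x) \<longlonglongrightarrow> Q x"
      using tendsto_uniform_limitI[OF Q x] by (rule LIMSEQ_Suc)
    ultimately show ?thesis unfolding lessThan_Suc_atMost by (rule LIMSEQ_unique)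
  qed
  then show ?thesis using that Q by blast
qed

text \<open>Finite products satisfy the identity exactly. Uniform convergence of holomorphic
  functions entails convergence of every Taylor coefficient, so \<open>f' = f L\<close> passes to
  the limit coefficient by coefficient.\<close>

lemma factor_product_logderiv:
  obtains Q F where "Q has_fps_expansion F" "fps_nth F 0 = 1"
    "\<forall>\<^sub>F x in nhds 0. prodinf (\<lambda>j. omega_factor j x) = Q x"
    "fps_logderiv F (Abs_fps (\<lambda>n. of_real (omega_power_sum \<omega> (Suc n) - (if n = 0 then gamma_p \<omega> else 0)
        - (-1) ^ Suc n * real (Suc n) * gamma_m \<omega>)))"
proof -
  define r where "r = 1 / (4 * (1 + omega_bound))"
  have r: "r > 0" using omega_nonneg[of 0] by (simp add: r_def omega_bound_def add_nonneg_nonneg add_pos_nonneg)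
  obtain Q where Q: "uniform_limit (cball 0 r) (\<lambda>J x. \<Prod>j<J. omega_factor j x) Q sequentially"
    "\<And>x. x \<in> cball 0 r \<Longrightarrow> prodinf (\<lambda>j. omega_factor j x) = Q x"
    using factor_converge unfolding r_def by blast
  have Qb: "uniform_limit (ball 0 r) (\<lambda>J x. \<Prod>j<J. omega_factor j x) Q sequentially"
    by (rule uniform_limit_on_subset[OF Q(1)]) auto
  note fb = phi_factor_bounds[OF omega_nonneg omega_le_bound]
  have hol: "(\<lambda>x. \<Prod>j<J. omega_factor j x) holomorphic_on ball 0 r" for J
    unfolding omega_factor_def phi_factor_def using fb(3,4)
    by (intro holomorphic_intros) (auto simp: r_def)
  have Qhol: "Q holomorphic_on ball 0 r"
  proof (rule holomorphic_uniform_sequence[OF open_ball hol])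
    fix x assume x: "x \<in> ball (0::complex) r"
    then obtain d where "d > 0" "cball x d \<subseteq> ball 0 r" using open_contains_cball[of "ball 0 r"] by blast
    then show "\<exists>d>0. cball x d \<subseteq> ball 0 r \<and> uniform_limit (cball x d) (\<lambda>J x. \<Prod>j<J. omega_factor j x) Q sequentially"
      using uniform_limit_on_subset[OF Qb] by blast
  qed
  have "\<exists>G. omega_factor j has_fps_expansion G \<and> fps_logderiv G (Abs_fps (\<lambda>n. of_real
        (omega_log_coeff j (Suc n))))" for j
    unfolding omega_factor_def by (rule phi_factor_logderiv) blast
  then have "\<exists>G. \<forall>j. omega_factor j has_fps_expansion G j \<and> fps_logderiv (G j) (Abs_fps (\<lambda>n. of_real
        (omega_log_coeff j (Suc n))))"
    by (intro choice allI)
  then obtain G where G: "\<And>j. omega_factor j has_fps_expansion G j"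
    "\<And>j. fps_logderiv (G j) (Abs_fps (\<lambda>n. of_real
        (omega_log_coeff j (Suc n))))"
    by blast
  define L where "L = (\<lambda>J n. \<Sum>j<J. omega_log_coeff j (Suc n))"
  define l where "l = (\<lambda>n. omega_power_sum \<omega> (Suc n) - (if n = 0 then gamma_p \<omega> else 0) - (-1) ^ Suc n * real (Suc n) * gamma_m \<omega>)"
  have GJ: "(\<lambda>x. \<Prod>j<J. omega_factor j x) has_fps_expansion (\<Prod>j<J. G j)" for J
    by (intro has_fps_expansion_prod G)
  have LJ: "fps_logderiv (\<Prod>j<J. G j) (Abs_fps (\<lambda>n. of_real (L J n)))" for J
  proof -
    have "(\<Sum>j<J. Abs_fps (\<lambda>n. complex_of_real (omega_log_coeff j (Suc n))))
        = Abs_fps (\<lambda>n. of_real (L J n))"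
      by (rule fps_ext) (simp add: fps_sum_nth L_def)
    then show ?thesis using fps_logderiv_prod[of "{..<J}" G, OF G(2)] by simp
  qed
  define F where "F = fps_expansion Q 0"
  have QF: "Q has_fps_expansion F"
    unfolding F_def using r by (intro has_fps_expansion_fps_expansion[OF open_ball _ Qhol]) auto
  have lim: "(\<lambda>J. fps_nth (\<Prod>j<J. G j) n) \<longlonglongrightarrow> fps_nth F n" for n
  proof -
    have "(\<lambda>J. (deriv ^^ n) (\<lambda>x. \<Prod>j<J. omega_factor j x) 0) \<longlonglongrightarrow> (deriv ^^ n) Q 0"
      using r hol by (intro higher_deriv_complex_uniform_limit[OF Qb]) auto
    then have "(\<lambda>J. (deriv ^^ n) (\<lambda>x. \<Prod>j<J. omega_factor j x) 0 / fact n) \<longlonglongrightarrow> (deriv ^^ n) Q 0 / fact n"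
      by (intro tendsto_intros) auto
    moreover have "fps_nth (\<Prod>j<J. G j) n = (deriv ^^ n) (\<lambda>x. \<Prod>j<J. omega_factor j x) 0 / fact n" for J
      unfolding fps_expansion_eqI[OF GJ, symmetric] fps_expansion_def by simp
    moreover have "fps_nth F n = (deriv ^^ n) Q 0 / fact n" by (simp add: F_def fps_expansion_def)
    ultimately show ?thesis by simp
  qed
  have Llim: "(\<lambda>J. complex_of_real (L J n)) \<longlonglongrightarrow> of_real (l n)" for n
    using phi_log_coeff_sums[of "Suc n"] by (intro tendsto_of_real) (simp add: sums_def L_def l_def)
  have "fps_logderiv F (Abs_fps (\<lambda>n. of_real (l n)))"
    unfolding fps_logderiv_def
  proof (rule fps_ext)
    fix n
    have "(\<lambda>J. fps_nth (fps_deriv (\<Prod>j<J. G j)) n) \<longlonglongrightarrow> fps_nth (fps_deriv F) n"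
      unfolding fps_deriv_nth by (intro tendsto_intros lim)
    moreover have "(\<lambda>J. fps_nth ((\<Prod>j<J. G j) * Abs_fps (\<lambda>n. of_real (L J n))) n)
        \<longlonglongrightarrow> fps_nth (F * Abs_fps (\<lambda>n. of_real (l n))) n"
      unfolding fps_mult_nth fps_nth_Abs_fps by (intro tendsto_sum tendsto_mult lim Llim)
    ultimately show "fps_nth (fps_deriv F) n = fps_nth (F * Abs_fps (\<lambda>n. of_real (l n))) n"
      unfolding LJ[unfolded fps_logderiv_def] by (rule LIMSEQ_unique)
  qed
  moreover have "fps_nth F 0 = 1"
  proof -
    have "fps_nth (G j) 0 = 1" for j
      using has_fps_expansion_imp_0_eq_fps_nth_0[OF G(1)[of j]] by (simp add: omega_factor_def phi_factor_def)
    then have "(\<lambda>J. fps_nth (\<Prod>j<J. G j) 0) = (\<lambda>J. 1)" by (simp add: fps_nth_0_prod)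
    then show ?thesis using LIMSEQ_unique[OF lim[of 0]] by auto
  qed
  moreover have "\<forall>\<^sub>F x in nhds 0. prodinf (\<lambda>j. omega_factor j x) = Q x"
    unfolding eventually_nhds using r Q(2) by (intro exI[of _ "ball 0 r"]) auto
  ultimately show ?thesis using that QF unfolding l_def by blast
qed

text \<open>The exponential factor supplies the missing \<open>\<gamma>\<close> terms: its
  logarithmic derivative is \<open>gamma_p\<close> plus \<open>gamma_m\<close> times the derivative
  of \<open>1 / (1 + x)\<close>, whose coefficient at \<open>x^n\<close> is
  \<open>(-1)^(n + 1) (n + 1)\<close>.\<close>

lemma h_coeff_newton:
  defines "h \<equiv> \<lambda>k. fps_nth (fps_expansion (\<lambda>x. Phi \<omega> (1 + x)) 0) k"
  shows "h 0 = 1" "of_nat (Suc k) * h (Suc k) = (\<Sum>j\<le>k. h j * of_real (omega_power_sum \<omega> (Suc (k - j))))"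
proof -
  obtain Q F where Q: "Q has_fps_expansion F" "fps_nth F 0 = 1"
    "\<forall>\<^sub>F x in nhds 0. prodinf (\<lambda>j. omega_factor j x) = Q x"
    "fps_logderiv F (Abs_fps (\<lambda>n. of_real (omega_power_sum \<omega> (Suc n) - (if n = 0 then gamma_p \<omega> else 0)
        - (-1) ^ Suc n * real (Suc n) * gamma_m \<omega>)))"
    by (rule factor_product_logderiv)
  let ?gp = "complex_of_real (gamma_p \<omega>)" and ?gm = "complex_of_real (gamma_m \<omega>)"
  define E where "E = (\<lambda>x. exp (?gp * x + ?gm * (inverse (1 + x) - 1)))"
  define I where "I = Abs_fps (\<lambda>n. (- 1 :: complex) ^ n)"
  have nz: "1 + x \<noteq> 0" if "x \<in> ball (0::complex) 1" for x
    using that by (metis add_eq_0_iff dist_0_norm less_irrefl mem_ball norm_minus_cancel norm_one)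
  have Ehol: "E holomorphic_on ball 0 1"
    unfolding E_def using nz by (intro holomorphic_intros) auto
  define Ef where "Ef = fps_expansion E 0"
  have EF: "E has_fps_expansion Ef"
    unfolding Ef_def by (intro has_fps_expansion_fps_expansion[OF open_ball _ Ehol]) auto
  have If: "(\<lambda>x. inverse (1 + x)) has_fps_expansion I"
  proof -
    have 1: "(\<lambda>x. inverse (1 + x)) has_fps_expansion inverse (1 + fps_X :: complex fps)"
      by (intro fps_expansion_intros) auto
    have "I * (1 + fps_X) = 1"
    proof -
      have "fps_const (- 1) = (- 1 :: complex fps)" by (metis fps_const_1_eq_1 fps_const_neg)
      from fps_geometric[of "-1", unfolded this] show ?thesis by (simp add: I_def)
    qed
    then have "inverse (1 + fps_X) = I"
      by (metis fps_inverse_unique fps_inverse_idempotent fps_mult_nth_0 fps_one_nth mult_zero_left zero_neq_one mult.commute)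
    with 1 show ?thesis by simp
  qed
  have ld: "fps_logderiv Ef (fps_const ?gp + fps_const ?gm * fps_deriv I)"
  proof (rule fps_logderiv_of_deriv[OF EF])
    show "(\<lambda>x. ?gp + ?gm * deriv (\<lambda>x. inverse (1 + x)) x) has_fps_expansion (fps_const ?gp + fps_const ?gm * fps_deriv I)"
      by (intro fps_expansion_intros has_fps_expansion_deriv If)
    show "\<forall>\<^sub>F x in nhds 0. deriv E x = E x * (?gp + ?gm * deriv (\<lambda>x. inverse (1 + x)) x)"
      unfolding eventually_nhds
    proof (intro exI[of _ "ball 0 1"] conjI ballI)
      fix x :: complex assume x: "x \<in> ball 0 1"
      have d: "((\<lambda>x. inverse (1 + x)) has_field_derivative - (inverse (1 + x) * inverse (1 + x))) (at x)"
        using nz[OF x] by (auto intro!: derivative_eq_intros)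
      have "(E has_field_derivative E x * (?gp + ?gm * - (inverse (1 + x) * inverse (1 + x)))) (at x)"
      proof -
        have "((\<lambda>x. ?gp * x + ?gm * (inverse (1 + x) - 1)) has_field_derivative
            ?gp * 1 + ?gm * (- (inverse (1 + x) * inverse (1 + x)) - 0)) (at x)"
          by (intro DERIV_add DERIV_cmult DERIV_ident DERIV_diff DERIV_const d)
        from DERIV_fun_exp[OF this] show ?thesis by (simp only: E_def mult_1_right diff_zero)
      qed
      then show "deriv E x = E x * (?gp + ?gm * deriv (\<lambda>x. inverse (1 + x)) x)"
        using DERIV_imp_deriv[OF d] by (simp add: DERIV_imp_deriv)
    qed auto
  qed
  have prod: "(\<lambda>x. E x * Q x) has_fps_expansion (Ef * F)" by (rule has_fps_expansion_mult[OF EF Q(1)])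
  have ev: "\<forall>\<^sub>F x in nhds 0. Phi \<omega> (1 + x) = E x * Q x"
  proof -
    have "\<forall>\<^sub>F x in nhds 0. x \<in> ball (0::complex) 1" by (intro eventually_nhds_in_open) auto
    with Q(3) show ?thesis
    proof eventually_elim
      case (elim x)
      have "(1 + of_real (beta_p \<omega> j) * x) / (1 - of_real (alpha_p \<omega> j) * x)
            * ((1 + of_real (beta_m \<omega> j) * (inverse (1 + x) - 1)) / (1 - of_real (alpha_m \<omega> j) * (inverse (1 + x) - 1)))
          = omega_factor j x" for j
      proof -
        have "1 + of_real t * (inverse (1 + x) - 1) = (1 + of_real (1 - t) * x) / (1 + x)" for t
          using nz[OF elim(2)] by (simp add: field_simps)
        from this[of "beta_m \<omega> j"] this[of "- alpha_m \<omega> j"]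
        have "(1 + of_real (beta_m \<omega> j) * (inverse (1 + x) - 1)) / (1 - of_real (alpha_m \<omega> j) * (inverse (1 + x) - 1))
            = (1 + of_real (1 - beta_m \<omega> j) * x) / (1 + of_real (1 + alpha_m \<omega> j) * x)"
          using nz[OF elim(2)] by simp
        then show ?thesis by (simp add: omega_factor_def phi_factor_def)
      qed
      then show ?case using elim(1) by (simp add: Phi_def E_def)
    qed
  qed
  have "(\<lambda>x. Phi \<omega> (1 + x)) has_fps_expansion (Ef * F)"
    unfolding has_fps_expansion_cong[OF ev refl] by (rule prod)
  then have h: "h = fps_nth (Ef * F)" unfolding h_def by (simp add: fps_expansion_eqI)
  have "fps_nth Ef 0 = 1"
    using has_fps_expansion_imp_0_eq_fps_nth_0[OF EF] by (simp add: E_def)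
  then show "h 0 = 1" by (simp add: h fps_mult_nth_0 Q(2))
  have "fps_logderiv (Ef * F) (Abs_fps (\<lambda>n. of_real (omega_power_sum \<omega> (Suc n))))"
  proof -
    have "(fps_const ?gp + fps_const ?gm * fps_deriv I) + Abs_fps (\<lambda>n. of_real (omega_power_sum \<omega> (Suc n) - (if n = 0 then gamma_p \<omega> else 0)
        - (-1) ^ Suc n * real (Suc n) * gamma_m \<omega>)) = Abs_fps (\<lambda>n. of_real (omega_power_sum \<omega> (Suc n)))"
      by (rule fps_ext) (simp add: I_def fps_nth_fps_const algebra_simps)
    then show ?thesis using fps_logderiv_mult[OF ld Q(4)] by simp
  qed
  from fps_logderiv_newton[OF this, of k]
  show "of_nat (Suc k) * h (Suc k) = (\<Sum>j\<le>k. h j * of_real (omega_power_sum \<omega> (Suc (k - j))))"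
    unfolding h by simp
qed

end

section \<open>Convergence of the moments\<close>

text \<open>A weakly decreasing signature plus the strictly decreasing \<open>N - 1 - i\<close> is
  strictly decreasing.\<close>

lemma Sign_nodes_inj:
  assumes "l \<in> Sign N"
  shows "inj_on (\<lambda>i. of_int (l ! i) + of_nat (N - 1 - i) :: complex) {..<N}"
proof (rule inj_onI)
  have len: "length l = N" and dec: "\<And>i j. i < j \<Longrightarrow> j < N \<Longrightarrow> l ! j \<le> l ! i"
    using assms sorted_wrt_nth_less[of "(\<ge>)" l] by (auto simp: Sign_def)
  fix i j assume ij: "i \<in> {..<N}" "j \<in> {..<N}"
    and eq: "of_int (l ! i) + of_nat (N - 1 - i) = (of_int (l ! j) + of_nat (N - 1 - j) :: complex)"
  have "(of_int (l ! i + int (N - 1 - i)) :: complex) = of_int (l ! j + int (N - 1 - j))" using eq by simp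
  then have "l ! i + int (N - 1 - i) = l ! j + int (N - 1 - j)" by (simp only: of_int_eq_iff)
  then show "i = j" using ij dec[of i j] dec[of j i] by (cases i j rule: linorder_cases) auto
qed

text \<open>The limiting moments and the coefficients of \<open>Phi \<omega> (1 + x)\<close> start
  at 1 and obey the same Newton recursion with \<open>omega_power_sum\<close>;
  \<open>int_seq\<close> and \<open>h_coeff\<close> extend them by 0 in the same way.\<close>

lemma shifted_schur_vershik_kerov_limit:
  assumes N: "filterlim N at_top sequentially"
    and lam: "\<And>L. L \<ge> 1 \<Longrightarrow> lam L \<in> Sign (N L)"
    and vk: "vershik_kerov N lam \<omega>" and \<omega>: "\<omega> \<in> Omega" and \<mu>: "int_partition \<mu>"
  shows "(\<lambda>L. shifted_schur (N L) \<mu> (\<lambda>i. of_int (lam L ! i)) / of_nat (N L) ^ sum_list \<mu>)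
    \<longlonglongrightarrow> schur_omega \<mu> \<omega>"
proof -
  define h where "h = (\<lambda>k. fps_nth (fps_expansion (\<lambda>x. Phi \<omega> (1 + x)) 0) k)"
  have inj: "\<forall>\<^sub>F L in sequentially. inj_on (\<lambda>i. of_int (lam L ! i) + of_nat (N L - 1 - i) :: complex) {..<N L}"
    using eventually_ge_at_top[of 1] by eventually_elim (intro Sign_nodes_inj lam)
  have p: "(\<lambda>L. (\<Sum>i<N L. (of_int (lam L ! i) - of_nat i) ^ Suc k - (- of_nat i) ^ Suc k) / of_nat (N L) ^ Suc k)
      \<longlonglongrightarrow> complex_of_real (omega_power_sum \<omega> (Suc k))" for k
    using tendsto_of_real[OF signature_power_sum_limit[OF N lam vk \<omega> zero_less_Suc[of k]], where 'a = complex]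
    by (simp del: power_Suc)
  have h0: "h 0 = 1" and hS: "of_nat (Suc k) * h (Suc k) = (\<Sum>j\<le>k. h j * complex_of_real (omega_power_sum \<omega> (Suc (k - j))))" for k
    unfolding h_def by (rule h_coeff_newton[OF \<omega>])+
  have "int_seq h = h_coeff \<omega>" by (simp add: fun_eq_iff int_seq_def h_coeff_def h_def)
  then show ?thesis
    using shifted_schur_limit[OF N refl inj p h0 hS \<mu>] by (simp add: schur_omega_def)
qed

theorem theorem3p1:
  fixes N d :: "nat \<Rightarrow> nat"
    and lam :: "nat \<Rightarrow> int list"
    and \<omega> :: vk_param
    and \<pi> :: "nat \<Rightarrow> complex Matrix.mat \<Rightarrow> complex Matrix.mat"
    and \<psi> :: "nat \<Rightarrow> complex Matrix.vec"
    and m :: nat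
    and \<mu> :: "nat \<Rightarrow> nat list"
    and S :: "nat \<Rightarrow> nat \<Rightarrow> (word \<Rightarrow>\<^sub>0 complex) set"
    and t :: real
  assumes N_pos: "\<And>L. 1 \<le> L \<Longrightarrow> 0 < N L"
    and N_mono: "strict_mono_on {1..} N"
    and N_lim: "(\<lambda>L. real L / real (N L)) \<longlonglongrightarrow> 1"
    and omega: "\<omega> \<in> Omega"
    and sign: "\<And>L. 1 \<le> L \<Longrightarrow> lam L \<in> Sign (N L)"
    and vk: "vershik_kerov N lam \<omega>"
    and irr: "\<And>L. 1 \<le> L \<Longrightarrow> irrep (N L) (lam L) (d L) (\<pi> L)"
    and unit: "\<And>L. 1 \<le> L \<Longrightarrow> \<psi> L \<in> carrier_vec (d L) \<and> \<psi> L \<bullet>c \<psi> L = 1"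
    and partitions: "\<And>i. i \<in> {1..m} \<Longrightarrow> int_partition (\<mu> i)"
    and immanants: "\<And>i L. i \<in> {1..m} \<Longrightarrow> 1 \<le> L \<Longrightarrow> length (\<mu> i) \<le> N L \<Longrightarrow>
                      quantum_immanant (N L) (\<mu> i) (S i L)"
    and t_pos: "0 < t"
  shows "(\<lambda>L. fock_expect (time_space (d L)) (state_vec (\<psi> L) (real L * t))
            (foldr (\<lambda>i T. X_tilde (N L) (d L) (\<pi> L) (\<psi> L) (\<mu> i) (S i L) (real L * t) \<circ> T)
               [1..<Suc m] id))
         \<longlonglongrightarrow> (if even m
              then \<Sum>P\<in>pair_partitions m. \<Prod>B\<in>P. complex_of_real t * (\<Prod>i\<in>B. schur_omega (\<mu> i) \<omega>)
              else 0)"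
proof -
  \<comment> \<open>A strictly increasing sequence of positive integers dominates the identity;
    hence \<open>N\<close> tends to infinity.\<close>
  have NL: "L \<le> N L" if "1 \<le> L" for L
    using that
  proof (induction L rule: dec_induct)
    case base
    then show ?case using N_pos[of 1] by simp
  next
    case (step L)
    then have "N L < N (Suc L)" using N_mono by (intro strict_mono_onD[of "{1..}" N]) auto
    then show ?case using step by linarith
  qed
  have N: "filterlim N at_top sequentially"
    by (rule filterlim_at_top_mono[OF filterlim_ident]) (use NL in \<open>auto intro: eventually_sequentiallyI[of 1]\<close>)
  define s where "s = (\<lambda>L. real L * t)"
  have s_top: "filterlim s at_top sequentially"
    unfolding s_def using t_pos by (intro filterlim_at_top_mult_tendsto_pos[OF tendsto_const] filterlim_real_sequentially)
  have sN: "(\<lambda>L. s L / real (N L)) \<longlonglongrightarrow> t"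
    using tendsto_mult[OF N_lim tendsto_const[of t]] by (simp add: s_def)
  define c where "c = (\<lambda>i L. shifted_schur (N L) (\<mu> i) (\<lambda>j. of_int (lam L ! j)))"
  have evN: "\<forall>\<^sub>F L in sequentially. 1 \<le> L \<and> (\<forall>i\<in>{1..m}. length (\<mu> i) \<le> N L)"
    by (intro eventually_conj eventually_ge_at_top eventually_ball_finite ballI
        eventually_compose_filterlim[OF eventually_ge_at_top N]) simp
  \<comment> \<open>The factor \<open>N^(- m/2)\<close> left over from the denominators is written
    as \<open>s^(- m/2) (s / N)^(m/2)\<close>: the first part normalizes the Poisson moment, the
    second tends to \<open>t^(m/2)\<close>.\<close>
  have lim: "(\<lambda>L. (\<Prod>i=1..m. c i L / of_nat (N L) ^ sum_list (\<mu> i))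
        * (poisson_central m (s L) / of_real (s L powr (m / 2))) * of_real ((s L / real (N L)) powr (m / 2)))
      \<longlonglongrightarrow> (\<Prod>i=1..m. schur_omega (\<mu> i) \<omega>) * of_nat (gauss_moment m) * of_real (t powr (m / 2))"
    unfolding c_def using t_pos
    by (intro tendsto_mult tendsto_prod poisson_central_tendsto s_top tendsto_of_real tendsto_powr sN tendsto_const
        shifted_schur_vershik_kerov_limit N sign vk omega partitions) auto
  have "\<forall>\<^sub>F L in sequentially. (\<Prod>i=1..m. c i L / of_nat (N L) ^ sum_list (\<mu> i))
        * (poisson_central m (s L) / of_real (s L powr (m / 2))) * of_real ((s L / real (N L)) powr (m / 2))
      = fock_expect (time_space (d L)) (state_vec (\<psi> L) (real L * t))
          (foldr (\<lambda>i T. X_tilde (N L) (d L) (\<pi> L) (\<psi> L) (\<mu> i) (S i L) (real L * t) \<circ> T) [1..<Suc m] id)"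
    using evN
  proof eventually_elim
    case (elim L)
    then have L: "1 \<le> L" and len: "\<And>i. i \<in> {1..m} \<Longrightarrow> length (\<mu> i) \<le> N L" by auto
    have s0: "0 < s L" using L t_pos by (simp add: s_def)
    have N0: "0 < real (N L)" using N_pos[OF L] by simp
    have U: "U_rep (N L) (d L) (\<pi> L) (S i L) = c i L \<cdot>\<^sub>m 1\<^sub>m (d L)" if i: "i \<in> {1..m}" for i
      using immanants[OF i L len[OF i]] sign[OF L] irr[OF L] by (auto simp: quantum_immanant_def c_def)
    have "fock_expect (time_space (d L)) (state_vec (\<psi> L) (s L))
          (foldr (\<lambda>i T. X_tilde (N L) (d L) (\<pi> L) (\<psi> L) (\<mu> i) (S i L) (s L) \<circ> T) [1..<Suc m] id)
        = (\<Prod>i=1..m. c i L / complex_of_real (real (N L) powr (real (sum_list (\<mu> i)) + 1 / 2))) * poisson_central m (s L)"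
      unfolding poisson_central_def
      by (rule fock_expect_X_tilde_prod) (use s0 unit[OF L] U in auto)
    also have "(\<Prod>i=1..m. c i L / complex_of_real (real (N L) powr (real (sum_list (\<mu> i)) + 1 / 2)))
        = (\<Prod>i=1..m. (c i L / of_nat (N L) ^ sum_list (\<mu> i)) / of_real (real (N L) powr (1 / 2)))"
      using N0 by (intro prod.cong refl) (simp add: powr_add powr_realpow)
    also have "\<dots> = (\<Prod>i=1..m. c i L / of_nat (N L) ^ sum_list (\<mu> i)) / of_real (real (N L) powr (m / 2))"
    proof -
      have "(real (N L) powr (1 / 2)) ^ m = real (N L) powr (m / 2)"
        using N0 by (simp add: powr_power)
      then show ?thesis by (simp add: prod_dividef flip: of_real_power)
    qed
    also have "\<dots> * poisson_central m (s L) = (\<Prod>i=1..m. c i L / of_nat (N L) ^ sum_list (\<mu> i))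
        * (poisson_central m (s L) / of_real (s L powr (m / 2))) * of_real ((s L / real (N L)) powr (m / 2))"
      using s0 N0 by (simp add: powr_divide)
    finally show ?case unfolding s_def by (rule sym)
  qed
  with lim have "(\<lambda>L. fock_expect (time_space (d L)) (state_vec (\<psi> L) (real L * t))
          (foldr (\<lambda>i T. X_tilde (N L) (d L) (\<pi> L) (\<psi> L) (\<mu> i) (S i L) (real L * t) \<circ> T) [1..<Suc m] id))
      \<longlonglongrightarrow> (\<Prod>i=1..m. schur_omega (\<mu> i) \<omega>) * of_nat (gauss_moment m) * of_real (t powr (m / 2))"
    by (rule Lim_transform_eventually)
  also have "(\<Prod>i=1..m. schur_omega (\<mu> i) \<omega>) * of_nat (gauss_moment m) * of_real (t powr (m / 2))
      = (if even m then \<Sum>P\<in>pair_partitions m. \<Prod>B\<in>P. complex_of_real t * (\<Prod>i\<in>B. schur_omega (\<mu> i) \<omega>) else 0)"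
  proof (cases "even m")
    case True
    then have "t powr (m / 2) = t ^ (m div 2)" using t_pos by (simp flip: powr_realpow add: real_of_nat_div)
    then show ?thesis unfolding sum_pair_partitions using True by (simp add: mult_ac)
  qed (simp add: gauss_moment_odd)
  finally show ?thesis .
qed

end
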